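(* Let $G$ be a compact (Hausdorff) second countable group. Then $G$ is locally random if and only if for every positive integer $n$, $G$ has only finitely many pairwise non-isomorphic irreducible unitary representations of degree (dimension) $n$.
   Context: Let $G$ be a compact group and $d$ a bi-invariant metric on $G$ compatible with (i.e. inducing) its topology. For $C_0\ge 1$ and $L\ge 1$, $(G,d)$ is called $L$-locally random with coefficient $C_0$ if for every irreducible (continuous, hence finite-dimensional) unitary representation $\pi$ of $G$ and all $x,y\in G$, $$\|\pi(x)-\pi(y)\|_{\mathrm{op}}\le C_0(\dim\pi)^L d(x,y),$$ where $\|\cdot\|_{\mathrm{op}}$ is the operator norm. The compact group $G$ is called locally random if $(G,d)$ is $L$-locally random with coefficient $C_0$ for some compatible bi-invariant metric $d$ on $G$ and some values $L\ge1$, $C_0\ge 1$. *)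

theory Defs
  imports
    "HOL-Analysis.Abstract_Metric_Spaces"
    "HOL-Analysis.L2_Norm"
    "Jordan_Normal_Form.Schur_Decomposition"
begin

locale topological_group = group G for G (structure) +
  fixes T :: "'a topology"
  assumes topspace_eq: "topspace T = carrier G"
    and continuous_mult: "continuous_map (prod_topology T T) T (\<lambda>(x, y). x \<otimes> y)"
    and continuous_inv: "continuous_map T T (\<lambda>x. inv x)"

definition vec_l2norm :: "complex vec \<Rightarrow> real" where
  "vec_l2norm v = L2_set (\<lambda>i. cmod (v $ i)) {..<dim_vec v}"

definition op_norm :: "complex mat \<Rightarrow> real" where
  "op_norm A = (SUP v \<in> {v \<in> carrier_vec (dim_col A). vec_l2norm v \<le> 1}. vec_l2norm (A *\<^sub>v v))"

definition unitary_group :: "nat \<Rightarrow> complex mat monoid" where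
  "unitary_group n =
    \<lparr>carrier = {U \<in> carrier_mat n n. U * mat_adjoint U = 1\<^sub>m n \<and> mat_adjoint U * U = 1\<^sub>m n},
     monoid.mult = (*), one = 1\<^sub>m n\<rparr>"

text \<open>
  An \<open>n\<close>-dimensional unitary representation is realised on \<open>\<complex>\<^sup>n\<close>, i.e. as a homomorphism into the
  unitary matrices. Since all vector space topologies on the \<open>n \<times> n\<close> matrices coincide, continuity
  is continuity of the matrix entries. Values of \<open>\<pi>\<close> outside \<open>carrier G\<close> are irrelevant.
\<close>

definition unitary_rep ::
    "('a, 'b) monoid_scheme \<Rightarrow> 'a topology \<Rightarrow> nat \<Rightarrow> ('a \<Rightarrow> complex mat) \<Rightarrow> bool" where
  "unitary_rep G T n \<pi> \<longleftrightarrow>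
    \<pi> \<in> hom G (unitary_group n) \<and>
    (\<forall>i<n. \<forall>j<n. continuous_map T euclidean (\<lambda>g. \<pi> g $$ (i, j)))"

definition irreducible_unitary_rep ::
    "('a, 'b) monoid_scheme \<Rightarrow> 'a topology \<Rightarrow> nat \<Rightarrow> ('a \<Rightarrow> complex mat) \<Rightarrow> bool" where
  "irreducible_unitary_rep G T n \<pi> \<longleftrightarrow>
    unitary_rep G T n \<pi> \<and> 0 < n \<and>
    (\<forall>W. VectorSpace.subspace class_ring W (module_vec TYPE(complex) n) \<longrightarrow>
         (\<forall>g \<in> carrier G. \<forall>w \<in> W. \<pi> g *\<^sub>v w \<in> W) \<longrightarrow>
         W = {0\<^sub>v n} \<or> W = carrier_vec n)"

definition isomorphic_reps ::
    "('a, 'b) monoid_scheme \<Rightarrow> nat \<Rightarrow> ('a \<Rightarrow> complex mat) \<Rightarrow> ('a \<Rightarrow> complex mat) \<Rightarrow> bool" where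
  "isomorphic_reps G n \<pi> \<sigma> \<longleftrightarrow>
    (\<exists>P \<in> carrier_mat n n. invertible_mat P \<and> (\<forall>g \<in> carrier G. P * \<pi> g = \<sigma> g * P))"

definition irrep_classes ::
    "('a, 'b) monoid_scheme \<Rightarrow> 'a topology \<Rightarrow> nat \<Rightarrow> ('a \<Rightarrow> complex mat) set set" where
  "irrep_classes G T n =
    {\<pi>. irreducible_unitary_rep G T n \<pi>} //
      {(\<pi>, \<sigma>). irreducible_unitary_rep G T n \<pi> \<and> irreducible_unitary_rep G T n \<sigma> \<and>
                isomorphic_reps G n \<pi> \<sigma>}"

definition compatible_biinvariant_metric ::
    "('a, 'b) monoid_scheme \<Rightarrow> 'a topology \<Rightarrow> ('a \<Rightarrow> 'a \<Rightarrow> real) \<Rightarrow> bool" where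
  "compatible_biinvariant_metric G T d \<longleftrightarrow>
    Metric_space (carrier G) d \<and> Metric_space.mtopology (carrier G) d = T \<and>
    (\<forall>g \<in> carrier G. \<forall>x \<in> carrier G. \<forall>y \<in> carrier G.
       d (g \<otimes>\<^bsub>G\<^esub> x) (g \<otimes>\<^bsub>G\<^esub> y) = d x y \<and> d (x \<otimes>\<^bsub>G\<^esub> g) (y \<otimes>\<^bsub>G\<^esub> g) = d x y)"

definition locally_random_wrt ::
    "('a, 'b) monoid_scheme \<Rightarrow> 'a topology \<Rightarrow> ('a \<Rightarrow> 'a \<Rightarrow> real) \<Rightarrow> real \<Rightarrow> real \<Rightarrow> bool" where
  "locally_random_wrt G T d L C \<longleftrightarrow>
    (\<forall>n \<pi>. irreducible_unitary_rep G T n \<pi> \<longrightarrow>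
       (\<forall>x \<in> carrier G. \<forall>y \<in> carrier G. op_norm (\<pi> x - \<pi> y) \<le> C * real n powr L * d x y))"

definition locally_random :: "('a, 'b) monoid_scheme \<Rightarrow> 'a topology \<Rightarrow> bool" where
  "locally_random G T \<longleftrightarrow>
    (\<exists>d L C. compatible_biinvariant_metric G T d \<and> 1 \<le> L \<and> 1 \<le> C \<and> locally_random_wrt G T d L C)"

end

theory Submission
  imports Defs "HOL-Complex_Analysis.Great_Picard" "Jordan_Normal_Form.Spectral_Radius"
begin

text \<open>
  Suppose first that \<open>G\<close> is locally random for a metric \<open>d\<close>. For a fixed degree \<open>n\<close> all irreducible
  representations are Lipschitz for \<open>d\<close> with one common constant, so, \<open>G\<close> being compact, such a
  representation is determined up to a small uniform error by finitely much data: its matrix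
  entries, rounded to a grid, at the points of a finite net. Two irreducible representations that
  are uniformly close are isomorphic (\<open>close_reps_isomorphic\<close>): the Haar mean of
  \<open>\<sigma> g * \<pi> (inv g)\<close> intertwines them, its trace is close to \<open>n\<close>, so it does not vanish, and by
  Schur's lemma it is invertible. Hence there are only finitely many classes of degree \<open>n\<close>.

  For the converse let \<open>d x y\<close> be the supremum of \<open>\<parallel>\<pi> x - \<pi> y\<parallel> / dim \<pi>\<close> over all irreducible \<open>\<pi>\<close>
  (\<open>rep_dist\<close>). Local randomness with \<open>L = C = 1\<close> and bi-invariance are built into this formula.
  Representations of large degree contribute little, because \<open>\<parallel>\<pi> x - \<pi> y\<parallel> \<le> 2\<close>; those of bounded
  degree fall into finitely many classes, and isomorphic irreducible representations give the same
  norms, because by Schur's lemma an intertwiner is a multiple of a unitary matrix. So \<open>d\<close> is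
  continuous. It vanishes only on the diagonal because irreducible representations separate points
  (\<open>irreducible_reps_separate\<close>, the theorem of Peter and Weyl), and a continuous metric on a compact
  space induces the topology of that space.

  The Haar mean is constructed on continuous functions only, without measure theory. Among the
  averages of left translates of a real function there are some that are nearly constant, since
  otherwise a further averaging would push the maximum below its infimum
  (\<open>real_left_average_near_constant\<close>). Comparing averages of left translates with averages of right
  translates shows that the constant is unique and depends linearly on the function.

  For the theorem of Peter and Weyl let \<open>h\<close> be a non-zero continuous function orthogonal to all
  coefficients of irreducible representations. The operator \<open>A f = (x \<mapsto> \<integral> cnj (h y) f (y x) dy)\<close>
  commutes with right translations, preserves the space of such functions, is compact, and does not
  vanish since it maps \<open>h\<close> to a function with value \<open>\<parallel>h\<parallel>\<^sup>2\<close> at \<open>\<one>\<close>. So \<open>A A\<^sup>*\<close> has a positive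
  eigenvalue (\<open>singular_vector_exists\<close>), whose eigenspace is invariant under right translations and
  finite-dimensional (\<open>orthonormal_card_bound\<close>). A minimal invariant subspace of it carries an irreducible representation
  whose coefficients span it (\<open>invariant_space_contains_irreducible\<close>), which contradicts
  orthogonality.
\<close>

unbundle no vec_syntax

section \<open>Uniform continuity and equicontinuity over compact spaces\<close>

text \<open>
  The tube lemma, applied to the open set of points where \<open>F\<close> is close to its value on the slice
  over \<open>y0\<close>. All uniform continuity and equicontinuity statements below are instances of it.
\<close>

lemma continuous_map_uniform_nbhd:
  fixes F :: "'x \<times> 'y \<Rightarrow> 'b::metric_space"
  assumes "compact_space X" and F: "continuous_map (prod_topology X Y) euclidean F"
    and y0: "y0 \<in> topspace Y" and e: "e > 0"
  obtains V where "openin Y V" "y0 \<in> V" "\<And>x y. x \<in> topspace X \<Longrightarrow> y \<in> V \<Longrightarrow> dist (F (x, y)) (F (x, y0)) < e"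
proof -
  let ?P = "prod_topology X Y"
  let ?W = "{z \<in> topspace ?P. dist (F z) (F (fst z, y0)) \<in> {..<e}}"
  have "continuous_map ?P ?P (\<lambda>z. (fst z, y0))"
    using y0 by (auto simp: continuous_map_pairwise o_def intro: continuous_map_fst)
  then have F0: "continuous_map ?P euclidean (\<lambda>z. F (fst z, y0))"
    using continuous_map_compose[OF _ F] by (auto simp: o_def)
  have "continuous_map ?P euclidean (\<lambda>z. dist (F z) (F (fst z, y0)))"
    using F F0 by (simp add: continuous_map_atin tendsto_dist)
  then have "openin ?P ?W"
    by (rule openin_continuous_map_preimage) simp
  moreover have "topspace X \<times> {y0} \<subseteq> ?W" using y0 e by auto
  ultimately obtain U V where "openin X U" "openin Y V" "topspace X \<subseteq> U" "y0 \<in> V" "U \<times> V \<subseteq> ?W"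
    using tube_lemma_left[of X Y ?W "topspace X" y0] assms by (auto simp: compact_space_def)
  then show thesis
    using that[of V] by (auto simp: subset_iff)
qed

text \<open>
  The functions \<open>\<lambda>x. F (x, y)\<close> form a totally bounded family in the supremum norm.
\<close>

lemma continuous_map_uniform_net:
  fixes F :: "'x \<times> 'y \<Rightarrow> 'b::metric_space"
  assumes X: "compact_space X" and Y: "compact_space Y"
    and F: "continuous_map (prod_topology X Y) euclidean F" and e: "e > 0"
  obtains C where "finite C" "C \<subseteq> topspace Y"
    "\<And>y. y \<in> topspace Y \<Longrightarrow> \<exists>c\<in>C. \<forall>x\<in>topspace X. dist (F (x, y)) (F (x, c)) < e"
proof -
  have "\<exists>V. openin Y V \<and> y0 \<in> V \<and> (\<forall>x\<in>topspace X. \<forall>y\<in>V. dist (F (x, y)) (F (x, y0)) < e)"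
    if "y0 \<in> topspace Y" for y0
    using continuous_map_uniform_nbhd[OF X F that e] by metis
  then obtain V where V: "\<And>y0. y0 \<in> topspace Y \<Longrightarrow> openin Y (V y0) \<and> y0 \<in> V y0 \<and>
      (\<forall>x\<in>topspace X. \<forall>y\<in>V y0. dist (F (x, y)) (F (x, y0)) < e)"
    by metis
  have "\<exists>\<F>. finite \<F> \<and> \<F> \<subseteq> V ` topspace Y \<and> topspace Y \<subseteq> \<Union>\<F>"
  proof -
    have "\<forall>U\<in>V ` topspace Y. openin Y U" "topspace Y \<subseteq> \<Union>(V ` topspace Y)" using V by auto
    then show ?thesis using Y unfolding compact_space_alt by blast
  qed
  then obtain C where C: "finite C" "C \<subseteq> topspace Y" "topspace Y \<subseteq> \<Union>(V ` C)"
    by (metis finite_subset_image)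
  show thesis
  proof (rule that[OF C(1,2)])
    fix y assume "y \<in> topspace Y"
    then obtain c where "c \<in> C" "y \<in> V c" using C(3) by blast
    then show "\<exists>c\<in>C. \<forall>x\<in>topspace X. dist (F (x, y)) (F (x, c)) < e"
      using V[of c] C(2) by blast
  qed
qed

text \<open>
  Arzela-Ascoli. Equicontinuity takes the form of finite nets that serve all members of the sequence
  at once. A diagonal sequence converges on the countable
  union of the nets, and the nets make the convergence uniform.
\<close>

lemma uniformly_convergent_subsequence:
  fixes g :: "nat \<Rightarrow> 'x \<Rightarrow> complex"
  assumes B: "\<And>n x. x \<in> S \<Longrightarrow> cmod (g n x) \<le> B"
    and eq: "\<And>e. e > 0 \<Longrightarrow> \<exists>C. finite C \<and> C \<subseteq> S \<and> (\<forall>x\<in>S. \<exists>c\<in>C. \<forall>n. cmod (g n x - g n c) \<le> e)"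
  obtains r u where "strict_mono (r :: nat \<Rightarrow> nat)" "uniform_limit S (\<lambda>n. g (r n)) u sequentially"
proof -
  have "\<exists>C. \<forall>k. finite (C k) \<and> C k \<subseteq> S \<and> (\<forall>x\<in>S. \<exists>c\<in>C k. \<forall>n. cmod (g n x - g n c) \<le> inverse (real (Suc k)))"
    by (rule choice) (use eq in simp)
  then obtain C where C: "\<And>k. finite (C k)" "\<And>k. C k \<subseteq> S"
    "\<And>k x. x \<in> S \<Longrightarrow> \<exists>c\<in>C k. \<forall>n. cmod (g n x - g n c) \<le> inverse (real (Suc k))"
    by blast
  have cnt: "countable (\<Union>k. C k)" using C(1) by (simp add: countable_finite)
  have bd: "\<And>n x. x \<in> (\<Union>k. C k) \<Longrightarrow> norm (g n x) \<le> B" using C(2) B by blast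
  have "\<exists>r :: nat \<Rightarrow> nat. strict_mono r \<and> (\<forall>x\<in>(\<Union>k. C k). \<exists>l. (\<lambda>n. g (r n) x) \<longlonglongrightarrow> l)"
    by (rule function_convergent_subsequence[of "\<Union>k. C k" g B, OF cnt bd])
      (assumption, rule exI, rule conjI, assumption, rule ballI, simp only:)
  then obtain r where r: "strict_mono (r :: nat \<Rightarrow> nat)" "\<And>x. x \<in> (\<Union>k. C k) \<Longrightarrow> \<exists>l. (\<lambda>n. g (r n) x) \<longlonglongrightarrow> l"
    by blast
  have "uniformly_Cauchy_on S (\<lambda>n. g (r n))"
    unfolding uniformly_Cauchy_on_def
  proof (intro allI impI)
    fix e :: real assume "e > 0"
    then obtain k where k: "inverse (real (Suc k)) < e / 3" using reals_Archimedean[of "e / 3"] by auto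
    have "\<exists>N. \<forall>m\<ge>N. \<forall>n\<ge>N. \<forall>c\<in>C k. dist (g (r m) c) (g (r n) c) < e / 3"
    proof -
      have "\<forall>c\<in>C k. \<exists>N. \<forall>m\<ge>N. \<forall>n\<ge>N. dist (g (r m) c) (g (r n) c) < e / 3"
      proof
        fix c assume "c \<in> C k"
        then have "Cauchy (\<lambda>n. g (r n) c)" using r(2) LIMSEQ_imp_Cauchy by blast
        then show "\<exists>N. \<forall>m\<ge>N. \<forall>n\<ge>N. dist (g (r m) c) (g (r n) c) < e / 3"
          using \<open>e > 0\<close> unfolding Cauchy_def by (elim allE[of _ "e / 3"]) simp
      qed
      from bchoice[OF this] obtain N where N: "\<And>c m n. c \<in> C k \<Longrightarrow> m \<ge> N c \<Longrightarrow> n \<ge> N c \<Longrightarrow>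
        dist (g (r m) c) (g (r n) c) < e / 3"
        by blast
      have "dist (g (r m) c) (g (r n) c) < e / 3" if "m \<ge> Max (N ` C k)" "n \<ge> Max (N ` C k)" "c \<in> C k" for m n c
      proof -
        have "N c \<le> Max (N ` C k)" using C(1) that(3) by simp
        then show ?thesis using that by (intro N) auto
      qed
      then show ?thesis by blast
    qed
    then obtain N where N: "\<And>m n c. m \<ge> N \<Longrightarrow> n \<ge> N \<Longrightarrow> c \<in> C k \<Longrightarrow> dist (g (r m) c) (g (r n) c) < e / 3" by blast
    have "dist (g (r m) x) (g (r n) x) < e" if x: "x \<in> S" and mn: "m \<ge> N" "n \<ge> N" for x m n
    proof -
      obtain c where c: "c \<in> C k" "\<And>n. cmod (g n x - g n c) \<le> inverse (real (Suc k))" using C(3)[OF x] by blast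
      have "dist (g (r m) x) (g (r n) x) \<le> dist (g (r m) x) (g (r m) c) + dist (g (r m) c) (g (r n) c) +
        dist (g (r n) c) (g (r n) x)"
        using dist_triangle[of "g (r m) x" "g (r n) x" "g (r m) c"] dist_triangle[of "g (r m) c" "g (r n) x"
          "g (r n) c"] by linarith
      then show ?thesis
        using c(2)[of "r m"] c(2)[of "r n"] N[OF mn c(1)] k by (simp add: dist_norm norm_minus_commute)
    qed
    then show "\<exists>N0. \<forall>x\<in>S. \<forall>m\<ge>N0. \<forall>n\<ge>N0. dist (g (r m) x) (g (r n) x) < e" by blast
  qed
  then have "uniformly_convergent_on S (\<lambda>n. g (r n))" by (rule Cauchy_uniformly_convergent)
  then show thesis using that r(1) unfolding uniformly_convergent_on_def by blast
qed

section \<open>Averages over finite lists\<close>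

text \<open>
  Averages are taken over lists, so that repetitions give rational weights and the list of products
  of two lists stands for the composition of two averagings.
\<close>

definition avg :: "'i list \<Rightarrow> ('i \<Rightarrow> 'b::real_normed_field) \<Rightarrow> 'b" where
  "avg xs f = (\<Sum>x\<leftarrow>xs. f x) / of_nat (length xs)"

lemma avg_cong: "(\<And>x. x \<in> set xs \<Longrightarrow> f x = g x) \<Longrightarrow> avg xs f = avg xs g"
  unfolding avg_def by (metis (mono_tags, lifting) map_cong)

lemma avg_add: "avg xs (\<lambda>x. f x + g x) = avg xs f + avg xs g"
  by (simp add: avg_def sum_list_addf add_divide_distrib)

lemma avg_cmult: "avg xs (\<lambda>x. c * f x) = c * avg xs f"
  by (simp add: avg_def sum_list_const_mult)

lemma avg_diff: "avg xs (\<lambda>x. f x - g x) = avg xs f - avg xs g"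
  by (simp add: avg_def sum_list_subtractf diff_divide_distrib)

lemma avg_const: "xs \<noteq> [] \<Longrightarrow> avg xs (\<lambda>_. c) = c"
  by (simp add: avg_def sum_list_triv)

lemma avg_map: "avg (map h xs) f = avg xs (\<lambda>x. f (h x))"
  by (simp add: avg_def o_def)

lemma avg_of_real: "avg xs (\<lambda>x. of_real (f x)) = of_real (avg xs f)"
proof -
  have "(\<Sum>x\<leftarrow>xs. of_real (f x)) = (of_real (\<Sum>x\<leftarrow>xs. f x) :: 'a)" by (induction xs) auto
  then show ?thesis by (simp add: avg_def)
qed

lemma avg_cnj: "avg xs (\<lambda>x. cnj (f x)) = cnj (avg xs f)"
proof -
  have "(\<Sum>x\<leftarrow>xs. cnj (f x)) = cnj (\<Sum>x\<leftarrow>xs. f x)" by (induction xs) auto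
  then show ?thesis by (simp add: avg_def)
qed

lemma avg_swap: "avg xs (\<lambda>x. avg ys (\<lambda>y. f x y)) = avg ys (\<lambda>y. avg xs (\<lambda>x. f x y))"
proof -
  have "(\<Sum>x\<leftarrow>xs. \<Sum>y\<leftarrow>ys. f x y) = (\<Sum>y\<leftarrow>ys. \<Sum>x\<leftarrow>xs. f x y)"
    by (induction xs) (auto simp: sum_list_addf)
  then have "(\<Sum>x\<leftarrow>xs. (\<Sum>y\<leftarrow>ys. f x y) / of_nat (length ys)) / of_nat (length xs) =
    (\<Sum>y\<leftarrow>ys. (\<Sum>x\<leftarrow>xs. f x y) / of_nat (length xs)) / of_nat (length ys)"
    by (simp add: divide_inverse sum_list_mult_const)
  then show ?thesis by (simp add: avg_def)
qed

lemma avg_product: "avg (List.product xs ys) (\<lambda>(x, y). f x y) = avg xs (\<lambda>x. avg ys (\<lambda>y. f x y))"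
proof -
  have "(\<Sum>(x, y)\<leftarrow>List.product xs ys. f x y) = (\<Sum>x\<leftarrow>xs. \<Sum>y\<leftarrow>ys. f x y)"
    by (induction xs) (auto simp: o_def)
  then show ?thesis
    by (simp add: avg_def divide_inverse sum_list_mult_const)
qed

lemma avg_le:
  fixes f :: "'i \<Rightarrow> real"
  assumes "xs \<noteq> []" "\<And>x. x \<in> set xs \<Longrightarrow> f x \<le> s"
  shows "avg xs f \<le> s"
proof -
  have "(\<Sum>x\<leftarrow>xs. f x) \<le> (\<Sum>x\<leftarrow>xs. s)" using assms(2) by (intro sum_list_mono) auto
  then show ?thesis using assms(1) by (simp add: avg_def sum_list_triv divide_simps mult.commute)
qed

lemma avg_mono:
  fixes f :: "'i \<Rightarrow> real"
  assumes "\<And>x. x \<in> set xs \<Longrightarrow> f x \<le> g x"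
  shows "avg xs f \<le> avg xs g"
  unfolding avg_def using assms by (intro divide_right_mono sum_list_mono) auto

lemma norm_avg_le:
  assumes "xs \<noteq> []" "\<And>x. x \<in> set xs \<Longrightarrow> norm (f x) \<le> e"
  shows "norm (avg xs f) \<le> e"
proof -
  have "norm (\<Sum>x\<leftarrow>xs. f x) \<le> (\<Sum>x\<leftarrow>xs. norm (f x))"
  proof (induction xs)
    case (Cons a xs)
    then show ?case using norm_triangle_ineq[of "f a" "\<Sum>x\<leftarrow>xs. f x"] by auto
  qed simp
  then have "norm (avg xs f) \<le> avg xs (\<lambda>x. norm (f x))"
    by (simp add: avg_def norm_divide divide_right_mono)
  also have "\<dots> \<le> e" using assms by (rule avg_le)
  finally show ?thesis .
qed

lemma norm_avg_diff_le:
  assumes "xs \<noteq> []" "\<And>x. x \<in> set xs \<Longrightarrow> norm (f x - c) \<le> e"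
  shows "norm (avg xs f - c) \<le> e"
  using norm_avg_le[of xs "\<lambda>x. f x - c" e] assms by (simp add: avg_diff avg_const)

text \<open>
  One small term in the list lowers the average by a definite amount. This is the quantitative step
  both in the construction of the Haar mean and in its strict positivity.
\<close>

lemma avg_le_drop:
  fixes f :: "'i \<Rightarrow> real"
  assumes "\<And>x. x \<in> set xs \<Longrightarrow> f x \<le> s" "b \<in> set xs" "f b \<le> t"
  shows "avg xs f \<le> s - (s - t) / length xs"
proof -
  obtain ys zs where xs: "xs = ys @ b # zs" using assms(2) by (metis split_list)
  have "(\<Sum>x\<leftarrow>ys. f x) \<le> (\<Sum>x\<leftarrow>ys. s)" "(\<Sum>x\<leftarrow>zs. f x) \<le> (\<Sum>x\<leftarrow>zs. s)"
    using assms(1) xs by (auto intro!: sum_list_mono)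
  then have "(\<Sum>x\<leftarrow>xs. f x) \<le> length xs * s - (s - t)"
    using assms(3) by (simp add: xs sum_list_triv algebra_simps)
  moreover have "length xs > 0" using xs by simp
  ultimately show ?thesis by (simp add: avg_def divide_simps mult.commute)
qed

lemma continuous_map_avg:
  fixes f :: "'i \<Rightarrow> 'x \<Rightarrow> 'b::real_normed_field"
  assumes "\<And>i. i \<in> set xs \<Longrightarrow> continuous_map X euclidean (f i)"
  shows "continuous_map X euclidean (\<lambda>x. avg xs (\<lambda>i. f i x))"
proof -
  have "continuous_map X euclidean (\<lambda>x. \<Sum>i\<leftarrow>xs. f i x)"
    using assms
  proof (induction xs)
    case (Cons i xs)
    then show ?case by (auto simp: continuous_map_atin intro!: tendsto_add)
  qed simp
  then show ?thesis
    unfolding avg_def divide_inverse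
    by (auto simp: continuous_map_atin intro!: tendsto_mult_right)
qed

section \<open>The operator norm\<close>

lemma vec_l2norm_nonneg: "0 \<le> vec_l2norm v"
  by (simp add: vec_l2norm_def L2_set_nonneg)

lemma vec_l2norm_0: "vec_l2norm (0\<^sub>v n) = 0"
  by (simp add: vec_l2norm_def L2_set_def)

lemma vec_l2norm_square:
  assumes "v \<in> carrier_vec n" shows "complex_of_real ((vec_l2norm v)\<^sup>2) = v \<bullet>c v"
proof -
  have "(vec_l2norm v)\<^sup>2 = (\<Sum>i<n. (cmod (v $ i))\<^sup>2)"
    using assms by (simp add: vec_l2norm_def L2_set_def sum_nonneg)
  also have "complex_of_real \<dots> = (\<Sum>i<n. v $ i * cnj (v $ i))"
    by (simp add: complex_norm_square[symmetric] del: of_real_power)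
  finally show ?thesis using assms
    by (simp add: scalar_prod_def conjugate_complex_def lessThan_atLeast0)
qed

lemma vec_l2norm_smult: "vec_l2norm (c \<cdot>\<^sub>v v) = cmod c * vec_l2norm v"
proof -
  have "vec_l2norm (c \<cdot>\<^sub>v v) = L2_set (\<lambda>i. cmod c * cmod (v $ i)) {..<dim_vec v}"
    unfolding vec_l2norm_def by (rule L2_set_cong) (auto simp: norm_mult)
  then show ?thesis by (simp add: vec_l2norm_def L2_set_right_distrib)
qed

lemma vec_l2norm_triangle:
  assumes "v \<in> carrier_vec n" "w \<in> carrier_vec n"
  shows "vec_l2norm (v + w) \<le> vec_l2norm v + vec_l2norm w"
proof -
  have "vec_l2norm (v + w) \<le> L2_set (\<lambda>i. cmod (v $ i) + cmod (w $ i)) {..<n}"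
    unfolding vec_l2norm_def using assms by (auto intro!: L2_set_mono norm_triangle_ineq)
  also have "\<dots> \<le> vec_l2norm v + vec_l2norm w"
    unfolding vec_l2norm_def using assms L2_set_triangle_ineq by auto
  finally show ?thesis .
qed

lemma norm_index_le_vec_l2norm: "v \<in> carrier_vec n \<Longrightarrow> i < n \<Longrightarrow> cmod (v $ i) \<le> vec_l2norm v"
  unfolding vec_l2norm_def by (auto intro: member_le_L2_set)

lemma vec_l2norm_le_sum: "v \<in> carrier_vec n \<Longrightarrow> vec_l2norm v \<le> (\<Sum>i<n. cmod (v $ i))"
  unfolding vec_l2norm_def using L2_set_le_sum[of "{..<n}" "\<lambda>i. cmod (v $ i)"] by auto

lemma vec_l2norm_eq_0: "v \<in> carrier_vec n \<Longrightarrow> vec_l2norm v = 0 \<Longrightarrow> v = 0\<^sub>v n"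
  using norm_index_le_vec_l2norm by (intro eq_vecI) fastforce+

lemma mat_mult_index_sum:
  "A \<in> carrier_mat n n \<Longrightarrow> B \<in> carrier_mat n n \<Longrightarrow> i < n \<Longrightarrow> j < n \<Longrightarrow>
    (A * B) $$ (i, j) = (\<Sum>k<n. A $$ (i, k) * B $$ (k, j))"
  by (auto simp: scalar_prod_def lessThan_atLeast0)

text \<open>
  A crude bound of the operator norm that depends continuously on the entries; it gives finiteness of
  the operator norm and continuity of \<open>y \<mapsto> \<parallel>\<pi> x - \<pi> y\<parallel>\<close>.
\<close>

definition entry_sum :: "nat \<Rightarrow> complex mat \<Rightarrow> real" where
  "entry_sum n A = (\<Sum>i<n. \<Sum>j<n. cmod (A $$ (i, j)))"

lemma entry_sum_nonneg: "0 \<le> entry_sum n A"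
  unfolding entry_sum_def by (intro sum_nonneg) auto

lemma vec_l2norm_mult_le_entry_sum:
  assumes A: "A \<in> carrier_mat n n" and v: "v \<in> carrier_vec n"
  shows "vec_l2norm (A *\<^sub>v v) \<le> entry_sum n A * vec_l2norm v"
proof -
  have "vec_l2norm (A *\<^sub>v v) \<le> (\<Sum>i<n. cmod ((A *\<^sub>v v) $ i))"
    using A v by (intro vec_l2norm_le_sum) auto
  also have "\<dots> \<le> (\<Sum>i<n. \<Sum>j<n. cmod (A $$ (i, j)) * vec_l2norm v)"
  proof (rule sum_mono)
    fix i assume i: "i \<in> {..<n}"
    have "(A *\<^sub>v v) $ i = (\<Sum>j<n. A $$ (i, j) * v $ j)"
      using A v i by (simp add: scalar_prod_def lessThan_atLeast0)
    also have "cmod \<dots> \<le> (\<Sum>j<n. cmod (A $$ (i, j)) * vec_l2norm v)"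
      using norm_index_le_vec_l2norm[OF v]
      by (intro sum_norm_le) (auto simp: norm_mult intro: mult_left_mono)
    finally show "cmod ((A *\<^sub>v v) $ i) \<le> (\<Sum>j<n. cmod (A $$ (i, j)) * vec_l2norm v)" .
  qed
  also have "\<dots> = entry_sum n A * vec_l2norm v" by (simp add: entry_sum_def sum_distrib_right)
  finally show ?thesis .
qed

lemma op_norm_bdd_above:
  assumes "A \<in> carrier_mat n n"
  shows "bdd_above ((\<lambda>v. vec_l2norm (A *\<^sub>v v)) ` {v \<in> carrier_vec (dim_col A). vec_l2norm v \<le> 1})"
proof (rule bdd_aboveI2)
  fix v assume "v \<in> {v \<in> carrier_vec (dim_col A). vec_l2norm v \<le> 1}"
  then have v: "v \<in> carrier_vec n" "vec_l2norm v \<le> 1" using assms by auto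
  show "vec_l2norm (A *\<^sub>v v) \<le> entry_sum n A"
    using vec_l2norm_mult_le_entry_sum[OF assms v(1)] mult_left_mono[OF v(2) entry_sum_nonneg[of n A]] by simp
qed

lemma op_norm_le:
  assumes A: "A \<in> carrier_mat n n" and c: "c \<ge> 0"
    and le: "\<And>v. v \<in> carrier_vec n \<Longrightarrow> vec_l2norm (A *\<^sub>v v) \<le> c * vec_l2norm v"
  shows "op_norm A \<le> c"
  unfolding op_norm_def
proof (rule cSUP_least)
  show "{v \<in> carrier_vec (dim_col A). vec_l2norm v \<le> 1} \<noteq> {}"
  proof -
    have "0\<^sub>v (dim_col A) \<in> {v \<in> carrier_vec (dim_col A). vec_l2norm v \<le> 1}" by (simp add: vec_l2norm_0)
    then show ?thesis by blast
  qed
  fix v assume "v \<in> {v \<in> carrier_vec (dim_col A). vec_l2norm v \<le> 1}"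
  then have v: "v \<in> carrier_vec n" "vec_l2norm v \<le> 1" using A by auto
  show "vec_l2norm (A *\<^sub>v v) \<le> c" using le[OF v(1)] mult_left_mono[OF v(2) c] by simp
qed

lemma op_norm_nonneg:
  assumes A: "A \<in> carrier_mat n n" shows "0 \<le> op_norm A"
proof -
  have "vec_l2norm (A *\<^sub>v 0\<^sub>v n) \<le> op_norm A"
    unfolding op_norm_def using A vec_l2norm_0[of n] by (intro cSUP_upper op_norm_bdd_above[OF A]) auto
  then show ?thesis using vec_l2norm_nonneg[of "A *\<^sub>v 0\<^sub>v n"] by linarith
qed

lemma vec_l2norm_mult_le:
  assumes A: "A \<in> carrier_mat n n" and v: "v \<in> carrier_vec n"
  shows "vec_l2norm (A *\<^sub>v v) \<le> op_norm A * vec_l2norm v"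
proof (cases "vec_l2norm v = 0")
  case True
  then show ?thesis using vec_l2norm_mult_le_entry_sum[OF A v] by simp
next
  case False
  then have pos: "vec_l2norm v > 0" using vec_l2norm_nonneg[of v] by linarith
  let ?c = "complex_of_real (1 / vec_l2norm v)"
  let ?w = "?c \<cdot>\<^sub>v v"
  have w: "?w \<in> carrier_vec n" "vec_l2norm ?w = 1" using v pos unfolding vec_l2norm_smult
    by (auto simp: norm_divide)
  have "vec_l2norm (A *\<^sub>v ?w) \<le> op_norm A"
    unfolding op_norm_def using A w by (intro cSUP_upper op_norm_bdd_above[OF A]) auto
  moreover have "A *\<^sub>v ?w = ?c \<cdot>\<^sub>v (A *\<^sub>v v)" using A v by (rule mult_mat_vec)
  moreover have "vec_l2norm (?c \<cdot>\<^sub>v (A *\<^sub>v v)) = vec_l2norm (A *\<^sub>v v) / vec_l2norm v"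
    using pos unfolding vec_l2norm_smult by (simp add: norm_divide)
  ultimately show ?thesis using pos by (simp add: divide_le_eq)
qed

lemma op_norm_le_entry_sum: "A \<in> carrier_mat n n \<Longrightarrow> op_norm A \<le> entry_sum n A"
  by (intro op_norm_le vec_l2norm_mult_le_entry_sum entry_sum_nonneg)

lemma norm_entry_le_op_norm:
  assumes A: "A \<in> carrier_mat n n" and ij: "i < n" "j < n"
  shows "cmod (A $$ (i, j)) \<le> op_norm A"
proof -
  have "vec_l2norm (unit_vec n j :: complex vec) = L2_set (\<lambda>i. if i = j then 1 else 0) {..<n}"
    unfolding vec_l2norm_def using ij(2) by (intro L2_set_cong) (auto simp: unit_vec_def)
  also have "\<dots> = sqrt (\<Sum>i<n. if i = j then 1 else 0)"
    unfolding L2_set_def by (intro arg_cong[where f = sqrt] sum.cong) auto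
  also have "\<dots> = 1" using ij by simp
  finally have "vec_l2norm (unit_vec n j :: complex vec) = 1" .
  then have "vec_l2norm (A *\<^sub>v unit_vec n j) \<le> op_norm A"
    using vec_l2norm_mult_le[OF A unit_vec_carrier, of j] by simp
  moreover have "(A *\<^sub>v unit_vec n j) $ i = A $$ (i, j)" using A ij by simp
  moreover have "A *\<^sub>v unit_vec n j \<in> carrier_vec n" using A by auto
  ultimately show ?thesis using norm_index_le_vec_l2norm[of "A *\<^sub>v unit_vec n j" n i] ij(1) by simp
qed

lemma op_norm_triangle:
  assumes A: "A \<in> carrier_mat n n" and B: "B \<in> carrier_mat n n"
  shows "op_norm (A + B) \<le> op_norm A + op_norm B"
proof (rule op_norm_le)
  fix v :: "complex vec" assume v: "v \<in> carrier_vec n"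
  have "(A + B) *\<^sub>v v = A *\<^sub>v v + B *\<^sub>v v" by (rule add_mult_distrib_mat_vec[OF A B v])
  moreover have "A *\<^sub>v v \<in> carrier_vec n" "B *\<^sub>v v \<in> carrier_vec n" using A B v by auto
  ultimately show "vec_l2norm ((A + B) *\<^sub>v v) \<le> (op_norm A + op_norm B) * vec_l2norm v"
    using vec_l2norm_triangle[of "A *\<^sub>v v" n "B *\<^sub>v v"] vec_l2norm_mult_le[OF A v] vec_l2norm_mult_le[OF B v]
    by (simp add: algebra_simps)
qed (use A B op_norm_nonneg in auto)

lemma op_norm_minus_commute:
  assumes A: "A \<in> carrier_mat n n" and B: "B \<in> carrier_mat n n"
  shows "op_norm (A - B) = op_norm (B - A)"
proof -
  have le: "op_norm (A - B) \<le> op_norm (B - A)" if A: "A \<in> carrier_mat n n" and B: "B \<in> carrier_mat n n" for A B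
  proof (rule op_norm_le)
    have BA: "B - A \<in> carrier_mat n n" using A B by auto
    show "A - B \<in> carrier_mat n n" using A B by auto
    show "0 \<le> op_norm (B - A)" by (rule op_norm_nonneg[OF BA])
    fix v :: "complex vec" assume v: "v \<in> carrier_vec n"
    have "(A - B) *\<^sub>v v = (-1) \<cdot>\<^sub>v ((B - A) *\<^sub>v v)"
      using A B v by (intro eq_vecI) (auto simp: scalar_prod_def algebra_simps sum_subtractf)
    then have "vec_l2norm ((A - B) *\<^sub>v v) = vec_l2norm ((B - A) *\<^sub>v v)" by (simp add: vec_l2norm_smult)
    then show "vec_l2norm ((A - B) *\<^sub>v v) \<le> op_norm (B - A) * vec_l2norm v"
      using vec_l2norm_mult_le[OF BA v] by simp
  qed
  show ?thesis using le[OF A B] le[OF B A] by (rule antisym)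
qed

section \<open>Adjoints and inverses of matrices\<close>

lemma mat_adjoint_carrier: "A \<in> carrier_mat n n \<Longrightarrow> mat_adjoint A \<in> carrier_mat n n"
  by (auto simp: mat_adjoint_def mat_of_rows_def)

lemma mat_adjoint_index:
  "A \<in> carrier_mat n n \<Longrightarrow> i < n \<Longrightarrow> j < n \<Longrightarrow> mat_adjoint A $$ (i, j) = cnj (A $$ (j, i))"
  by (auto simp: mat_adjoint_def mat_of_rows_def conjugate_complex_def)

lemma cscalar_prod_adjoint:
  fixes v w :: "complex vec"
  assumes A: "A \<in> carrier_mat n n" and v: "v \<in> carrier_vec n" and w: "w \<in> carrier_vec n"
  shows "(A *\<^sub>v v) \<bullet>c w = v \<bullet>c (mat_adjoint A *\<^sub>v w)"
proof -
  have A': "mat_adjoint A \<in> carrier_mat n n" by (rule mat_adjoint_carrier[OF A])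
  have "(A *\<^sub>v v) \<bullet>c w = (\<Sum>i<n. \<Sum>j<n. A $$ (i, j) * v $ j * cnj (w $ i))"
    using A v w by (simp add: scalar_prod_def lessThan_atLeast0 conjugate_complex_def sum_distrib_right)
  also have "\<dots> = (\<Sum>j<n. \<Sum>i<n. A $$ (i, j) * v $ j * cnj (w $ i))" by (rule sum.swap)
  also have "\<dots> = v \<bullet>c (mat_adjoint A *\<^sub>v w)"
    using A A' v w
    by (simp add: scalar_prod_def lessThan_atLeast0 conjugate_complex_def sum_distrib_left
      mat_adjoint_index[OF A] mult_ac)
  finally show ?thesis .
qed

text \<open>
  The scalar \<open>c\<close> appears conjugated when \<open>P\<close> is moved across the inner product; since both norms are
  real the conjugation may be dropped.
\<close>

lemma vec_l2norm_scaled_isometry: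
  assumes P: "P \<in> carrier_mat n n" and PP: "mat_adjoint P * P = c \<cdot>\<^sub>m 1\<^sub>m n"
    and v: "v \<in> carrier_vec n"
  shows "complex_of_real ((vec_l2norm (P *\<^sub>v v))\<^sup>2) = c * complex_of_real ((vec_l2norm v)\<^sup>2)"
proof -
  note P' = mat_adjoint_carrier[OF P]
  have Pv: "P *\<^sub>v v \<in> carrier_vec n" using P v by auto
  have cs: "(P *\<^sub>v v) \<bullet>c (P *\<^sub>v v) = v \<bullet>c (mat_adjoint P *\<^sub>v (P *\<^sub>v v))"
    by (rule cscalar_prod_adjoint[OF P v Pv])
  have "mat_adjoint P *\<^sub>v (P *\<^sub>v v) = (c \<cdot>\<^sub>m 1\<^sub>m n) *\<^sub>v v"
    using assoc_mult_mat_vec[OF P' P v] PP by simp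
  also have "\<dots> = c \<cdot>\<^sub>v v" using v by (intro eq_vecI) (auto simp: row_smult)
  finally have eq: "mat_adjoint P *\<^sub>v (P *\<^sub>v v) = c \<cdot>\<^sub>v v" .
  have "complex_of_real ((vec_l2norm (P *\<^sub>v v))\<^sup>2) = (P *\<^sub>v v) \<bullet>c (P *\<^sub>v v)" by (rule vec_l2norm_square[OF Pv])
  also have "\<dots> = v \<bullet>c (c \<cdot>\<^sub>v v)" unfolding cs eq ..
  also have "\<dots> = cnj c * (v \<bullet>c v)"
    using v by (simp add: scalar_prod_def conjugate_complex_def sum_distrib_left mult_ac)
  finally have 1: "complex_of_real ((vec_l2norm (P *\<^sub>v v))\<^sup>2) = cnj c * complex_of_real ((vec_l2norm v)\<^sup>2)"
    unfolding vec_l2norm_square[OF v] .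
  then have "cnj (complex_of_real ((vec_l2norm (P *\<^sub>v v))\<^sup>2)) = c * complex_of_real ((vec_l2norm v)\<^sup>2)"
    by simp
  then show ?thesis by simp
qed

lemma invertible_matI:
  "A \<in> carrier_mat n n \<Longrightarrow> B \<in> carrier_mat n n \<Longrightarrow> A * B = 1\<^sub>m n \<Longrightarrow> B * A = 1\<^sub>m n \<Longrightarrow> invertible_mat A"
  unfolding invertible_mat_def inverts_mat_def by auto

lemma invertible_mat_inverse:
  assumes P: "P \<in> carrier_mat n n" and inv: "invertible_mat P"
  shows "\<exists>B\<in>carrier_mat n n. P * B = 1\<^sub>m n \<and> B * P = 1\<^sub>m n"
proof -
  obtain B where B: "P * B = 1\<^sub>m n" "B * P = 1\<^sub>m (dim_row B)"
    using P inv unfolding invertible_mat_def inverts_mat_def by auto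
  have "dim_row B = n" using arg_cong[OF B(2), of dim_col] P by auto
  moreover have "dim_col B = n" using arg_cong[OF B(1), of dim_col] by auto
  ultimately show ?thesis using B by auto
qed

section \<open>Unitary representations and Schur's lemma\<close>

text \<open>
  The library's notion of subspace, freed from the module record, so that irreducibility can be
  used and proved by elementary closure properties.
\<close>

definition vec_subspace :: "nat \<Rightarrow> complex vec set \<Rightarrow> bool" where
  "vec_subspace n W \<longleftrightarrow> W \<subseteq> carrier_vec n \<and> 0\<^sub>v n \<in> W \<and>
    (\<forall>v\<in>W. \<forall>w\<in>W. v + w \<in> W) \<and> (\<forall>c. \<forall>v\<in>W. c \<cdot>\<^sub>v v \<in> W)"

lemma subspace_iff_vec_subspace:
  "VectorSpace.subspace class_ring W (module_vec TYPE(complex) n) \<longleftrightarrow> vec_subspace n W"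
proof
  assume "VectorSpace.subspace class_ring W (module_vec TYPE(complex) n)"
  then interpret submodule class_ring W "module_vec TYPE(complex) n" by (rule subspace.submod)
  show "vec_subspace n W"
    using subset m_closed zero_closed smult_closed by (auto simp: vec_subspace_def module_vec_simps)
next
  assume "vec_subspace n W"
  then show "VectorSpace.subspace class_ring W (module_vec TYPE(complex) n)"
    by (intro subspace.intro submodule.intro vec_vs vec_module)
      (auto simp: vec_subspace_def module_vec_simps)
qed

lemma irreducible_iff:
  "irreducible_unitary_rep G T n \<pi> \<longleftrightarrow>
    unitary_rep G T n \<pi> \<and> 0 < n \<and>
    (\<forall>W. vec_subspace n W \<longrightarrow> (\<forall>g \<in> carrier G. \<forall>w \<in> W. \<pi> g *\<^sub>v w \<in> W) \<longrightarrow>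
         W = {0\<^sub>v n} \<or> W = carrier_vec n)"
  unfolding irreducible_unitary_rep_def subspace_iff_vec_subspace ..

lemma finite_quotient_representatives:
  assumes r: "equiv A r" and fin: "finite (A // r)"
  shows "\<exists>R\<subseteq>A. finite R \<and> (\<forall>x\<in>A. \<exists>y\<in>R. (x, y) \<in> r)"
proof -
  have "\<forall>c\<in>A // r. \<exists>y. y \<in> A \<and> c = r `` {y}" by (blast elim: quotientE)
  from bchoice[OF this] obtain f where f: "\<And>c. c \<in> A // r \<Longrightarrow> f c \<in> A \<and> c = r `` {f c}" by blast
  have "(x, f (r `` {x})) \<in> r" if "x \<in> A" for x
    using f[OF quotientI[OF that]] that r by (intro eq_equiv_class[OF _ r]) auto
  note rel = this
  show ?thesis
  proof (intro exI[of _ "f ` (A // r)"] conjI ballI)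
    show "f ` (A // r) \<subseteq> A" using f by (simp add: image_subset_iff)
    show "finite (f ` (A // r))" using fin by simp
    show "\<exists>y\<in>f ` (A // r). (x, y) \<in> r" if "x \<in> A" for x
      using that rel by (intro bexI[of _ "f (r `` {x})"] imageI quotientI)
  qed
qed

text \<open>
  \<open>\<Phi>\<close> need not be constant on classes: it is enough that equal values force equivalence.
\<close>

lemma finite_quotient_if_finite_invariant:
  assumes r: "equiv A r" and fin: "finite (\<Phi> ` A)"
    and inv: "\<And>x y. x \<in> A \<Longrightarrow> y \<in> A \<Longrightarrow> \<Phi> x = \<Phi> y \<Longrightarrow> (x, y) \<in> r"
  shows "finite (A // r)"
proof -
  have "A // r \<subseteq> (\<lambda>t. r `` {SOME x. x \<in> A \<and> \<Phi> x = t}) ` (\<Phi> ` A)"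
  proof
    fix c assume "c \<in> A // r"
    then obtain x where x: "x \<in> A" "c = r `` {x}" by (auto elim: quotientE)
    let ?y = "SOME y. y \<in> A \<and> \<Phi> y = \<Phi> x"
    have "?y \<in> A \<and> \<Phi> ?y = \<Phi> x" using x(1) by (intro someI[of "\<lambda>y. y \<in> A \<and> \<Phi> y = \<Phi> x" x]) simp
    then have "r `` {x} = r `` {?y}" using inv[of x ?y] x(1) r by (intro equiv_class_eq) auto
    then show "c \<in> (\<lambda>t. r `` {SOME x. x \<in> A \<and> \<Phi> x = t}) ` (\<Phi> ` A)" using x by blast
  qed
  then show ?thesis using fin finite_subset by blast
qed

context Group.group
begin

lemma unitary_repD:
  assumes "unitary_rep G T n \<pi>"
  shows "\<And>g. g \<in> carrier G \<Longrightarrow> \<pi> g \<in> carrier_mat n n"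
    "\<And>g. g \<in> carrier G \<Longrightarrow> \<pi> g * mat_adjoint (\<pi> g) = 1\<^sub>m n"
    "\<And>g. g \<in> carrier G \<Longrightarrow> mat_adjoint (\<pi> g) * \<pi> g = 1\<^sub>m n"
    "\<And>g h. g \<in> carrier G \<Longrightarrow> h \<in> carrier G \<Longrightarrow> \<pi> (g \<otimes> h) = \<pi> g * \<pi> h"
  using assms by (auto simp: unitary_rep_def hom_def unitary_group_def Pi_iff)

lemma unitary_rep_one:
  assumes "unitary_rep G T n \<pi>" shows "\<pi> \<one> = 1\<^sub>m n"
proof -
  note r = unitary_repD[OF assms]
  let ?A = "\<pi> \<one>"
  have A: "?A \<in> carrier_mat n n" using r(1) by simp
  have "?A = ?A * (?A * mat_adjoint ?A)" using A r(2)[of \<one>] by simp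
  also have "\<dots> = (?A * ?A) * mat_adjoint ?A"
    using assoc_mult_mat[OF A A mat_adjoint_carrier[OF A]] by simp
  also have "\<dots> = 1\<^sub>m n" using r(4)[of \<one> \<one>] r(2)[of \<one>] by simp
  finally show ?thesis .
qed

lemma unitary_rep_inv:
  assumes "unitary_rep G T n \<pi>" and g: "g \<in> carrier G" shows "\<pi> (inv g) = mat_adjoint (\<pi> g)"
proof -
  note r = unitary_repD[OF assms(1)]
  have A: "\<pi> g \<in> carrier_mat n n" "\<pi> (inv g) \<in> carrier_mat n n" "mat_adjoint (\<pi> g) \<in> carrier_mat n n"
    using r(1) g mat_adjoint_carrier by auto
  have "\<pi> (inv g) = \<pi> (inv g) * (\<pi> g * mat_adjoint (\<pi> g))" using A r(2)[OF g] by simp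
  also have "\<dots> = (\<pi> (inv g) * \<pi> g) * mat_adjoint (\<pi> g)"
    by (rule assoc_mult_mat[OF A(2,1,3), symmetric])
  also have "\<dots> = mat_adjoint (\<pi> g)"
  proof -
    have "\<pi> (inv g) * \<pi> g = 1\<^sub>m n" using r(4)[of "inv g" g] g unitary_rep_one[OF assms(1)] by simp
    then show ?thesis by (simp only: left_mult_one_mat[OF A(3)])
  qed
  finally show ?thesis .
qed

lemma unitary_rep_isometry:
  assumes "unitary_rep G T n \<pi>" and g: "g \<in> carrier G" and v: "v \<in> carrier_vec n"
  shows "vec_l2norm (\<pi> g *\<^sub>v v) = vec_l2norm v"
proof -
  note r = unitary_repD[OF assms(1)]
  have "complex_of_real ((vec_l2norm (\<pi> g *\<^sub>v v))\<^sup>2) = 1 * complex_of_real ((vec_l2norm v)\<^sup>2)"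
    by (rule vec_l2norm_scaled_isometry[OF r(1)[OF g] _ v]) (use r(3)[OF g] in \<open>auto intro!: eq_matI\<close>)
  then have "(vec_l2norm (\<pi> g *\<^sub>v v))\<^sup>2 = (vec_l2norm v)\<^sup>2" by (simp only: mult_1 of_real_eq_iff)
  then show ?thesis using vec_l2norm_nonneg by (simp add: power2_eq_iff_nonneg)
qed

lemma op_norm_diff_unitary_le:
  assumes \<pi>: "unitary_rep G T n \<pi>" and x: "x \<in> carrier G" "y \<in> carrier G"
  shows "op_norm (\<pi> x - \<pi> y) \<le> 2"
proof (rule op_norm_le)
  note r = unitary_repD[OF \<pi>]
  have c: "\<pi> x \<in> carrier_mat n n" "\<pi> y \<in> carrier_mat n n" using r x by auto
  show "\<pi> x - \<pi> y \<in> carrier_mat n n" using c by auto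
  fix v :: "complex vec" assume v: "v \<in> carrier_vec n"
  have "vec_l2norm ((\<pi> x - \<pi> y) *\<^sub>v v) = vec_l2norm (\<pi> x *\<^sub>v v + (-1) \<cdot>\<^sub>v (\<pi> y *\<^sub>v v))"
    using c v by (intro arg_cong[where f = vec_l2norm] eq_vecI) (auto simp: scalar_prod_def algebra_simps
      sum_subtractf)
  also have "\<dots> \<le> vec_l2norm (\<pi> x *\<^sub>v v) + vec_l2norm ((-1) \<cdot>\<^sub>v (\<pi> y *\<^sub>v v))"
    using c v by (intro vec_l2norm_triangle[of _ n]) auto
  also have "\<dots> = 2 * vec_l2norm v"
    using unitary_rep_isometry[OF \<pi> x(1) v] unitary_rep_isometry[OF \<pi> x(2) v] by (simp add: vec_l2norm_smult)
  finally show "vec_l2norm ((\<pi> x - \<pi> y) *\<^sub>v v) \<le> 2 * vec_l2norm v" .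
qed simp

lemma op_norm_translate:
  assumes \<pi>: "unitary_rep G T n \<pi>" and x: "x \<in> carrier G" "y \<in> carrier G" "g \<in> carrier G"
  shows "op_norm (\<pi> (g \<otimes> x) - \<pi> (g \<otimes> y)) \<le> op_norm (\<pi> x - \<pi> y)"
    and "op_norm (\<pi> (x \<otimes> g) - \<pi> (y \<otimes> g)) \<le> op_norm (\<pi> x - \<pi> y)"
proof -
  note r = unitary_repD[OF \<pi>]
  have c: "\<pi> x \<in> carrier_mat n n" "\<pi> y \<in> carrier_mat n n" "\<pi> g \<in> carrier_mat n n" using r x by auto
  have d: "\<pi> x - \<pi> y \<in> carrier_mat n n" using c by auto
  have l: "\<pi> (g \<otimes> x) - \<pi> (g \<otimes> y) = \<pi> g * (\<pi> x - \<pi> y)"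
    using r(4) x mult_minus_distrib_mat[OF c(3,1,2)] by simp
  have m: "\<pi> (x \<otimes> g) - \<pi> (y \<otimes> g) = (\<pi> x - \<pi> y) * \<pi> g"
    using r(4) x minus_mult_distrib_mat[OF c(1,2,3)] by simp
  show "op_norm (\<pi> (g \<otimes> x) - \<pi> (g \<otimes> y)) \<le> op_norm (\<pi> x - \<pi> y)"
    unfolding l
  proof (rule op_norm_le)
    fix v :: "complex vec" assume v: "v \<in> carrier_vec n"
    have "vec_l2norm (\<pi> g * (\<pi> x - \<pi> y) *\<^sub>v v) = vec_l2norm (\<pi> g *\<^sub>v ((\<pi> x - \<pi> y) *\<^sub>v v))"
      using assoc_mult_mat_vec[OF c(3) d v] by simp
    also have "\<dots> = vec_l2norm ((\<pi> x - \<pi> y) *\<^sub>v v)"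
      using d v by (intro unitary_rep_isometry[OF \<pi> x(3)]) auto
    finally show "vec_l2norm (\<pi> g * (\<pi> x - \<pi> y) *\<^sub>v v) \<le> op_norm (\<pi> x - \<pi> y) * vec_l2norm v"
      using vec_l2norm_mult_le[OF d v] by simp
  qed (use c d op_norm_nonneg in auto)
  show "op_norm (\<pi> (x \<otimes> g) - \<pi> (y \<otimes> g)) \<le> op_norm (\<pi> x - \<pi> y)"
    unfolding m
  proof (rule op_norm_le)
    fix v :: "complex vec" assume v: "v \<in> carrier_vec n"
    have gv: "\<pi> g *\<^sub>v v \<in> carrier_vec n" using c v by auto
    have "vec_l2norm ((\<pi> x - \<pi> y) * \<pi> g *\<^sub>v v) = vec_l2norm ((\<pi> x - \<pi> y) *\<^sub>v (\<pi> g *\<^sub>v v))"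
      using assoc_mult_mat_vec[OF d c(3) v] by simp
    then show "vec_l2norm ((\<pi> x - \<pi> y) * \<pi> g *\<^sub>v v) \<le> op_norm (\<pi> x - \<pi> y) * vec_l2norm v"
      using vec_l2norm_mult_le[OF d gv] unitary_rep_isometry[OF \<pi> x(3) v] by simp
  qed (use c d op_norm_nonneg in auto)
qed

text \<open>
  Schur's lemma: the kernel of a non-zero intertwiner is an invariant subspace other than the whole
  space, hence trivial.
\<close>

lemma intertwiner_invertible:
  assumes \<pi>: "irreducible_unitary_rep G T n \<pi>" and \<sigma>: "unitary_rep G T n \<sigma>"
    and P: "P \<in> carrier_mat n n" "P \<noteq> 0\<^sub>m n n"
    and comm: "\<And>g. g \<in> carrier G \<Longrightarrow> P * \<pi> g = \<sigma> g * P"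
  shows "invertible_mat P"
proof -
  have \<pi>u: "unitary_rep G T n \<pi>" using \<pi> by (simp add: irreducible_iff)
  note r = unitary_repD[OF \<pi>u] and s = unitary_repD[OF \<sigma>]
  let ?W = "{v \<in> carrier_vec n. P *\<^sub>v v = 0\<^sub>v n}"
  have "vec_subspace n ?W"
    using P(1) by (auto simp: vec_subspace_def mult_add_distrib_mat_vec mult_mat_vec)
  moreover have "\<pi> g *\<^sub>v w \<in> ?W" if g: "g \<in> carrier G" and w: "w \<in> ?W" for g w
  proof -
    have "P *\<^sub>v (\<pi> g *\<^sub>v w) = (P * \<pi> g) *\<^sub>v w" using P(1) r(1)[OF g] w by (simp add: assoc_mult_mat_vec)
    also have "\<dots> = \<sigma> g *\<^sub>v (P *\<^sub>v w)" using P(1) s(1)[OF g] w comm[OF g] by (simp add: assoc_mult_mat_vec)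
    also have "\<dots> = 0\<^sub>v n" using w s(1)[OF g] by auto
    finally show ?thesis using r(1)[OF g] w by auto
  qed
  ultimately have "?W = {0\<^sub>v n} \<or> ?W = carrier_vec n" using \<pi> unfolding irreducible_iff by blast
  moreover have "?W \<noteq> carrier_vec n"
  proof
    assume all: "?W = carrier_vec n"
    have "P = 0\<^sub>m n n"
    proof (rule eq_matI)
      fix i j assume ij: "i < dim_row (0\<^sub>m n n :: complex mat)" "j < dim_col (0\<^sub>m n n :: complex mat)"
      have "unit_vec n j \<in> ?W" using all by simp
      then have "(P *\<^sub>v unit_vec n j) $ i = 0" using ij by simp
      then show "P $$ (i, j) = 0\<^sub>m n n $$ (i, j)" using P(1) ij by simp
    qed (use P in auto)
    then show False using P(2) by simp
  qed
  ultimately have "?W = {0\<^sub>v n}" by blast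
  then have "Determinant.det P \<noteq> 0" unfolding det_0_iff_vec_prod_zero_field[OF P(1)] by blast
  from det_non_zero_imp_unit[OF P(1) this, of "()"]
  obtain B where "B \<in> carrier_mat n n" "B * P = 1\<^sub>m n" "P * B = 1\<^sub>m n"
    by (auto simp: Units_def ring_mat_def)
  then show ?thesis using P(1) unfolding invertible_mat_def inverts_mat_def by auto
qed

text \<open>
  Schur's lemma again: the matrix \<open>P\<^sup>*P\<close> commutes with \<open>\<pi>\<close>, and its eigenspace for some eigenvalue is a
  non-zero invariant subspace, hence everything.
\<close>

lemma intertwiner_scaled_isometry:
  assumes \<pi>: "irreducible_unitary_rep G T n \<pi>" and \<sigma>: "unitary_rep G T n \<sigma>"
    and P: "P \<in> carrier_mat n n"
    and comm: "\<And>g. g \<in> carrier G \<Longrightarrow> P * \<pi> g = \<sigma> g * P"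
  obtains c where "mat_adjoint P * P = c \<cdot>\<^sub>m 1\<^sub>m n"
proof -
  have \<pi>u: "unitary_rep G T n \<pi>" and n: "n > 0" using \<pi> by (auto simp: irreducible_iff)
  note r = unitary_repD[OF \<pi>u] and s = unitary_repD[OF \<sigma>]
  note P' = mat_adjoint_carrier[OF P]
  define Q where "Q = mat_adjoint P * P"
  have Q: "Q \<in> carrier_mat n n" using P P' by (auto simp: Q_def)
  have adj_mult: "mat_adjoint (A * B) = mat_adjoint B * mat_adjoint A"
    if "A \<in> carrier_mat n n" "B \<in> carrier_mat n n" for A B :: "complex mat"
  proof (rule eq_matI)
    have c: "A * B \<in> carrier_mat n n" "mat_adjoint A \<in> carrier_mat n n" "mat_adjoint B \<in> carrier_mat n n"
      using that mat_adjoint_carrier by auto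
    show "dim_row (mat_adjoint (A * B)) = dim_row (mat_adjoint B * mat_adjoint A)"
      "dim_col (mat_adjoint (A * B)) = dim_col (mat_adjoint B * mat_adjoint A)"
      using c mat_adjoint_carrier[OF c(1)] by auto
    fix i j assume "i < dim_row (mat_adjoint B * mat_adjoint A)" "j < dim_col (mat_adjoint B * mat_adjoint A)"
    then have ij: "i < n" "j < n" using c by auto
    have "mat_adjoint (A * B) $$ (i, j) = (\<Sum>k<n. cnj (A $$ (j, k)) * cnj (B $$ (k, i)))"
      using ij that by (simp add: mat_adjoint_index[OF c(1)] scalar_prod_def lessThan_atLeast0)
    also have "\<dots> = (\<Sum>k<n. mat_adjoint B $$ (i, k) * mat_adjoint A $$ (k, j))"
      using ij by (intro sum.cong) (auto simp: mat_adjoint_index[OF that(1)] mat_adjoint_index[OF that(2)])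
    also have "\<dots> = (mat_adjoint B * mat_adjoint A) $$ (i, j)"
      using ij c by (simp add: scalar_prod_def lessThan_atLeast0)
    finally show "mat_adjoint (A * B) $$ (i, j) = (mat_adjoint B * mat_adjoint A) $$ (i, j)" .
  qed
  have comm': "mat_adjoint P * \<sigma> g = \<pi> g * mat_adjoint P" if g: "g \<in> carrier G" for g
  proof -
    have i: "inv g \<in> carrier G" using g by simp
    have adj2: "mat_adjoint (mat_adjoint A) = A" if "A \<in> carrier_mat n n" for A :: "complex mat"
      using that mat_adjoint_carrier[OF that] mat_adjoint_carrier[OF mat_adjoint_carrier[OF that]]
      by (intro eq_matI) (auto simp: mat_adjoint_index[OF that] mat_adjoint_index[OF mat_adjoint_carrier[OF
        that]])
    have "mat_adjoint (P * \<pi> (inv g)) = mat_adjoint (\<sigma> (inv g) * P)" using comm[OF i] by simp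
    then show ?thesis
      using adj_mult[OF P r(1)[OF i]] adj_mult[OF s(1)[OF i] P] unitary_rep_inv[OF \<pi>u g] unitary_rep_inv[OF \<sigma> g]
        adj2[OF r(1)[OF g]] adj2[OF s(1)[OF g]] by simp
  qed
  have commQ: "Q * \<pi> g = \<pi> g * Q" if g: "g \<in> carrier G" for g
  proof -
    have "Q * \<pi> g = mat_adjoint P * (\<sigma> g * P)"
      unfolding Q_def using assoc_mult_mat[OF P' P r(1)[OF g]] comm[OF g] by simp
    also have "\<dots> = (\<pi> g * mat_adjoint P) * P"
      using assoc_mult_mat[OF P' s(1)[OF g] P] comm'[OF g] by simp
    also have "\<dots> = \<pi> g * Q" unfolding Q_def using assoc_mult_mat[OF r(1)[OF g] P' P] by simp
    finally show ?thesis .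
  qed
  \<comment> \<open>an eigenvalue exists because the complex field is algebraically closed\<close>
  obtain c where c: "eigenvalue Q c" using spectrum_non_empty[OF Q n] by (auto simp: spectrum_def)
  let ?W = "{v \<in> carrier_vec n. Q *\<^sub>v v = c \<cdot>\<^sub>v v}"
  have "vec_subspace n ?W"
    using Q by (auto simp: vec_subspace_def mult_add_distrib_mat_vec[OF Q] mult_mat_vec[OF Q]
      smult_add_distrib_vec smult_smult_assoc mult.commute)
  moreover have "\<pi> g *\<^sub>v w \<in> ?W" if g: "g \<in> carrier G" and w: "w \<in> ?W" for g w
  proof -
    have w': "w \<in> carrier_vec n" "Q *\<^sub>v w = c \<cdot>\<^sub>v w" using w by auto
    have "Q *\<^sub>v (\<pi> g *\<^sub>v w) = (Q * \<pi> g) *\<^sub>v w" using assoc_mult_mat_vec[OF Q r(1)[OF g] w'(1)] by simp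
    also have "\<dots> = \<pi> g *\<^sub>v (Q *\<^sub>v w)" unfolding commQ[OF g] using assoc_mult_mat_vec[OF r(1)[OF g] Q w'(1)]
      by simp
    also have "\<dots> = c \<cdot>\<^sub>v (\<pi> g *\<^sub>v w)" unfolding w'(2) by (rule mult_mat_vec[OF r(1)[OF g] w'(1)])
    finally show ?thesis using r(1)[OF g] w' by auto
  qed
  ultimately have "?W = {0\<^sub>v n} \<or> ?W = carrier_vec n" using \<pi> unfolding irreducible_iff by blast
  moreover have "?W \<noteq> {0\<^sub>v n}"
    using c Q unfolding eigenvalue_def eigenvector_def by auto
  ultimately have all: "Q *\<^sub>v v = c \<cdot>\<^sub>v v" if "v \<in> carrier_vec n" for v using that by blast
  have "Q = c \<cdot>\<^sub>m 1\<^sub>m n"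
  proof (rule eq_matI)
    fix i j assume "i < dim_row (c \<cdot>\<^sub>m 1\<^sub>m n)" "j < dim_col (c \<cdot>\<^sub>m 1\<^sub>m n)"
    then have ij: "i < n" "j < n" by auto
    have "Q $$ (i, j) = (Q *\<^sub>v unit_vec n j) $ i" using Q ij by simp
    also have "\<dots> = (c \<cdot>\<^sub>v unit_vec n j) $ i" using all[of "unit_vec n j"] by simp
    finally show "Q $$ (i, j) = (c \<cdot>\<^sub>m 1\<^sub>m n) $$ (i, j)" using ij by simp
  qed (use Q in auto)
  then show thesis unfolding Q_def by (rule that)
qed

lemma isomorphic_reps_refl:
  assumes \<pi>: "unitary_rep G T n \<pi>" shows "isomorphic_reps G n \<pi> \<pi>"
proof -
  have "invertible_mat (1\<^sub>m n :: complex mat)" unfolding invertible_mat_def inverts_mat_def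
    by (auto intro!: exI[of _ "1\<^sub>m n"])
  moreover have "1\<^sub>m n * \<pi> g = \<pi> g * 1\<^sub>m n" if "g \<in> carrier G" for g
    using left_mult_one_mat right_mult_one_mat unitary_repD(1)[OF \<pi> that] by metis
  ultimately show ?thesis unfolding isomorphic_reps_def by (intro bexI[of _ "1\<^sub>m n"]) auto
qed

lemma isomorphic_reps_sym:
  assumes \<pi>: "unitary_rep G T n \<pi>" and \<sigma>: "unitary_rep G T n \<sigma>" and iso: "isomorphic_reps G n \<pi> \<sigma>"
  shows "isomorphic_reps G n \<sigma> \<pi>"
proof -
  note r = unitary_repD[OF \<pi>] and s = unitary_repD[OF \<sigma>]
  obtain P where P: "P \<in> carrier_mat n n" "invertible_mat P" "\<And>g. g \<in> carrier G \<Longrightarrow> P * \<pi> g = \<sigma> g * P"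
    using iso by (auto simp: isomorphic_reps_def)
  obtain B where Bc: "B \<in> carrier_mat n n" and B: "P * B = 1\<^sub>m n" and B2: "B * P = 1\<^sub>m n"
    using invertible_mat_inverse[OF P(1,2)] by blast
  have "B * \<sigma> g = \<pi> g * B" if g: "g \<in> carrier G" for g
  proof -
    have "B * \<sigma> g = B * \<sigma> g * (P * B)" using B Bc s(1)[OF g] by simp
    also have "\<dots> = B * (\<sigma> g * P) * B"
      using Bc P(1) s(1)[OF g] assoc_mult_mat[of B n n "\<sigma> g" n P n] assoc_mult_mat[of "B * \<sigma> g" n n P n B n]
        by simp
    also have "\<dots> = B * (P * \<pi> g) * B" using P(3)[OF g] by simp
    also have "\<dots> = (B * P) * \<pi> g * B"
      using Bc P(1) r(1)[OF g] assoc_mult_mat[of B n n P n "\<pi> g" n] by simp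
    also have "\<dots> = \<pi> g * B" using B2 r(1)[OF g] by simp
    finally show ?thesis .
  qed
  moreover have "invertible_mat B" unfolding invertible_mat_def inverts_mat_def using Bc P(1) B B2 by auto
  ultimately show ?thesis using Bc by (auto simp: isomorphic_reps_def)
qed

text \<open>
  Isomorphism only provides an invertible intertwiner, but up to a positive factor this intertwiner is
  unitary, and the factor cancels.
\<close>

lemma isomorphic_op_norm_le:
  assumes \<pi>: "irreducible_unitary_rep G T n \<pi>" and \<sigma>: "unitary_rep G T n \<sigma>"
    and iso: "isomorphic_reps G n \<pi> \<sigma>" and x: "x \<in> carrier G" "y \<in> carrier G"
  shows "op_norm (\<pi> x - \<pi> y) \<le> op_norm (\<sigma> x - \<sigma> y)"
proof -
  have \<pi>u: "unitary_rep G T n \<pi>" and n: "n > 0" using \<pi> by (auto simp: irreducible_iff)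
  note r = unitary_repD[OF \<pi>u] and s = unitary_repD[OF \<sigma>]
  obtain P where P: "P \<in> carrier_mat n n" "invertible_mat P" "\<And>g. g \<in> carrier G \<Longrightarrow> P * \<pi> g = \<sigma> g * P"
    using iso by (auto simp: isomorphic_reps_def)
  obtain c where c: "mat_adjoint P * P = c \<cdot>\<^sub>m 1\<^sub>m n"
    using intertwiner_scaled_isometry[OF \<pi> \<sigma> P(1,3)] by blast
  define k where "k = sqrt (Re c)"
  have sq: "(vec_l2norm (P *\<^sub>v v))\<^sup>2 = Re c * (vec_l2norm v)\<^sup>2" if "v \<in> carrier_vec n" for v
    using arg_cong[OF vec_l2norm_scaled_isometry[OF P(1) c that], of Re] by simp
  obtain B where B: "B \<in> carrier_mat n n" "B * P = 1\<^sub>m n" using invertible_mat_inverse[OF P(1,2)] by blast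
  \<comment> \<open>that \<open>P\<close> does not annihilate one vector makes the scaling factor positive\<close>
  have "P *\<^sub>v unit_vec n 0 \<noteq> 0\<^sub>v n"
  proof
    assume "P *\<^sub>v unit_vec n 0 = 0\<^sub>v n"
    then have "(B * P) *\<^sub>v unit_vec n 0 = 0\<^sub>v n"
      using assoc_mult_mat_vec[OF B(1) P(1), of "unit_vec n 0"] B(1) by auto
    then have "(unit_vec n 0 :: complex vec) $ 0 = 0" using B(2) n by simp
    then show False using n by simp
  qed
  then have "vec_l2norm (P *\<^sub>v unit_vec n 0) \<noteq> 0"
    using vec_l2norm_eq_0[of "P *\<^sub>v unit_vec n 0" n] P(1) by auto
  then have "Re c * (vec_l2norm (unit_vec n 0 :: complex vec))\<^sup>2 > 0"
    using sq[of "unit_vec n 0"] by (metis unit_vec_carrier zero_less_power2)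
  then have "Re c > 0" by (simp add: zero_less_mult_iff not_less_iff_gr_or_eq)
  then have k: "k > 0" "k\<^sup>2 = Re c" by (auto simp: k_def)
  have nP: "vec_l2norm (P *\<^sub>v v) = k * vec_l2norm v" if "v \<in> carrier_vec n" for v
  proof (rule power2_eq_imp_eq)
    show "(vec_l2norm (P *\<^sub>v v))\<^sup>2 = (k * vec_l2norm v)\<^sup>2" using sq[OF that] k(2)
      by (simp add: power_mult_distrib)
  qed (use k vec_l2norm_nonneg in auto)
  let ?a = "\<pi> x - \<pi> y" and ?b = "\<sigma> x - \<sigma> y"
  have a: "?a \<in> carrier_mat n n" and b: "?b \<in> carrier_mat n n"
    using r(1)[OF x(1)] r(1)[OF x(2)] s(1)[OF x(1)] s(1)[OF x(2)] by auto
  have Pab: "P * ?a = ?b * P"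
    using mult_minus_distrib_mat[OF P(1) r(1)[OF x(1)] r(1)[OF x(2)]] minus_mult_distrib_mat[OF s(1)[OF
      x(1)] s(1)[OF x(2)] P(1)]
      P(3) x by simp
  show ?thesis
  proof (rule op_norm_le[OF a op_norm_nonneg[OF b]])
    fix v :: "complex vec" assume v: "v \<in> carrier_vec n"
    have v': "?a *\<^sub>v v \<in> carrier_vec n" "P *\<^sub>v v \<in> carrier_vec n" using a P(1) v by auto
    have "k * vec_l2norm (?a *\<^sub>v v) = vec_l2norm (P *\<^sub>v (?a *\<^sub>v v))" using nP[OF v'(1)] ..
    also have "\<dots> = vec_l2norm (?b *\<^sub>v (P *\<^sub>v v))"
      using assoc_mult_mat_vec[OF P(1) a v] assoc_mult_mat_vec[OF b P(1) v] Pab by simp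
    also have "\<dots> \<le> k * (op_norm ?b * vec_l2norm v)"
      using vec_l2norm_mult_le[OF b v'(2)] nP[OF v] by (simp add: mult_ac)
    finally show "vec_l2norm (?a *\<^sub>v v) \<le> op_norm ?b * vec_l2norm v" using k(1) by simp
  qed
qed

lemma isomorphic_reps_trans:
  assumes \<pi>: "irreducible_unitary_rep G T n \<pi>" and \<sigma>: "unitary_rep G T n \<sigma>" and \<rho>: "unitary_rep G T n \<rho>"
    and iso: "isomorphic_reps G n \<pi> \<sigma>" "isomorphic_reps G n \<sigma> \<rho>"
  shows "isomorphic_reps G n \<pi> \<rho>"
proof -
  have \<pi>u: "unitary_rep G T n \<pi>" and n: "n > 0" using \<pi> by (auto simp: irreducible_iff)
  note r = unitary_repD[OF \<pi>u] and s = unitary_repD[OF \<sigma>] and t = unitary_repD[OF \<rho>]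
  obtain P where P: "P \<in> carrier_mat n n" "invertible_mat P" "\<And>g. g \<in> carrier G \<Longrightarrow> P * \<pi> g = \<sigma> g * P"
    using iso by (auto simp: isomorphic_reps_def)
  obtain Q where Q: "Q \<in> carrier_mat n n" "invertible_mat Q" "\<And>g. g \<in> carrier G \<Longrightarrow> Q * \<sigma> g = \<rho> g * Q"
    using iso by (auto simp: isomorphic_reps_def)
  obtain B where B: "B \<in> carrier_mat n n" "P * B = 1\<^sub>m n" "B * P = 1\<^sub>m n"
    using invertible_mat_inverse[OF P(1,2)] by blast
  obtain D where D: "D \<in> carrier_mat n n" "Q * D = 1\<^sub>m n" "D * Q = 1\<^sub>m n"
    using invertible_mat_inverse[OF Q(1,2)] by blast
  have c: "Q * P \<in> carrier_mat n n" "B * D \<in> carrier_mat n n" using P(1) Q(1) B(1) D(1) by auto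
  have "(Q * P) * (B * D) = Q * (P * B) * D"
    using assoc_mult_mat[OF c(1) B(1) D(1)] assoc_mult_mat[OF Q(1) P(1) B(1)] by simp
  then have 1: "(Q * P) * (B * D) = 1\<^sub>m n" using B(2) D(2) Q(1) by simp
  have "(B * D) * (Q * P) = B * (D * Q) * P"
    using assoc_mult_mat[OF c(2) Q(1) P(1)] assoc_mult_mat[OF B(1) D(1) Q(1)] by simp
  then have "(B * D) * (Q * P) = 1\<^sub>m n" using B(1,3) D(3) by simp
  then have "invertible_mat (Q * P)"
    by (rule invertible_matI[OF c 1])
  moreover have "Q * P * \<pi> g = \<rho> g * (Q * P)" if g: "g \<in> carrier G" for g
  proof -
    have "Q * P * \<pi> g = Q * (\<sigma> g * P)" using assoc_mult_mat[OF Q(1) P(1) r(1)[OF g]] P(3)[OF g] by simp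
    also have "\<dots> = (\<rho> g * Q) * P" using assoc_mult_mat[OF Q(1) s(1)[OF g] P(1)] Q(3)[OF g] by simp
    also have "\<dots> = \<rho> g * (Q * P)" by (rule assoc_mult_mat[OF t(1)[OF g] Q(1) P(1)])
    finally show ?thesis .
  qed
  ultimately show ?thesis using P(1) Q(1) unfolding isomorphic_reps_def by (intro bexI[of _ "Q * P"]) auto
qed

lemma equiv_irreps:
  "equiv {\<pi>. irreducible_unitary_rep G T n \<pi>}
    {(\<pi>, \<sigma>). irreducible_unitary_rep G T n \<pi> \<and> irreducible_unitary_rep G T n \<sigma> \<and> isomorphic_reps G n \<pi> \<sigma>}"
proof (rule equivI)
  let ?r = "{(\<pi>, \<sigma>). irreducible_unitary_rep G T n \<pi> \<and> irreducible_unitary_rep G T n \<sigma> \<and>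
    isomorphic_reps G n \<pi> \<sigma>}"
  have u: "unitary_rep G T n \<pi>" if "irreducible_unitary_rep G T n \<pi>" for \<pi> using that
    by (simp add: irreducible_iff)
  show "refl_on {\<pi>. irreducible_unitary_rep G T n \<pi>} ?r"
    using u isomorphic_reps_refl by (auto simp: refl_on_def)
  show "sym ?r" using isomorphic_reps_sym[OF u u] by (auto simp: sym_def)
  show "trans ?r" using isomorphic_reps_trans[OF _ u u] unfolding trans_def by blast
qed auto

lemma finite_irrep_representatives:
  assumes "finite (irrep_classes G T n)"
  shows "\<exists>R. finite R \<and> (\<forall>\<rho>\<in>R. irreducible_unitary_rep G T n \<rho>) \<and>
    (\<forall>\<pi>. irreducible_unitary_rep G T n \<pi> \<longrightarrow> (\<exists>\<rho>\<in>R. isomorphic_reps G n \<pi> \<rho>))"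
proof -
  from finite_quotient_representatives[OF equiv_irreps assms[unfolded irrep_classes_def]]
  obtain R where "R \<subseteq> {\<pi>. irreducible_unitary_rep G T n \<pi>}" "finite R"
    "\<forall>\<pi>\<in>{\<pi>. irreducible_unitary_rep G T n \<pi>}. \<exists>\<rho>\<in>R. (\<pi>, \<rho>) \<in> {(\<pi>, \<sigma>). irreducible_unitary_rep G T n \<pi> \<and>
       irreducible_unitary_rep G T n \<sigma> \<and> isomorphic_reps G n \<pi> \<sigma>}"
    by (elim exE conjE)
  then show ?thesis by (intro exI[of _ R]) auto
qed

lemma finite_irrep_classesI:
  assumes "finite (\<Phi> ` {\<pi>. irreducible_unitary_rep G T n \<pi>})"
    and "\<And>\<pi> \<sigma>. irreducible_unitary_rep G T n \<pi> \<Longrightarrow> irreducible_unitary_rep G T n \<sigma> \<Longrightarrow> \<Phi> \<pi> = \<Phi> \<sigma> \<Longrightarrow>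
      isomorphic_reps G n \<pi> \<sigma>"
  shows "finite (irrep_classes G T n)"
  unfolding irrep_classes_def
  by (rule finite_quotient_if_finite_invariant[OF equiv_irreps assms(1)]) (use assms(2) in auto)

end

section \<open>The Haar mean of a compact group\<close>

locale compact_group = topological_group G T for G (structure) and T :: "'a topology" +
  assumes compact: "compact_space T"
begin

abbreviation cont :: "('a \<Rightarrow> complex) \<Rightarrow> bool" where
  "cont f \<equiv> continuous_map T euclidean f"

abbreviation "urep \<equiv> unitary_rep G T"

abbreviation "irrep \<equiv> irreducible_unitary_rep G T"

lemma cont_left:
  assumes "continuous_map T X f" "g \<in> carrier G" shows "continuous_map T X (\<lambda>x. f (g \<otimes> x))"
proof -
  have "continuous_map T (prod_topology T T) (\<lambda>x. (g, x))"
    using assms(2) by (simp add: continuous_map_pairwise o_def topspace_eq)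
  from continuous_map_compose[OF continuous_map_compose[OF this continuous_mult] assms(1)]
  show ?thesis by (simp add: o_def)
qed

lemma cont_right:
  assumes "continuous_map T X f" "g \<in> carrier G" shows "continuous_map T X (\<lambda>x. f (x \<otimes> g))"
proof -
  have "continuous_map T (prod_topology T T) (\<lambda>x. (x, g))"
    using assms(2) by (simp add: continuous_map_pairwise o_def topspace_eq)
  from continuous_map_compose[OF continuous_map_compose[OF this continuous_mult] assms(1)]
  show ?thesis by (simp add: o_def)
qed

lemma cont_inv: "continuous_map T X f \<Longrightarrow> continuous_map T X (\<lambda>x. f (inv x))"
  using continuous_map_compose[OF continuous_inv] by (simp add: o_def)

lemma cont_cong: "continuous_map T X f \<Longrightarrow> (\<And>x. x \<in> carrier G \<Longrightarrow> f x = g x) \<Longrightarrow> continuous_map T X g"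
  by (erule continuous_map_eq) (simp add: topspace_eq)

lemma cont_bounded:
  assumes "continuous_map T euclidean (f :: 'a \<Rightarrow> 'x::real_normed_vector)"
  obtains B where "B > 0" "\<And>x. x \<in> carrier G \<Longrightarrow> norm (f x) \<le> B"
proof -
  have "compactin euclidean (f ` topspace T)"
    using image_compactin assms compact unfolding compact_space_def by blast
  then have "bounded (f ` carrier G)"
    by (simp add: topspace_eq compact_imp_bounded)
  then show thesis using that by (auto simp: bounded_pos)
qed

lemma cont_Re: "cont f \<Longrightarrow> continuous_map T euclidean (\<lambda>x. Re (f x))"
  and cont_Im: "cont f \<Longrightarrow> continuous_map T euclidean (\<lambda>x. Im (f x))"
  by (auto simp: continuous_map_atin intro: tendsto_Re tendsto_Im)

lemma cont_add: "cont f \<Longrightarrow> cont g \<Longrightarrow> cont (\<lambda>x. f x + g x)"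
  and cont_diff: "cont f \<Longrightarrow> cont g \<Longrightarrow> cont (\<lambda>x. f x - g x)"
  and cont_mult: "cont f \<Longrightarrow> cont g \<Longrightarrow> cont (\<lambda>x. f x * g x)"
  and cont_cnj: "cont f \<Longrightarrow> cont (\<lambda>x. cnj (f x))"
  by (auto simp: continuous_map_atin intro: tendsto_add tendsto_diff tendsto_mult tendsto_cnj)

lemma cont_const: "cont (\<lambda>x. c)" by simp

lemma cont_sum: "(\<And>i. i \<in> I \<Longrightarrow> cont (f i)) \<Longrightarrow> cont (\<lambda>x. \<Sum>i\<in>I. f i x)"
  by (auto simp: continuous_map_atin intro!: tendsto_sum)

lemmas cont_intros = cont_add cont_diff cont_mult cont_cnj cont_const cont_sum cont_inv cont_left cont_right

definition pts :: "'a list \<Rightarrow> bool" where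
  "pts as \<longleftrightarrow> as \<noteq> [] \<and> set as \<subseteq> carrier G"

definition left_mean :: "('a \<Rightarrow> complex) \<Rightarrow> complex \<Rightarrow> bool" where
  "left_mean f c \<longleftrightarrow> (\<forall>e>0. \<exists>as. pts as \<and> (\<forall>x\<in>carrier G. cmod (avg as (\<lambda>a. f (a \<otimes> x)) - c) \<le> e))"

definition right_mean :: "('a \<Rightarrow> complex) \<Rightarrow> complex \<Rightarrow> bool" where
  "right_mean f c \<longleftrightarrow> (\<forall>e>0. \<exists>as. pts as \<and> (\<forall>x\<in>carrier G. cmod (avg as (\<lambda>a. f (x \<otimes> a)) - c) \<le> e))"

text \<open>
  Left and right translations commute, so the average of \<open>f\<close> over all products \<open>a \<otimes> b\<close>, with \<open>a\<close> from a
  good list for \<open>c\<close> and \<open>b\<close> from a good list for \<open>d\<close>, is close to both constants. This gives uniqueness of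
  the mean, and it is the reason for considering both kinds of translates.
\<close>

lemma left_mean_eq_right_mean:
  assumes "left_mean f c" "right_mean f d"
  shows "c = d"
proof (rule ccontr)
  assume "c \<noteq> d"
  define e where "e = cmod (c - d) / 3"
  have e: "e > 0" using \<open>c \<noteq> d\<close> by (simp add: e_def)
  obtain as where as: "pts as" "\<And>x. x \<in> carrier G \<Longrightarrow> cmod (avg as (\<lambda>a. f (a \<otimes> x)) - c) \<le> e"
    using assms(1) e unfolding left_mean_def by blast
  obtain bs where bs: "pts bs" "\<And>x. x \<in> carrier G \<Longrightarrow> cmod (avg bs (\<lambda>b. f (x \<otimes> b)) - d) \<le> e"
    using assms(2) e unfolding right_mean_def by blast
  have 1: "cmod (avg bs (\<lambda>b. avg as (\<lambda>a. f (a \<otimes> b))) - c) \<le> e"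
    by (rule norm_avg_diff_le) (use as bs(1) in \<open>auto simp: pts_def\<close>)
  have 2: "cmod (avg as (\<lambda>a. avg bs (\<lambda>b. f (a \<otimes> b))) - d) \<le> e"
    by (rule norm_avg_diff_le) (use bs as(1) in \<open>auto simp: pts_def\<close>)
  let ?z = "avg bs (\<lambda>b. avg as (\<lambda>a. f (a \<otimes> b)))"
  have "cmod (c - d) \<le> cmod (c - ?z) + cmod (?z - d)"
    using norm_triangle_ineq[of "c - ?z" "?z - d"] by simp
  also have "\<dots> \<le> e + e"
    using 1 2 unfolding avg_swap[of as bs] by (simp add: norm_minus_commute)
  finally have "cmod (c - d) \<le> e + e" .
  then show False using e by (simp add: e_def)
qed

lemma right_mean_left_average:
  assumes "right_mean f c" "pts as"
  shows "right_mean (\<lambda>x. avg as (\<lambda>a. f (a \<otimes> x))) c"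
  unfolding right_mean_def
proof (intro allI impI)
  fix e :: real assume "e > 0"
  then obtain bs where bs: "pts bs" "\<And>x. x \<in> carrier G \<Longrightarrow> cmod (avg bs (\<lambda>b. f (x \<otimes> b)) - c) \<le> e"
    using assms(1) unfolding right_mean_def by blast
  have "cmod (avg bs (\<lambda>b. avg as (\<lambda>a. f (a \<otimes> (x \<otimes> b)))) - c) \<le> e" if x: "x \<in> carrier G" for x
  proof -
    have eq: "avg bs (\<lambda>b. avg as (\<lambda>a. f (a \<otimes> (x \<otimes> b)))) = avg as (\<lambda>a. avg bs (\<lambda>b. f ((a \<otimes> x) \<otimes> b)))"
      unfolding avg_swap[of bs] using x assms(2) bs(1) unfolding pts_def
      by (intro avg_cong) (metis m_assoc subsetD)
    show ?thesis unfolding eq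
      by (rule norm_avg_diff_le) (use x assms(2) bs(2) in \<open>auto simp: pts_def\<close>)
  qed
  then show "\<exists>bs. pts bs \<and> (\<forall>x\<in>carrier G. cmod (avg bs (\<lambda>b. avg as (\<lambda>a. f (a \<otimes> (x \<otimes> b)))) - c) \<le> e)"
    using bs(1) by blast
qed

lemma pts_product:
  assumes "pts as" "pts bs" shows "pts (map (\<lambda>(a, b). a \<otimes> b) (List.product as bs))"
proof -
  obtain a as' b bs' where "as = a # as'" "bs = b # bs'"
    using assms unfolding pts_def by (meson neq_Nil_conv)
  then have "List.product as bs \<noteq> []" by simp
  then show ?thesis using assms by (auto simp: pts_def)
qed

lemma avg_pts_product:
  assumes "pts as" "pts bs" "x \<in> carrier G"
  shows "avg (map (\<lambda>(a, b). a \<otimes> b) (List.product as bs)) (\<lambda>c. f (c \<otimes> x)) = avg bs (\<lambda>b. avg as (\<lambda>a. f (a \<otimes> (b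
    \<otimes> x))))"
proof -
  have "avg (map (\<lambda>(a, b). a \<otimes> b) (List.product as bs)) (\<lambda>c. f (c \<otimes> x)) =
    avg (List.product as bs) (\<lambda>(a, b). f (a \<otimes> (b \<otimes> x)))"
    unfolding avg_map using assms by (intro avg_cong) (auto simp: pts_def subset_iff m_assoc)
  also have "\<dots> = avg bs (\<lambda>b. avg as (\<lambda>a. f (a \<otimes> (b \<otimes> x))))"
    by (subst avg_product) (rule avg_swap)
  finally show ?thesis .
qed

text \<open>
  A list that is good for \<open>f\<close> stays good under further averaging. So one first averages for \<open>f\<close> and then
  chooses a list for the resulting average of \<open>g\<close>; its left mean has to be the right mean \<open>d\<close> of \<open>g\<close>,
  which is not affected by averaging over left translates. The existence of that left mean is an
  assumption because at first it is known only for multiples of real functions.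
\<close>

lemma left_mean_add:
  assumes f: "left_mean f c" and g: "right_mean g d"
    and ex: "\<And>as. pts as \<Longrightarrow> \<exists>e. left_mean (\<lambda>x. avg as (\<lambda>a. g (a \<otimes> x))) e"
  shows "left_mean (\<lambda>x. f x + g x) (c + d)"
  unfolding left_mean_def
proof (intro allI impI)
  fix e :: real assume "e > 0"
  then have e: "e / 2 > 0" by simp
  obtain as where as: "pts as" "\<And>x. x \<in> carrier G \<Longrightarrow> cmod (avg as (\<lambda>a. f (a \<otimes> x)) - c) \<le> e / 2"
    using f e unfolding left_mean_def by blast
  obtain d' where d': "left_mean (\<lambda>x. avg as (\<lambda>a. g (a \<otimes> x))) d'" using ex as(1) by blast
  have "d' = d" using left_mean_eq_right_mean[OF d' right_mean_left_average[OF g as(1)]] .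
  then obtain bs where bs: "pts bs"
    "\<And>x. x \<in> carrier G \<Longrightarrow> cmod (avg bs (\<lambda>b. avg as (\<lambda>a. g (a \<otimes> (b \<otimes> x)))) - d) \<le> e / 2"
    using d' e unfolding left_mean_def by blast
  let ?cs = "map (\<lambda>(a, b). a \<otimes> b) (List.product as bs)"
  have "cmod (avg ?cs (\<lambda>a. f (a \<otimes> x) + g (a \<otimes> x)) - (c + d)) \<le> e" if x: "x \<in> carrier G" for x
  proof -
    have "cmod (avg bs (\<lambda>b. avg as (\<lambda>a. f (a \<otimes> (b \<otimes> x)))) - c) \<le> e / 2"
      by (rule norm_avg_diff_le) (use as(2) bs(1) x in \<open>auto simp: pts_def\<close>)
    then show ?thesis
      using bs(2)[OF x] norm_triangle_ineq[of "avg ?cs (\<lambda>a. f (a \<otimes> x)) - c" "avg ?cs (\<lambda>a. g (a \<otimes> x)) - d"]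
      unfolding avg_add avg_pts_product[OF as(1) bs(1) x] by (simp add: algebra_simps)
  qed
  then show "\<exists>as. pts as \<and> (\<forall>x\<in>carrier G. cmod (avg as (\<lambda>a. f (a \<otimes> x) + g (a \<otimes> x)) - (c + d)) \<le> e)"
    using pts_product[OF as(1) bs(1)] by blast
qed

text \<open>
  Let \<open>s0\<close> be the infimum of the upper bounds of averages of left translates of \<open>g\<close>. An average \<open>\<phi>\<close> whose
  maximum is close to \<open>s0\<close> cannot be much smaller than \<open>s0\<close> anywhere: the left translates by a finite
  list \<open>bs\<close>, chosen beforehand and independent of \<open>\<phi>\<close>, bring every point close to any given point, so
  averaging \<open>\<phi>\<close> over \<open>bs\<close> would spread a small value over the whole group and lower the maximum below
  \<open>s0\<close>.
\<close>

lemma real_left_average_near_constant: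
  fixes g :: "'a \<Rightarrow> real"
  assumes g: "continuous_map T euclidean g"
  obtains s where "\<And>e. e > 0 \<Longrightarrow> \<exists>as. pts as \<and> (\<forall>x\<in>carrier G. \<bar>avg as (\<lambda>a. g (a \<otimes> x)) - s\<bar> \<le> e)"
proof -
  define S where "S = {s. \<exists>as. pts as \<and> (\<forall>x\<in>carrier G. avg as (\<lambda>a. g (a \<otimes> x)) \<le> s)}"
  obtain B where B: "\<And>x. x \<in> carrier G \<Longrightarrow> \<bar>g x\<bar> \<le> B"
    using cont_bounded[OF g] by (metis real_norm_def)
  have lower: "s \<ge> - B" if "s \<in> S" for s
  proof -
    obtain as where as: "pts as" "avg as (\<lambda>a. g (a \<otimes> \<one>)) \<le> s" using \<open>s \<in> S\<close> unfolding S_def by blast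
    have "\<bar>avg as (\<lambda>a. g (a \<otimes> \<one>))\<bar> \<le> B"
      using norm_avg_le[of as "\<lambda>a. g (a \<otimes> \<one>)" B] B as(1) by (auto simp: pts_def)
    with as(2) show ?thesis by linarith
  qed
  have "pts [\<one>]" by (simp add: pts_def)
  moreover have "avg [\<one>] (\<lambda>a. g (a \<otimes> x)) \<le> B" if "x \<in> carrier G" for x
    using B[OF that] that by (simp add: avg_def)
  ultimately have "B \<in> S" unfolding S_def by blast
  define s0 where "s0 = Inf S"
  have bdd: "bdd_below S" using lower by (auto simp: bdd_below_def)
  have s0_le: "s0 \<le> s" if "s \<in> S" for s using that bdd by (simp add: s0_def cInf_lower)
  have "\<exists>as. pts as \<and> (\<forall>x\<in>carrier G. \<bar>avg as (\<lambda>a. g (a \<otimes> x)) - s0\<bar> \<le> e)" if "e > 0" for e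
  proof -
    define d where "d = e / 3"
    have d: "d > 0" using that by (simp add: d_def)
    have "continuous_map (prod_topology T T) euclidean (\<lambda>p. g (fst p \<otimes> snd p))"
      using continuous_map_compose[OF continuous_mult g] by (simp add: o_def case_prod_unfold)
    from continuous_map_uniform_net[OF compact compact this d] obtain C where
      C: "finite C" "C \<subseteq> carrier G"
        "\<And>y. y \<in> carrier G \<Longrightarrow> \<exists>c\<in>C. \<forall>x\<in>carrier G. dist (g (x \<otimes> y)) (g (x \<otimes> c)) < d"
      by (auto simp: topspace_eq)
    have "finite ((\<lambda>(c, c'). c \<otimes> inv c') ` (C \<times> C))" using C(1) by simp
    then obtain bs where bs: "set bs = (\<lambda>(c, c'). c \<otimes> inv c') ` (C \<times> C)" using finite_list by blast
    have "C \<noteq> {}" using C(3)[of \<one>] by auto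
    then have pbs: "pts bs" using bs C(2) by (auto simp: pts_def)
    let ?m = "length bs"
    have m: "?m > 0" using pbs by (simp add: pts_def)
    \<comment> \<open>being close in the sense of the net is invariant under left translation, so if \<open>x\<close> is close to
      \<open>c\<close> and \<open>x0\<close> is close to \<open>c0\<close>, then \<open>c0 \<otimes> inv c\<close> moves \<open>x\<close> close to \<open>c0\<close> and hence close to \<open>x0\<close>\<close>
    have cover: "\<exists>b\<in>set bs. \<forall>a\<in>carrier G. \<bar>g (a \<otimes> (b \<otimes> x)) - g (a \<otimes> x0)\<bar> \<le> 2 * d"
      if x: "x \<in> carrier G" "x0 \<in> carrier G" for x x0
    proof -
      obtain c where c: "c \<in> C" "\<And>a. a \<in> carrier G \<Longrightarrow> dist (g (a \<otimes> x)) (g (a \<otimes> c)) < d"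
        using C(3)[OF x(1)] by blast
      obtain c0 where c0: "c0 \<in> C" "\<And>a. a \<in> carrier G \<Longrightarrow> dist (g (a \<otimes> x0)) (g (a \<otimes> c0)) < d"
        using C(3)[OF x(2)] by blast
      have cc: "c \<in> carrier G" "c0 \<in> carrier G" using c(1) c0(1) C(2) by auto
      have "\<bar>g (a \<otimes> ((c0 \<otimes> inv c) \<otimes> x)) - g (a \<otimes> x0)\<bar> \<le> 2 * d" if a: "a \<in> carrier G" for a
      proof -
        have "a \<otimes> (c0 \<otimes> inv c \<otimes> x) = (a \<otimes> (c0 \<otimes> inv c)) \<otimes> x" "(a \<otimes> (c0 \<otimes> inv c)) \<otimes> c = a \<otimes> c0"
          using a cc x by (simp_all add: m_assoc)
        then show ?thesis using c(2)[of "a \<otimes> (c0 \<otimes> inv c)"] c0(2)[OF a] a cc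
          by (simp add: dist_real_def)
      qed
      moreover have "c0 \<otimes> inv c \<in> set bs" unfolding bs using c(1) c0(1) by auto
      ultimately show ?thesis by blast
    qed
    \<comment> \<open>the slack \<open>d / ?m\<close> is exactly what averaging over \<open>bs\<close> gains\<close>
    have "Inf S < s0 + d / ?m" using d m by (simp add: s0_def)
    then obtain s where s: "s \<in> S" "s < s0 + d / ?m"
      using \<open>B \<in> S\<close> bdd by (metis cInf_less_iff empty_iff)
    then obtain as where as: "pts as" "\<And>x. x \<in> carrier G \<Longrightarrow> avg as (\<lambda>a. g (a \<otimes> x)) \<le> s"
      unfolding S_def by blast
    have "\<bar>avg as (\<lambda>a. g (a \<otimes> x0)) - s0\<bar> \<le> e" if x0: "x0 \<in> carrier G" for x0
    proof -
      have "avg as (\<lambda>a. g (a \<otimes> x0)) \<ge> s0 - 3 * d"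
      proof (rule ccontr)
        assume low: "\<not> ?thesis"
        have "avg (map (\<lambda>(a, b). a \<otimes> b) (List.product as bs)) (\<lambda>c. g (c \<otimes> x)) \<le> s - d / ?m"
          if x: "x \<in> carrier G" for x
        proof -
          obtain b where b: "b \<in> set bs" "\<And>a. a \<in> carrier G \<Longrightarrow> \<bar>g (a \<otimes> (b \<otimes> x)) - g (a \<otimes> x0)\<bar> \<le> 2 * d"
            using cover[OF x x0] by blast
          have "avg as (\<lambda>a. g (a \<otimes> (b \<otimes> x))) \<le> avg as (\<lambda>a. g (a \<otimes> x0) + 2 * d)"
          proof (rule avg_mono)
            fix a assume "a \<in> set as"
            then have "a \<in> carrier G" using as(1) by (auto simp: pts_def)
            from b(2)[OF this] show "g (a \<otimes> (b \<otimes> x)) \<le> g (a \<otimes> x0) + 2 * d" by linarith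
          qed
          also have "\<dots> = avg as (\<lambda>a. g (a \<otimes> x0)) + 2 * d"
            using as(1) by (simp add: avg_add avg_const pts_def)
          also have "\<dots> \<le> s - d" using low s0_le[OF s(1)] by simp
          finally have "avg bs (\<lambda>b. avg as (\<lambda>a. g (a \<otimes> (b \<otimes> x)))) \<le> s - (s - (s - d)) / ?m"
            using b(1) as(2) pbs x by (intro avg_le_drop[of _ _ _ b]) (auto simp: pts_def)
          then show ?thesis by (simp add: avg_pts_product[OF as(1) pbs x])
        qed
        then have "s - d / ?m \<in> S" unfolding S_def using pts_product[OF as(1) pbs] by blast
        then show False using s0_le s(2) by force
      qed
      moreover have "avg as (\<lambda>a. g (a \<otimes> x0)) \<le> s0 + d"
      proof -
        have "d / ?m \<le> d" using d m
          by (simp add: divide_le_eq Suc_le_eq)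
        then show ?thesis using as(2)[OF x0] s(2) by linarith
      qed
      ultimately show ?thesis using d by (simp add: d_def)
    qed
    with as(1) show ?thesis by blast
  qed
  then show thesis using that by blast
qed

lemma left_mean_real:
  assumes "continuous_map T euclidean (g :: 'a \<Rightarrow> real)"
  shows "\<exists>c. left_mean (\<lambda>x. complex_of_real (g x)) (of_real c)"
proof -
  obtain s where s: "\<And>e. e > 0 \<Longrightarrow> \<exists>as. pts as \<and> (\<forall>x\<in>carrier G. \<bar>avg as (\<lambda>a. g (a \<otimes> x)) - s\<bar> \<le> e)"
    using real_left_average_near_constant[OF assms] by blast
  have "left_mean (\<lambda>x. complex_of_real (g x)) (of_real s)"
    unfolding left_mean_def avg_of_real of_real_diff[symmetric] norm_of_real using s by blast
  then show ?thesis by blast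
qed

lemma left_mean_cmult:
  assumes "left_mean f c" shows "left_mean (\<lambda>x. k * f x) (k * c)"
  unfolding left_mean_def
proof (intro allI impI)
  fix e :: real assume "e > 0"
  then have "e / (cmod k + 1) > 0" by (smt (verit) divide_pos_pos norm_ge_zero)
  then obtain as where as: "pts as" "\<And>x. x \<in> carrier G \<Longrightarrow> cmod (avg as (\<lambda>a. f (a \<otimes> x)) - c) \<le> e / (cmod k + 1)"
    using assms unfolding left_mean_def by blast
  have "cmod (avg as (\<lambda>a. k * f (a \<otimes> x)) - k * c) \<le> e" if x: "x \<in> carrier G" for x
  proof -
    have "cmod (avg as (\<lambda>a. k * f (a \<otimes> x)) - k * c) = cmod k * cmod (avg as (\<lambda>a. f (a \<otimes> x)) - c)"
      by (simp add: avg_cmult norm_mult flip: right_diff_distrib)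
    also have "\<dots> \<le> (cmod k + 1) * (e / (cmod k + 1))"
      by (rule mult_mono) (use as(2)[OF x] in auto)
    also have "\<dots> = e" by (smt (verit) norm_ge_zero nonzero_mult_div_cancel_left times_divide_eq_right)
    finally show ?thesis .
  qed
  then show "\<exists>as. pts as \<and> (\<forall>x\<in>carrier G. cmod (avg as (\<lambda>a. k * f (a \<otimes> x)) - k * c) \<le> e)"
    using as(1) by blast
qed

lemma left_mean_inv_imp_right_mean:
  assumes "left_mean (\<lambda>x. f (inv x)) c" shows "right_mean f c"
  unfolding right_mean_def
proof (intro allI impI)
  fix e :: real assume "e > 0"
  then obtain as where as: "pts as" "\<And>x. x \<in> carrier G \<Longrightarrow> cmod (avg as (\<lambda>a. f (inv (a \<otimes> x))) - c) \<le> e"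
    using assms unfolding left_mean_def by blast
  have "cmod (avg (map (\<lambda>a. inv a) as) (\<lambda>a. f (x \<otimes> a)) - c) \<le> e" if x: "x \<in> carrier G" for x
  proof -
    have "avg (map (\<lambda>a. inv a) as) (\<lambda>a. f (x \<otimes> a)) = avg as (\<lambda>a. f (inv (a \<otimes> inv x)))"
      unfolding avg_map using as(1) x by (intro avg_cong) (auto simp: pts_def inv_mult_group subset_iff)
    then show ?thesis using as(2)[of "inv x"] x by simp
  qed
  moreover have "pts (map (\<lambda>a. inv a) as)" using as(1) by (auto simp: pts_def)
  ultimately show "\<exists>as. pts as \<and> (\<forall>x\<in>carrier G. cmod (avg as (\<lambda>a. f (x \<otimes> a)) - c) \<le> e)" by blast
qed

lemma cont_avg_left:
  assumes "continuous_map T euclidean (f :: 'a \<Rightarrow> 'x::real_normed_field)" "pts as"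
  shows "continuous_map T euclidean (\<lambda>x. avg as (\<lambda>a. f (a \<otimes> x)))"
  using assms by (intro continuous_map_avg cont_left) (auto simp: pts_def)

lemma left_mean_exists:
  assumes "cont f" shows "\<exists>c. left_mean f c"
proof -
  obtain c where c: "left_mean (\<lambda>x. complex_of_real (Re (f x))) c"
    using left_mean_real[OF cont_Re[OF assms]] by blast
  have "\<exists>d. left_mean (\<lambda>x. complex_of_real (Im (f (inv x)))) d"
    using left_mean_real[OF cont_inv[OF cont_Im[OF assms]]] by blast
  then obtain d where d: "left_mean (\<lambda>x. \<i> * complex_of_real (Im (f (inv x)))) (\<i> * d)"
    using left_mean_cmult by blast
  have "left_mean (\<lambda>x. complex_of_real (Re (f x)) + \<i> * complex_of_real (Im (f x))) (c + \<i> * d)"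
  proof (rule left_mean_add[OF c])
    show "right_mean (\<lambda>x. \<i> * complex_of_real (Im (f x))) (\<i> * d)"
      using d by (rule left_mean_inv_imp_right_mean)
    fix as assume "pts as"
    from left_mean_real[OF cont_avg_left[OF cont_Im[OF assms] this]]
    show "\<exists>e. left_mean (\<lambda>x. avg as (\<lambda>a. \<i> * complex_of_real (Im (f (a \<otimes> x))))) e"
      unfolding avg_cmult avg_of_real using left_mean_cmult by blast
  qed
  then show ?thesis by (auto simp flip: complex_eq)
qed

lemma right_mean_exists: "cont f \<Longrightarrow> \<exists>c. right_mean f c"
  using left_mean_exists[OF cont_inv] left_mean_inv_imp_right_mean by blast

text \<open>
  On continuous functions this is the integral with respect to the normalised Haar measure.
\<close>

definition haar :: "('a \<Rightarrow> complex) \<Rightarrow> complex" where "haar f = (THE c. left_mean f c)"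

lemma haar_eqI:
  assumes "cont f" "left_mean f c" shows "haar f = c"
  unfolding haar_def
proof (rule the_equality)
  show "left_mean f c" by fact
  obtain d where "right_mean f d" using right_mean_exists assms(1) by blast
  then show "c' = c" if "left_mean f c'" for c'
    using left_mean_eq_right_mean assms(2) that by metis
qed

lemma left_mean_haar: "cont f \<Longrightarrow> left_mean f (haar f)"
  using left_mean_exists haar_eqI by metis

lemma right_mean_haar: "cont f \<Longrightarrow> right_mean f (haar f)"
  using right_mean_exists left_mean_haar left_mean_eq_right_mean by metis

lemma haar_eqI_right: "cont f \<Longrightarrow> right_mean f c \<Longrightarrow> haar f = c"
  using left_mean_haar left_mean_eq_right_mean by blast

lemma haar_cong: "(\<And>x. x \<in> carrier G \<Longrightarrow> f x = g x) \<Longrightarrow> haar f = haar g"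
proof -
  assume eq: "\<And>x. x \<in> carrier G \<Longrightarrow> f x = g x"
  have "avg as (\<lambda>a. f (a \<otimes> x)) = avg as (\<lambda>a. g (a \<otimes> x))" if "pts as" "x \<in> carrier G" for as x
    using that by (intro avg_cong eq) (auto simp: pts_def)
  then have "left_mean f = left_mean g"
    unfolding left_mean_def fun_eq_iff by (simp cong: conj_cong ball_cong)
  then show "haar f = haar g" by (simp add: haar_def)
qed

lemma haar_add: assumes "cont f" "cont g" shows "haar (\<lambda>x. f x + g x) = haar f + haar g"
proof (rule haar_eqI)
  show "left_mean (\<lambda>x. f x + g x) (haar f + haar g)"
    using assms by (intro left_mean_add left_mean_haar right_mean_haar left_mean_exists cont_avg_left) auto
qed (use assms in \<open>auto intro: cont_intros\<close>)

lemma haar_cmult: "cont f \<Longrightarrow> haar (\<lambda>x. k * f x) = k * haar f"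
  by (intro haar_eqI left_mean_cmult left_mean_haar cont_intros)

lemma haar_diff: "cont f \<Longrightarrow> cont g \<Longrightarrow> haar (\<lambda>x. f x - g x) = haar f - haar g"
  using haar_add[of f "\<lambda>x. (-1) * g x"] haar_cmult[of g "-1"] cont_mult[OF cont_const[of "-1"], of g] by simp

lemma haar_0: "haar (\<lambda>x. 0) = 0"
  using haar_cmult[of "\<lambda>x. 0" 0] by simp

lemma haar_sum:
  assumes "finite I" "\<And>i. i \<in> I \<Longrightarrow> cont (f i)"
  shows "haar (\<lambda>x. \<Sum>i\<in>I. f i x) = (\<Sum>i\<in>I. haar (f i))"
  using assms by (induction I rule: finite_induct) (auto simp: haar_0 haar_add cont_sum)

lemma haar_const: "haar (\<lambda>x. c) = c"
proof (rule haar_eqI[OF cont_const])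
  have "pts [\<one>]" by (simp add: pts_def)
  then show "left_mean (\<lambda>x. c) c"
    unfolding left_mean_def using avg_const[of _ c] by (metis diff_self norm_zero less_imp_le pts_def)
qed

lemma haar_left: assumes "cont f" "g \<in> carrier G" shows "haar (\<lambda>x. f (g \<otimes> x)) = haar f"
proof (rule haar_eqI_right)
  show "cont (\<lambda>x. f (g \<otimes> x))" using assms by (rule cont_left)
  have "right_mean (\<lambda>x. avg [g] (\<lambda>a. f (a \<otimes> x))) (haar f)"
    using assms by (intro right_mean_left_average right_mean_haar) (auto simp: pts_def)
  then show "right_mean (\<lambda>x. f (g \<otimes> x)) (haar f)" by (simp add: avg_def)
qed

lemma haar_right: assumes "cont f" "g \<in> carrier G" shows "haar (\<lambda>x. f (x \<otimes> g)) = haar f"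
proof (rule haar_eqI)
  show "cont (\<lambda>x. f (x \<otimes> g))" using assms by (rule cont_right)
  show "left_mean (\<lambda>x. f (x \<otimes> g)) (haar f)"
    unfolding left_mean_def
  proof (intro allI impI)
    fix e :: real assume "e > 0"
    then obtain as where as: "pts as" "\<And>x. x \<in> carrier G \<Longrightarrow> cmod (avg as (\<lambda>a. f (a \<otimes> x)) - haar f) \<le> e"
      using left_mean_haar[OF assms(1)] unfolding left_mean_def by blast
    have "avg as (\<lambda>a. f (a \<otimes> x \<otimes> g)) = avg as (\<lambda>a. f (a \<otimes> (x \<otimes> g)))" if "x \<in> carrier G" for x
      using that assms(2) as(1) by (intro avg_cong) (auto simp: pts_def m_assoc subset_iff)
    then show "\<exists>as. pts as \<and> (\<forall>x\<in>carrier G. cmod (avg as (\<lambda>a. f (a \<otimes> x \<otimes> g)) - haar f) \<le> e)"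
      using as assms(2) by (metis m_closed)
  qed
qed

lemma haar_left_average:
  assumes "cont f" "pts as" shows "haar (\<lambda>x. avg as (\<lambda>a. f (a \<otimes> x))) = haar f"
  by (rule haar_eqI_right[OF cont_avg_left[OF assms] right_mean_left_average[OF right_mean_haar[OF assms(1)]
    assms(2)]])

lemma haar_cnj: assumes "cont f" shows "haar (\<lambda>x. cnj (f x)) = cnj (haar f)"
proof (rule haar_eqI)
  show "cont (\<lambda>x. cnj (f x))" using assms by (rule cont_cnj)
  show "left_mean (\<lambda>x. cnj (f x)) (cnj (haar f))"
    using left_mean_haar[OF assms] unfolding left_mean_def avg_cnj complex_cnj_diff[symmetric] complex_mod_cnj .
qed

lemma norm_haar_le:
  assumes "cont f" "\<And>x. x \<in> carrier G \<Longrightarrow> cmod (f x) \<le> B"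
  shows "cmod (haar f) \<le> B"
proof (rule field_le_epsilon)
  fix e :: real assume "e > 0"
  then obtain as where as: "pts as" "cmod (avg as (\<lambda>a. f (a \<otimes> \<one>)) - haar f) \<le> e"
    using left_mean_haar[OF assms(1)] unfolding left_mean_def by blast
  have "cmod (avg as (\<lambda>a. f (a \<otimes> \<one>))) \<le> B"
    by (rule norm_avg_le) (use as(1) assms(2) in \<open>auto simp: pts_def\<close>)
  then show "cmod (haar f) \<le> B + e"
    using as(2) norm_triangle_ineq2[of "haar f" "avg as (\<lambda>a. f (a \<otimes> \<one>))"] by (simp add: norm_minus_commute)
qed

text \<open>
  Positivity is inherited from averages of values of \<open>g - f\<close>, which are arbitrarily close to the mean.
\<close>

lemma Re_haar_mono:
  assumes "cont f" "cont g" "\<And>x. x \<in> carrier G \<Longrightarrow> Re (f x) \<le> Re (g x)"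
  shows "Re (haar f) \<le> Re (haar g)"
proof (rule field_le_epsilon)
  fix e :: real assume "e > 0"
  have "cont (\<lambda>x. g x - f x)" using assms by (intro cont_intros)
  then obtain as where as: "pts as" "cmod (avg as (\<lambda>a. g (a \<otimes> \<one>) - f (a \<otimes> \<one>)) - haar (\<lambda>x. g x - f x)) \<le> e"
    using left_mean_haar \<open>e > 0\<close> unfolding left_mean_def by blast
  have Re_avg: "Re (avg as h) = avg as (\<lambda>a. Re (h a))" for h
  proof -
    have "Re (\<Sum>a\<leftarrow>as. h a) = (\<Sum>a\<leftarrow>as. Re (h a))" by (induction as) auto
    then show ?thesis by (simp add: avg_def)
  qed
  have "avg as (\<lambda>a. - Re (g (a \<otimes> \<one>) - f (a \<otimes> \<one>))) \<le> 0"
    by (rule avg_le) (use as(1) assms(3) in \<open>auto simp: pts_def\<close>)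
  moreover have "avg as (\<lambda>a. - Re (g (a \<otimes> \<one>) - f (a \<otimes> \<one>))) = - Re (avg as (\<lambda>a. g (a \<otimes> \<one>) - f (a \<otimes> \<one>)))"
    unfolding Re_avg using avg_cmult[of as "-1::real" "\<lambda>a. Re (g (a \<otimes> \<one>) - f (a \<otimes> \<one>))"] by simp
  moreover have "Re (avg as (\<lambda>a. g (a \<otimes> \<one>) - f (a \<otimes> \<one>))) - Re (haar (\<lambda>x. g x - f x)) \<le> e"
    using order_trans[OF complex_Re_le_cmod as(2)] by simp
  ultimately show "Re (haar f) \<le> Re (haar g) + e"
    using haar_diff[OF assms(2,1)] by simp
qed

text \<open>
  The mean of finitely many functions can be computed to any accuracy by one list of group elements:
  averaging further for a new function does not spoil the accuracy for the old ones.
\<close>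

lemma simultaneous_average:
  assumes "finite F" "\<And>f. f \<in> F \<Longrightarrow> cont f" "e > 0"
  shows "\<exists>as. pts as \<and> (\<forall>f\<in>F. \<forall>x\<in>carrier G. cmod (avg as (\<lambda>a. f (a \<otimes> x)) - haar f) \<le> e)"
  using assms(1,2)
proof (induction F rule: finite_induct)
  case empty
  have "pts [\<one>]" by (simp add: pts_def)
  then show ?case by auto
next
  case (insert f F)
  then obtain as where as: "pts as" "\<And>f x. f \<in> F \<Longrightarrow> x \<in> carrier G \<Longrightarrow> cmod (avg as (\<lambda>a. f (a \<otimes> x)) - haar f) \<le> e"
    by blast
  have f: "cont f" using insert by simp
  have Lf: "cont (\<lambda>x. avg as (\<lambda>a. f (a \<otimes> x)))" using cont_avg_left[OF f as(1)] .
  have "haar (\<lambda>x. avg as (\<lambda>a. f (a \<otimes> x))) = haar f"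
    by (rule haar_eqI_right[OF Lf right_mean_left_average[OF right_mean_haar[OF f] as(1)]])
  then obtain bs where bs: "pts bs"
    "\<And>x. x \<in> carrier G \<Longrightarrow> cmod (avg bs (\<lambda>b. avg as (\<lambda>a. f (a \<otimes> (b \<otimes> x)))) - haar f) \<le> e"
    using left_mean_haar[OF Lf] assms(3) unfolding left_mean_def by metis
  let ?cs = "map (\<lambda>(a, b). a \<otimes> b) (List.product as bs)"
  have "cmod (avg ?cs (\<lambda>a. h (a \<otimes> x)) - haar h) \<le> e" if h: "h \<in> insert f F" and x: "x \<in> carrier G" for h x
    unfolding avg_pts_product[OF as(1) bs(1) x]
  proof (cases "h = f")
    case False
    with h have "h \<in> F" by simp
    then show "cmod (avg bs (\<lambda>b. avg as (\<lambda>a. h (a \<otimes> (b \<otimes> x)))) - haar h) \<le> e"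
      by (intro norm_avg_diff_le[of bs]) (use as bs(1) x in \<open>auto simp: pts_def\<close>)
  qed (use bs x in auto)
  then show ?case using pts_product[OF as(1) bs(1)] by blast
qed

lemma cont_section_right:
  assumes F: "continuous_map (prod_topology T T) X (\<lambda>(x, y). F x y)" and x: "x \<in> carrier G"
  shows "continuous_map T X (\<lambda>y. F x y)"
proof -
  have "continuous_map T (prod_topology T T) (\<lambda>y. (x, y))"
    using x by (simp add: continuous_map_pairwise o_def topspace_eq)
  from continuous_map_compose[OF this F] show ?thesis by (simp add: o_def)
qed

lemma cont_section_left:
  assumes F: "continuous_map (prod_topology T T) X (\<lambda>(x, y). F x y)" and y: "y \<in> carrier G"
  shows "continuous_map T X (\<lambda>x. F x y)"
proof -
  have "continuous_map T (prod_topology T T) (\<lambda>x. (x, y))"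
    using y by (simp add: continuous_map_pairwise o_def topspace_eq)
  from continuous_map_compose[OF this F] show ?thesis by (simp add: o_def)
qed

lemma cont_haar:
  assumes F: "continuous_map (prod_topology T T) euclidean (\<lambda>(x, y). F x y)"
  shows "cont (\<lambda>y. haar (\<lambda>x. F x y))"
proof -
  have "\<exists>U. openin T U \<and> y0 \<in> U \<and> (\<forall>y\<in>U. haar (\<lambda>x. F x y) \<in> ball (haar (\<lambda>x. F x y0)) e)"
    if y0: "y0 \<in> topspace T" and e: "e > 0" for y0 e
  proof -
    have "e / 2 > 0" using e by simp
    from continuous_map_uniform_nbhd[OF compact F y0 this]
    obtain V where V: "openin T V" "y0 \<in> V" "\<And>x y. x \<in> topspace T \<Longrightarrow> y \<in> V \<Longrightarrow> dist (F x y) (F x y0) < e / 2"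
      by auto
    have "cmod (haar (\<lambda>x. F x y0) - haar (\<lambda>x. F x y)) < e" if y: "y \<in> V" for y
    proof -
      have "y \<in> carrier G" "y0 \<in> carrier G" using y y0 V(1) openin_subset topspace_eq by blast+
      then have c: "cont (\<lambda>x. F x y)" "cont (\<lambda>x. F x y0)" using cont_section_left[OF F] by auto
      have "cmod (haar (\<lambda>x. F x y0 - F x y)) \<le> e / 2"
        using V(3)[OF _ y] c by (intro norm_haar_le cont_intros) (auto simp: topspace_eq dist_norm
          norm_minus_commute less_imp_le)
      then show ?thesis using e c by (simp add: haar_diff)
    qed
    then show ?thesis using V(1,2) by (auto simp: dist_norm)
  qed
  then show ?thesis
    using Met_TC.continuous_map_to_metric[of T "\<lambda>y. haar (\<lambda>x. F x y)"] by simp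
qed

lemma continuous_map_swap_args:
  "continuous_map (prod_topology T T) X (\<lambda>(x, y). F x y) \<Longrightarrow>
    continuous_map (prod_topology T T) X (\<lambda>(y, x). F x y)"
  using continuous_map_compose[of "prod_topology T T" "prod_topology T T" "\<lambda>(x, y). (y, x)" X "\<lambda>(x, y). F x y"]
  by (simp add: o_def case_prod_unfold continuous_map_pairwise continuous_map_fst continuous_map_snd)

text \<open>
  By total boundedness of the sections \<open>\<lambda>x. F x y\<close> there is one list \<open>as\<close> whose average approximates the
  mean of all of them, uniformly in \<open>y\<close>, and also the mean of \<open>\<psi>\<close>. For the average over \<open>as\<close> in place of
  the mean in \<open>x\<close>, interchanging the order is just additivity.
\<close>

lemma haar_Fubini:
  assumes F: "continuous_map (prod_topology T T) euclidean (\<lambda>(x, y). F x y)"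
  shows "haar (\<lambda>x. haar (\<lambda>y. F x y)) = haar (\<lambda>y. haar (\<lambda>x. F x y))"
proof (rule ccontr)
  assume ne: "\<not> ?thesis"
  define \<phi> where "\<phi> = (\<lambda>y. haar (\<lambda>x. F x y))"
  define \<psi> where "\<psi> = (\<lambda>x. haar (\<lambda>y. F x y))"
  have \<phi>: "cont \<phi>" unfolding \<phi>_def by (rule cont_haar[OF F])
  have \<psi>: "cont \<psi>" unfolding \<psi>_def by (rule cont_haar[OF continuous_map_swap_args[OF F]])
  have s1: "cont (\<lambda>x. F x y)" if "y \<in> carrier G" for y using cont_section_left[OF F that] .
  have s2: "cont (\<lambda>y. F x y)" if "x \<in> carrier G" for x using cont_section_right[OF F that] .
  \<comment> \<open>the errors below add up to \<open>4 * e\<close>\<close>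
  define e where "e = cmod (haar \<psi> - haar \<phi>) / 5"
  have e: "e > 0" using ne by (simp add: e_def \<phi>_def \<psi>_def)
  from continuous_map_uniform_net[OF compact compact F e] obtain C where
    C: "finite C" "C \<subseteq> carrier G"
      "\<And>y. y \<in> carrier G \<Longrightarrow> \<exists>c\<in>C. \<forall>x\<in>carrier G. dist (F x y) (F x c) < e"
    by (auto simp: topspace_eq)
  have "\<exists>as. pts as \<and> (\<forall>f\<in>insert \<psi> ((\<lambda>c x. F x c) ` C). \<forall>x\<in>carrier G. cmod (avg as (\<lambda>a. f (a \<otimes> x)) - haar f)
    \<le> e)"
    using C s1 \<psi> e by (intro simultaneous_average) auto
  then obtain as where as: "pts as" "\<And>x. x \<in> carrier G \<Longrightarrow> cmod (avg as (\<lambda>a. \<psi> (a \<otimes> x)) - haar \<psi>) \<le> e"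
    "\<And>c x. c \<in> C \<Longrightarrow> x \<in> carrier G \<Longrightarrow> cmod (avg as (\<lambda>a. F (a \<otimes> x) c) - \<phi> c) \<le> e"
    unfolding \<phi>_def by auto
  have ac: "a \<otimes> \<one> = a" "a \<in> carrier G" if "a \<in> set as" for a using that as(1) by (auto simp: pts_def)
  have eq1: "avg as (\<lambda>a. f (a \<otimes> \<one>)) = avg as f" for f :: "'a \<Rightarrow> complex"
    using ac by (intro avg_cong) simp
  have near: "cmod (avg as (\<lambda>a. F a y) - \<phi> y) \<le> 3 * e" if y: "y \<in> carrier G" for y
  proof -
    obtain c where c: "c \<in> C" "\<And>x. x \<in> carrier G \<Longrightarrow> dist (F x y) (F x c) < e" using C(3)[OF y] by blast
    have cG: "c \<in> carrier G" using c(1) C(2) by auto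
    have 1: "cmod (avg as (\<lambda>a. F a y - F a c)) \<le> e"
      by (rule norm_avg_le) (use as(1) ac c(2) in \<open>auto simp: pts_def dist_norm less_imp_le\<close>)
    have 2: "cmod (haar (\<lambda>x. F x c - F x y)) \<le> e"
      using c(2) s1[OF y] s1[OF cG] by (intro norm_haar_le cont_intros) (auto simp: dist_norm
        norm_minus_commute less_imp_le)
    have 3: "cmod (avg as (\<lambda>a. F a c) - \<phi> c) \<le> e"
      using as(3)[OF c(1) one_closed] eq1[of "\<lambda>a. F a c"] by simp
    have eq: "avg as (\<lambda>a. F a y) - \<phi> y = avg as (\<lambda>a. F a y - F a c) + (avg as (\<lambda>a. F a c) - \<phi> c) + haar (\<lambda>x.
      F x c - F x y)"
      using s1[OF y] s1[OF cG] by (simp add: avg_diff haar_diff \<phi>_def)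
    show ?thesis unfolding eq
      using 1 2 3 norm_triangle_ineq[of "avg as (\<lambda>a. F a y - F a c) + (avg as (\<lambda>a. F a c) - \<phi> c)"
        "haar (\<lambda>x. F x c - F x y)"]
        norm_triangle_ineq[of "avg as (\<lambda>a. F a y - F a c)" "avg as (\<lambda>a. F a c) - \<phi> c"] by linarith
  qed
  have ca: "cont (\<lambda>y. avg as (\<lambda>a. F a y))" using ac s2 by (intro continuous_map_avg) auto
  have "cmod (haar (\<lambda>y. avg as (\<lambda>a. F a y) - \<phi> y)) \<le> 3 * e"
    using near ca \<phi> by (intro norm_haar_le cont_intros) auto
  then have A: "cmod (haar (\<lambda>y. avg as (\<lambda>a. F a y)) - haar \<phi>) \<le> 3 * e" using ca \<phi> by (simp add: haar_diff)
  have avgM: "haar (\<lambda>y. avg bs (\<lambda>a. F a y)) = avg bs \<psi>" if "set bs \<subseteq> carrier G" for bs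
  proof -
    have "haar (\<lambda>y. \<Sum>a\<leftarrow>bs. F a y) = (\<Sum>a\<leftarrow>bs. \<psi> a) \<and> cont (\<lambda>y. \<Sum>a\<leftarrow>bs. F a y)" using that
      by (induction bs) (auto simp: haar_0 haar_add s2 \<psi>_def cont_add)
    then show ?thesis unfolding avg_def by (simp add: divide_inverse mult.commute[of _ "inverse _"] haar_cmult)
  qed
  have "cmod (avg as \<psi> - haar \<psi>) \<le> e" using as(2)[OF one_closed] eq1[of \<psi>] by simp
  then have "cmod (haar \<psi> - haar \<phi>) \<le> 4 * e"
    using A avgM[of as] as(1) norm_triangle_ineq[of "haar \<psi> - avg as \<psi>" "avg as \<psi> - haar \<phi>"]
    by (simp add: pts_def norm_minus_commute)
  then show False using e by (simp add: e_def)
qed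

section \<open>The inner product of continuous functions\<close>

definition ip :: "('a \<Rightarrow> complex) \<Rightarrow> ('a \<Rightarrow> complex) \<Rightarrow> complex" where
  "ip f g = haar (\<lambda>x. f x * cnj (g x))"

definition nrm2 :: "('a \<Rightarrow> complex) \<Rightarrow> real" where
  "nrm2 f = Re (ip f f)"

lemma ip_cong: "(\<And>x. x \<in> carrier G \<Longrightarrow> f x = f' x) \<Longrightarrow> (\<And>x. x \<in> carrier G \<Longrightarrow> g x = g' x) \<Longrightarrow> ip f g = ip f' g'"
  unfolding ip_def by (rule haar_cong) simp

lemma ip_cnj: "cont f \<Longrightarrow> cont g \<Longrightarrow> cnj (ip f g) = ip g f"
  unfolding ip_def by (subst haar_cnj[symmetric]) (auto intro: cont_intros simp: mult.commute)

lemma ip_self: "cont f \<Longrightarrow> ip f f = complex_of_real (nrm2 f)"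
  unfolding nrm2_def using ip_cnj[of f f] by (simp add: complex_eq_iff)

lemma nrm2_nonneg: "cont f \<Longrightarrow> 0 \<le> nrm2 f"
  unfolding nrm2_def ip_def using Re_haar_mono[of "\<lambda>x. 0" "\<lambda>x. f x * cnj (f x)"]
  by (simp add: haar_0 cont_intros)

lemma nrm2_le:
  assumes "cont f" "B \<ge> 0" "\<And>x. x \<in> carrier G \<Longrightarrow> cmod (f x) \<le> B" shows "nrm2 f \<le> B\<^sup>2"
proof -
  have "cmod (ip f f) \<le> B\<^sup>2" unfolding ip_def
  proof (rule norm_haar_le)
    fix x assume "x \<in> carrier G"
    then show "cmod (f x * cnj (f x)) \<le> B\<^sup>2"
      using assms(2) assms(3)[of x] by (simp add: norm_mult power2_eq_square mult_mono)
  qed (intro cont_intros assms)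
  then show ?thesis unfolding nrm2_def using complex_Re_le_cmod order_trans by blast
qed

lemma ip_add: "cont f \<Longrightarrow> cont g \<Longrightarrow> cont h \<Longrightarrow> ip (\<lambda>x. f x + g x) h = ip f h + ip g h"
  unfolding ip_def by (subst haar_add[symmetric]) (auto intro: cont_intros simp: distrib_right)

lemma ip_diff: "cont f \<Longrightarrow> cont g \<Longrightarrow> cont h \<Longrightarrow> ip (\<lambda>x. f x - g x) h = ip f h - ip g h"
  unfolding ip_def by (subst haar_diff[symmetric]) (auto intro: cont_intros simp: left_diff_distrib)

lemma ip_cmult: "cont f \<Longrightarrow> cont h \<Longrightarrow> ip (\<lambda>x. c * f x) h = c * ip f h"
  unfolding ip_def by (subst haar_cmult[symmetric]) (auto intro: cont_intros simp: mult.assoc)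

lemma ip_sum: "finite I \<Longrightarrow> (\<And>i. i \<in> I \<Longrightarrow> cont (f i)) \<Longrightarrow> cont h \<Longrightarrow> ip (\<lambda>x. \<Sum>i\<in>I. f i x) h = (\<Sum>i\<in>I. ip (f i) h)"
  unfolding ip_def by (subst haar_sum[symmetric]) (auto intro: cont_intros simp: sum_distrib_right)

lemma ip_lincomb:
  assumes "finite I" "\<And>i. i \<in> I \<Longrightarrow> cont (f i)" "cont h"
  shows "ip (\<lambda>x. \<Sum>i\<in>I. c i * f i x) h = (\<Sum>i\<in>I. c i * ip (f i) h)"
proof -
  have "ip (\<lambda>x. \<Sum>i\<in>I. c i * f i x) h = (\<Sum>i\<in>I. ip (\<lambda>x. c i * f i x) h)"
    using assms by (intro ip_sum cont_intros) auto
  also have "\<dots> = (\<Sum>i\<in>I. c i * ip (f i) h)"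
    using assms by (intro sum.cong ip_cmult) auto
  finally show ?thesis .
qed

lemma ip_lincomb_right:
  assumes "finite I" "\<And>i. i \<in> I \<Longrightarrow> cont (f i)" "cont h"
  shows "ip h (\<lambda>x. \<Sum>i\<in>I. c i * f i x) = (\<Sum>i\<in>I. cnj (c i) * ip h (f i))"
proof -
  have "ip h (\<lambda>x. \<Sum>i\<in>I. c i * f i x) = cnj (ip (\<lambda>x. \<Sum>i\<in>I. c i * f i x) h)"
    using assms by (intro ip_cnj[symmetric] cont_intros) auto
  also have "\<dots> = (\<Sum>i\<in>I. cnj (c i) * cnj (ip (f i) h))" using assms by (simp add: ip_lincomb)
  also have "\<dots> = (\<Sum>i\<in>I. cnj (c i) * ip h (f i))" using assms by (intro sum.cong) (auto simp: ip_cnj)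
  finally show ?thesis .
qed

lemma nrm2_diff:
  assumes f: "cont f" and g: "cont g"
  shows "nrm2 (\<lambda>x. f x - c * g x) = nrm2 f - 2 * Re (cnj c * ip f g) + (cmod c)\<^sup>2 * nrm2 g"
proof -
  have cg: "cont (\<lambda>x. c * g x)" using g by (intro cont_intros)
  have d: "cont (\<lambda>x. f x - c * g x)" using f cg by (rule cont_diff)
  have r: "ip k (\<lambda>x. f x - c * g x) = ip k f - cnj c * ip k g" if k: "cont k" for k
  proof -
    have "ip k (\<lambda>x. f x - c * g x) = cnj (ip (\<lambda>x. f x - c * g x) k)" using ip_cnj[OF d k] by simp
    also have "\<dots> = cnj (ip f k) - cnj c * cnj (ip g k)"
      using ip_diff[OF f cg k] ip_cmult[OF g k, of c] by simp
    finally show ?thesis using ip_cnj f g k by simp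
  qed
  have "ip (\<lambda>x. f x - c * g x) (\<lambda>x. f x - c * g x) = (ip f f - cnj c * ip f g) - c * (ip g f - cnj c * ip g g)"
    unfolding ip_diff[OF f cg d] ip_cmult[OF g d] r[OF f] r[OF g] ..
  moreover have "ip g f = cnj (ip f g)" using ip_cnj[OF f g] by simp
  ultimately have eq: "ip (\<lambda>x. f x - c * g x) (\<lambda>x. f x - c * g x) =
    of_real (nrm2 f) - cnj c * ip f g - cnj (cnj c * ip f g) + c * cnj c * of_real (nrm2 g)"
    using ip_self[OF f] ip_self[OF g] by (simp add: algebra_simps)
  have "c * cnj c * of_real (nrm2 g) = of_real ((cmod c)\<^sup>2 * nrm2 g)"
    by (simp add: complex_norm_square del: of_real_power)
  then have "Re (c * cnj c * of_real (nrm2 g)) = (cmod c)\<^sup>2 * nrm2 g" by (simp only: Re_complex_of_real)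
  moreover have "Re (cnj (cnj c * ip f g)) = Re (cnj c * ip f g)" by (rule cnj.simps(1))
  ultimately show ?thesis
    unfolding nrm2_def[of "\<lambda>x. f x - c * g x"] eq plus_complex.simps minus_complex.simps Re_complex_of_real
      by linarith
qed

lemma nrm2_cmult: "cont f \<Longrightarrow> nrm2 (\<lambda>x. c * f x) = (cmod c)\<^sup>2 * nrm2 f"
  using nrm2_diff[of "\<lambda>x. 0" f "-c"] by (simp add: nrm2_def ip_def haar_0)

lemma Cauchy_Schwarz:
  assumes f: "cont f" and g: "cont g" shows "(cmod (ip f g))\<^sup>2 \<le> nrm2 f * nrm2 g"
proof -
  define a where "a = ip f g"
  have key: "2 * s * (cmod a)\<^sup>2 \<le> nrm2 f + s\<^sup>2 * (cmod a)\<^sup>2 * nrm2 g" for s :: real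
  proof -
    have "0 \<le> nrm2 (\<lambda>x. f x - (of_real s * a) * g x)" using f g by (intro nrm2_nonneg cont_intros)
    have "cnj (of_real s * a) * a = of_real (s * (cmod a)\<^sup>2)"
      using complex_norm_square[of a] by (simp add: mult_ac del: of_real_power)
    then have "Re (cnj (of_real s * a) * a) = s * (cmod a)\<^sup>2" by (simp only: Re_complex_of_real)
    moreover have "(cmod (of_real s * a))\<^sup>2 = s\<^sup>2 * (cmod a)\<^sup>2" by (simp add: norm_mult power_mult_distrib)
    ultimately show ?thesis using \<open>0 \<le> _\<close> unfolding nrm2_diff[OF f g] a_def[symmetric] by simp
  qed
  have g0: "nrm2 g \<ge> 0" using g by (rule nrm2_nonneg)
  show ?thesis
  proof (cases "nrm2 g = 0")
    case True
    have "(cmod a)\<^sup>2 = 0"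
    proof (rule ccontr)
      assume "\<not> ?thesis"
      then have "(cmod a)\<^sup>2 > 0" by simp
      then show False using key[of "(nrm2 f + 1) / (2 * (cmod a)\<^sup>2)"] True by simp
    qed
    then show ?thesis using True by (simp add: a_def)
  next
    case False
    with g0 have pos: "nrm2 g > 0" by simp
    have "(cmod a)\<^sup>2 / nrm2 g \<le> nrm2 f"
      using key[of "1 / nrm2 g"] pos by (simp add: power2_eq_square)
    then show ?thesis using pos by (simp add: divide_le_eq a_def)
  qed
qed

text \<open>
  Strict positivity. Finitely many left translates of the open set where \<open>f\<close> is not small cover the
  group, so an average of left translates of \<open>(cmod (f x))\<^sup>2\<close> has a positive lower bound, and averaging
  does not change the mean.
\<close>

lemma nrm2_eq_0:
  assumes f: "cont f" and 0: "nrm2 f = 0" and x0: "x0 \<in> carrier G"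
  shows "f x0 = 0"
proof (rule ccontr)
  assume "f x0 \<noteq> 0"
  define h where "h = (\<lambda>x. (cmod (f x))\<^sup>2)"
  define d where "d = h x0 / 2"
  have d: "d > 0" using \<open>f x0 \<noteq> 0\<close> by (simp add: d_def h_def)
  have hc: "continuous_map T euclidean h"
    using f unfolding h_def by (auto simp: continuous_map_atin intro!: tendsto_power tendsto_norm)
  have "continuous_map (prod_topology T T) euclidean (\<lambda>p. h (fst p \<otimes> snd p))"
    using continuous_map_compose[OF continuous_mult hc] by (simp add: o_def case_prod_unfold)
  from continuous_map_uniform_net[OF compact compact this d] obtain C where
    C: "finite C" "C \<subseteq> carrier G"
      "\<And>y. y \<in> carrier G \<Longrightarrow> \<exists>c\<in>C. \<forall>x\<in>carrier G. dist (h (x \<otimes> y)) (h (x \<otimes> c)) < d"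
    by (auto simp: topspace_eq)
  \<comment> \<open>\<open>x0 \<otimes> inv c\<close> moves \<open>c\<close> to \<open>x0\<close>, and therefore moves the points close to \<open>c\<close> to points where
    \<open>h\<close> is nearly as large as at \<open>x0\<close>\<close>
  obtain as where as: "set as = (\<lambda>c. x0 \<otimes> inv c) ` C" using C(1) finite_list finite_imageI by metis
  have "C \<noteq> {}" using C(3)[OF x0] by auto
  then have pas: "pts as" using as C(2) x0 by (auto simp: pts_def)
  let ?m = "length as"
  have m: "?m > 0" using pas by (simp add: pts_def)
  let ?hc = "\<lambda>x. complex_of_real (h x)"
  have hcc: "cont ?hc" using hc by (auto simp: continuous_map_atin intro: tendsto_of_real)
  have low: "avg as (\<lambda>a. h (a \<otimes> x)) \<ge> d / ?m" if x: "x \<in> carrier G" for x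
  proof -
    obtain c where c: "c \<in> C" "\<And>z. z \<in> carrier G \<Longrightarrow> dist (h (z \<otimes> x)) (h (z \<otimes> c)) < d" using C(3)[OF x] by blast
    have cG: "c \<in> carrier G" using c(1) C(2) by auto
    have "(x0 \<otimes> inv c) \<otimes> c = x0" using x0 cG by (simp add: m_assoc)
    then have "\<bar>h ((x0 \<otimes> inv c) \<otimes> x) - h x0\<bar> < d"
      using c(2)[of "x0 \<otimes> inv c"] x0 cG by (simp add: dist_real_def)
    then have "h ((x0 \<otimes> inv c) \<otimes> x) > d" unfolding d_def by linarith
    then have "avg as (\<lambda>a. - h (a \<otimes> x)) \<le> 0 - (0 - (- d)) / ?m"
      using as c(1) by (intro avg_le_drop[of _ _ _ "x0 \<otimes> inv c"]) (auto simp: h_def)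
    moreover have "avg as (\<lambda>a. - h (a \<otimes> x)) = - avg as (\<lambda>a. h (a \<otimes> x))"
      using avg_cmult[of as "-1::real" "\<lambda>a. h (a \<otimes> x)"] by simp
    ultimately show ?thesis by simp
  qed
  have "Re (haar (\<lambda>x. of_real (d / ?m))) \<le> Re (haar (\<lambda>x. avg as (\<lambda>a. ?hc (a \<otimes> x))))"
    using low by (intro Re_haar_mono cont_const cont_avg_left hcc pas) (simp add: avg_of_real)
  then have "d / ?m \<le> Re (haar ?hc)" unfolding haar_const haar_left_average[OF hcc pas] by simp
  moreover have "Re (haar ?hc) = nrm2 f"
    unfolding nrm2_def ip_def h_def by (simp only: complex_norm_square)
  moreover have "d / ?m > 0" using d m by simp
  ultimately show False using 0 by simp
qed

lemma nrm2_right_translate: "cont f \<Longrightarrow> g \<in> carrier G \<Longrightarrow> nrm2 (\<lambda>x. f (x \<otimes> g)) = nrm2 f"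
  unfolding nrm2_def ip_def by (subst haar_right[of "\<lambda>x. f x * cnj (f x)"]) (auto intro: cont_intros)

lemma ip_right_translate:
  assumes "cont f" "cont p" "g \<in> carrier G"
  shows "ip (\<lambda>x. f (x \<otimes> g)) p = ip f (\<lambda>x. p (x \<otimes> inv g))"
proof -
  have "ip f (\<lambda>x. p (x \<otimes> inv g)) = haar (\<lambda>x. f (x \<otimes> g) * cnj (p (x \<otimes> g \<otimes> inv g)))"
    unfolding ip_def using assms by (intro haar_right[symmetric]) (auto intro!: cont_intros)
  also have "\<dots> = ip (\<lambda>x. f (x \<otimes> g)) p"
    unfolding ip_def using assms by (intro haar_cong) (simp add: m_assoc)
  finally show ?thesis ..
qed

section \<open>Convolution operators\<close>

lemma jcont_mult: "cont f \<Longrightarrow> continuous_map (prod_topology T T) euclidean (\<lambda>(x, y). f (x \<otimes> y))"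
  using continuous_map_compose[OF continuous_mult] by (simp add: o_def case_prod_unfold)

lemma jcont_inv_mult:
  assumes "cont f" shows "continuous_map (prod_topology T T) euclidean (\<lambda>(x, y). f (inv x \<otimes> y))"
proof -
  have "continuous_map (prod_topology T T) (prod_topology T T) (\<lambda>p. (inv (fst p), snd p))"
    using continuous_map_compose[OF continuous_map_fst continuous_inv, of T]
    by (simp add: continuous_map_pairwise o_def continuous_map_snd)
  from continuous_map_compose[OF this jcont_mult[OF assms]] show ?thesis
    by (simp add: o_def case_prod_unfold)
qed

lemma jcont_fst: "cont f \<Longrightarrow> continuous_map (prod_topology T T) euclidean (\<lambda>(x, y). f x)"
  using continuous_map_compose[OF continuous_map_fst] by (simp add: o_def case_prod_unfold)

lemma jcont_snd: "cont f \<Longrightarrow> continuous_map (prod_topology T T) euclidean (\<lambda>(x, y). f y)"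
  using continuous_map_compose[OF continuous_map_snd] by (simp add: o_def case_prod_unfold)

lemma jcont_times:
  fixes F F' :: "'a \<Rightarrow> 'a \<Rightarrow> complex"
  shows "continuous_map X euclidean (\<lambda>(x, y). F x y) \<Longrightarrow> continuous_map X euclidean (\<lambda>(x, y). F' x y)
    \<Longrightarrow> continuous_map X euclidean (\<lambda>(x, y). F x y * F' x y)"
  by (auto simp: continuous_map_atin case_prod_unfold intro: tendsto_mult)

lemmas jcont_intros = jcont_mult jcont_inv_mult jcont_fst jcont_snd jcont_times

text \<open>
  Correlation with \<open>h\<close>; this operator commutes with right translations.
\<close>

definition cor :: "('a \<Rightarrow> complex) \<Rightarrow> ('a \<Rightarrow> complex) \<Rightarrow> 'a \<Rightarrow> complex" where
  "cor h f x = haar (\<lambda>y. cnj (h y) * f (y \<otimes> x))"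

text \<open>
  Convolution with \<open>h\<close>, the adjoint of the previous operator.
\<close>

definition conv :: "('a \<Rightarrow> complex) \<Rightarrow> ('a \<Rightarrow> complex) \<Rightarrow> 'a \<Rightarrow> complex" where
  "conv h f x = haar (\<lambda>y. h y * f (inv y \<otimes> x))"

lemma cont_cor: "cont h \<Longrightarrow> cont f \<Longrightarrow> cont (cor h f)"
  unfolding cor_def by (intro cont_haar jcont_intros cont_intros)

lemma cont_conv: "cont h \<Longrightarrow> cont f \<Longrightarrow> cont (conv h f)"
  unfolding conv_def by (intro cont_haar jcont_intros cont_intros)

lemma cont_inv_left: "cont f \<Longrightarrow> x \<in> carrier G \<Longrightarrow> cont (\<lambda>y. f (inv y \<otimes> x))"
  using cont_section_left[OF jcont_inv_mult] .

lemma cor_add: "cont h \<Longrightarrow> cont f \<Longrightarrow> cont g \<Longrightarrow> x \<in> carrier G \<Longrightarrow> cor h (\<lambda>x. f x + g x) x = cor h f x + cor h g x"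
  unfolding cor_def by (subst haar_add[symmetric]) (auto intro!: cont_intros simp: distrib_left)

lemma cor_cmult: "cont h \<Longrightarrow> cont f \<Longrightarrow> x \<in> carrier G \<Longrightarrow> cor h (\<lambda>x. c * f x) x = c * cor h f x"
  unfolding cor_def by (subst haar_cmult[symmetric]) (auto intro!: cont_intros simp: mult_ac)

lemma conv_add: "cont h \<Longrightarrow> cont f \<Longrightarrow> cont g \<Longrightarrow> x \<in> carrier G \<Longrightarrow> conv h (\<lambda>x. f x + g x) x = conv h f x + conv h g x"
  unfolding conv_def by (subst haar_add[symmetric]) (auto intro!: cont_mult cont_inv_left simp: distrib_left)

lemma conv_cmult: "cont h \<Longrightarrow> cont f \<Longrightarrow> x \<in> carrier G \<Longrightarrow> conv h (\<lambda>x. c * f x) x = c * conv h f x"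
  unfolding conv_def by (subst haar_cmult[symmetric]) (auto intro!: cont_mult cont_inv_left simp: mult_ac)

lemma cor_cong: "(\<And>x. x \<in> carrier G \<Longrightarrow> f x = g x) \<Longrightarrow> x \<in> carrier G \<Longrightarrow> cor h f x = cor h g x"
  unfolding cor_def by (rule haar_cong) simp

lemma cor_right_translate:
  "x \<in> carrier G \<Longrightarrow> g \<in> carrier G \<Longrightarrow> cor h (\<lambda>z. f (z \<otimes> g)) x = cor h f (x \<otimes> g)"
  unfolding cor_def by (rule haar_cong) (simp add: m_assoc)

lemma conv_right_translate:
  "x \<in> carrier G \<Longrightarrow> g \<in> carrier G \<Longrightarrow> conv h (\<lambda>z. f (z \<otimes> g)) x = conv h f (x \<otimes> g)"
  unfolding conv_def by (rule haar_cong) (simp add: m_assoc)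

text \<open>
  Fubini together with left invariance, used in the substitution of \<open>inv y \<otimes> x\<close> for \<open>x\<close>.
\<close>

lemma ip_cor:
  assumes h: "cont h" and f: "cont f" and g: "cont g"
  shows "ip (cor h f) g = ip f (conv h g)"
proof -
  have "ip (cor h f) g = haar (\<lambda>x. haar (\<lambda>y. cnj (h y) * f (y \<otimes> x) * cnj (g x)))"
    unfolding ip_def cor_def
  proof (rule haar_cong)
    fix x assume x: "x \<in> carrier G"
    have "haar (\<lambda>y. cnj (g x) * (cnj (h y) * f (y \<otimes> x))) = cnj (g x) * haar (\<lambda>y. cnj (h y) * f (y \<otimes> x))"
      using h f x by (intro haar_cmult cont_intros)
    then show "haar (\<lambda>y. cnj (h y) * f (y \<otimes> x)) * cnj (g x) = haar (\<lambda>y. cnj (h y) * f (y \<otimes> x) * cnj (g x))"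
      by (simp add: mult_ac)
  qed
  also have "\<dots> = haar (\<lambda>y. haar (\<lambda>x. cnj (h y) * f (y \<otimes> x) * cnj (g x)))"
    by (rule haar_Fubini[symmetric]) (intro jcont_intros cont_intros h f g)
  also have "\<dots> = haar (\<lambda>y. haar (\<lambda>x. cnj (h y) * f x * cnj (g (inv y \<otimes> x))))"
  proof (rule haar_cong)
    fix y assume y: "y \<in> carrier G"
    have "haar (\<lambda>x. cnj (h y) * f x * cnj (g (inv y \<otimes> x))) = haar (\<lambda>x. cnj (h y) * f (y \<otimes> x) * cnj (g (inv y
      \<otimes> (y \<otimes> x))))"
      using f g y by (intro haar_left[symmetric] cont_intros) auto
    also have "\<dots> = haar (\<lambda>x. cnj (h y) * f (y \<otimes> x) * cnj (g x))"
      using y by (intro haar_cong) (simp flip: m_assoc)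
    finally show "haar (\<lambda>x. cnj (h y) * f (y \<otimes> x) * cnj (g x)) = haar (\<lambda>x. cnj (h y) * f x * cnj (g (inv y \<otimes>
      x)))" ..
  qed
  also have "\<dots> = haar (\<lambda>x. haar (\<lambda>y. cnj (h y) * f x * cnj (g (inv y \<otimes> x))))"
  proof (rule haar_Fubini)
    show "continuous_map (prod_topology T T) euclidean (\<lambda>(x, y). cnj (h x) * f y * cnj (g (inv x \<otimes> y)))"
      using jcont_inv_mult[OF cont_cnj[OF g]] by (intro jcont_times jcont_fst jcont_snd cont_cnj h f)
  qed
  also have "\<dots> = ip f (conv h g)"
    unfolding ip_def conv_def
  proof (rule haar_cong)
    fix x assume x: "x \<in> carrier G"
    have c: "cont (\<lambda>y. h y * g (inv y \<otimes> x))" using h g x by (intro cont_mult cont_inv_left)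
    have "haar (\<lambda>y. f x * cnj (h y * g (inv y \<otimes> x))) = f x * haar (\<lambda>y. cnj (h y * g (inv y \<otimes> x)))"
      using c by (intro haar_cmult cont_cnj)
    also have "\<dots> = f x * cnj (haar (\<lambda>y. h y * g (inv y \<otimes> x)))" by (simp only: haar_cnj[OF c])
    finally show "haar (\<lambda>y. cnj (h y) * f x * cnj (g (inv y \<otimes> x))) = f x * cnj (haar (\<lambda>y. h y * g (inv y \<otimes> x)))"
      by (simp add: mult_ac)
  qed
  finally show ?thesis .
qed

text \<open>
  Right invariance moves the translation from \<open>f\<close> to \<open>h\<close>. Therefore bounds that are uniform over the
  unit ball of \<open>f\<close> in the mean square norm only depend on \<open>h\<close>.
\<close>

lemma cor_eq_ip:
  assumes "cont h" "cont f" "x \<in> carrier G"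
  shows "cor h f x = ip f (\<lambda>y. h (y \<otimes> inv x))"
proof -
  have "ip f (\<lambda>y. h (y \<otimes> inv x)) = haar (\<lambda>y. f (y \<otimes> x) * cnj (h (y \<otimes> x \<otimes> inv x)))"
    unfolding ip_def using assms by (intro haar_right[symmetric] cont_intros) auto
  also have "\<dots> = cor h f x"
    unfolding cor_def using assms(3) by (intro haar_cong) (simp add: m_assoc)
  finally show ?thesis ..
qed

lemma norm_cor_le:
  assumes h: "cont h" and f: "cont f" and x: "x \<in> carrier G"
  shows "(cmod (cor h f x))\<^sup>2 \<le> nrm2 f * nrm2 h"
  using Cauchy_Schwarz[OF f cont_right[OF h, of "inv x"]] nrm2_right_translate[OF h, of "inv x"] x
  by (simp add: cor_eq_ip[OF h f x])

text \<open>
  The compactness of the operator: the images of the unit ball of the mean square norm are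
  equicontinuous.
\<close>

lemma cor_equicontinuous:
  assumes h: "cont h" and e: "e > 0"
  shows "\<exists>C. finite C \<and> C \<subseteq> carrier G \<and>
    (\<forall>x\<in>carrier G. \<exists>c\<in>C. \<forall>f. cont f \<longrightarrow> nrm2 f \<le> 1 \<longrightarrow> cmod (cor h f x - cor h f c) \<le> e)"
proof -
  have "continuous_map (prod_topology T T) (prod_topology T T) (\<lambda>p. (fst p, inv (snd p)))"
    using continuous_map_compose[OF continuous_map_snd continuous_inv, of T]
    by (simp add: continuous_map_pairwise o_def continuous_map_fst)
  from continuous_map_compose[OF this jcont_mult[OF h]]
  have "continuous_map (prod_topology T T) euclidean (\<lambda>p. h (fst p \<otimes> inv (snd p)))"
    by (simp add: o_def case_prod_unfold)
  from continuous_map_uniform_net[OF compact compact this e] obtain C where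
    C: "finite C" "C \<subseteq> carrier G"
      "\<And>y. y \<in> carrier G \<Longrightarrow> \<exists>c\<in>C. \<forall>x\<in>carrier G. dist (h (x \<otimes> inv y)) (h (x \<otimes> inv c)) < e"
    by (auto simp: topspace_eq)
  show ?thesis
  proof (intro exI[of _ C] conjI ballI C(1,2))
    fix x assume x: "x \<in> carrier G"
    then obtain c where c: "c \<in> C" "\<And>y. y \<in> carrier G \<Longrightarrow> dist (h (y \<otimes> inv x)) (h (y \<otimes> inv c)) < e"
      using C(3) by blast
    have cG: "c \<in> carrier G" using c(1) C(2) by auto
    have hx: "cont (\<lambda>y. h (y \<otimes> inv x))" and hc: "cont (\<lambda>y. h (y \<otimes> inv c))" using h x cG
      by (auto intro: cont_right)
    have "cmod (cor h f x - cor h f c) \<le> e" if f: "cont f" "nrm2 f \<le> 1" for f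
    proof -
      let ?k = "\<lambda>y. h (y \<otimes> inv x) - h (y \<otimes> inv c)"
      have k: "cont ?k" using hx hc by (rule cont_diff)
      have "cor h f x - cor h f c = cnj (ip ?k f)"
        unfolding ip_diff[OF hx hc f(1)] cor_eq_ip[OF h f(1) x] cor_eq_ip[OF h f(1) cG]
        using ip_cnj[OF hx f(1)] ip_cnj[OF hc f(1)] by simp
      then have "(cmod (cor h f x - cor h f c))\<^sup>2 \<le> nrm2 ?k * nrm2 f"
        using Cauchy_Schwarz[OF k f(1)] by simp
      also have "\<dots> \<le> e\<^sup>2 * 1"
      proof (rule mult_mono)
        show "nrm2 ?k \<le> e\<^sup>2" using c(2) e by (intro nrm2_le k) (auto simp: dist_norm less_imp_le)
      qed (use f nrm2_nonneg in auto)
      finally show ?thesis using e by (simp add: power2_le_iff_abs_le)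
    qed
    then show "\<exists>c\<in>C. \<forall>f. cont f \<longrightarrow> nrm2 f \<le> 1 \<longrightarrow> cmod (cor h f x - cor h f c) \<le> e" using c(1) by blast
  qed
qed

section \<open>A singular vector of a convolution operator\<close>

text \<open>
  Linear spaces of continuous functions. Functions are not identified when they agree on the carrier,
  so membership is closed under the pointwise operations only.
\<close>

definition lin :: "('a \<Rightarrow> complex) set \<Rightarrow> bool" where
  "lin V \<longleftrightarrow> (\<forall>f\<in>V. cont f) \<and> (\<lambda>x. 0) \<in> V \<and> (\<forall>f\<in>V. \<forall>g\<in>V. (\<lambda>x. f x + g x) \<in> V) \<and>
     (\<forall>c. \<forall>f\<in>V. (\<lambda>x. c * f x) \<in> V)"

lemma linD:
  assumes "lin V"
  shows "\<And>f. f \<in> V \<Longrightarrow> cont f" "(\<lambda>x. 0) \<in> V" "\<And>f g. f \<in> V \<Longrightarrow> g \<in> V \<Longrightarrow> (\<lambda>x. f x + g x) \<in> V"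
    "\<And>c f. f \<in> V \<Longrightarrow> (\<lambda>x. c * f x) \<in> V"
  using assms by (auto simp: lin_def)

lemma lin_diff: "lin V \<Longrightarrow> f \<in> V \<Longrightarrow> g \<in> V \<Longrightarrow> (\<lambda>x. f x - g x) \<in> V"
  using linD(3)[of V f "\<lambda>x. (-1) * g x"] linD(4)[of V g "-1"] by simp

lemma lin_lincomb:
  assumes "lin V" "finite I" "\<And>i. i \<in> I \<Longrightarrow> f i \<in> V" shows "(\<lambda>x. \<Sum>i\<in>I. c i * f i x) \<in> V"
  using assms(2,3)
proof (induction I rule: finite_induct)
  case empty
  then show ?case using linD(2)[OF assms(1)] by simp
next
  case (insert i I)
  have "(\<lambda>x. c i * f i x + (\<Sum>i\<in>I. c i * f i x)) \<in> V"
    using insert by (intro linD(3,4)[OF assms(1)]) auto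
  then show ?case using insert by simp
qed

lemma cont_uniform_limit:
  assumes f: "\<And>n. cont (f n)" and u: "uniform_limit (carrier G) f u sequentially"
  shows "cont u"
proof -
  have "continuous_map T Met_TC.mtopology u"
  proof (rule Met_TC.continuous_map_uniform_limit)
    show "\<forall>\<^sub>F n in sequentially. continuous_map T Met_TC.mtopology (f n)" using f by simp
    show "\<forall>\<^sub>F n in sequentially. \<forall>x\<in>topspace T. u x \<in> UNIV \<and> dist (f n x) (u x) < e" if "e > 0" for e
      using uniform_limitD[OF u that] by (simp add: topspace_eq)
  qed simp
  then show ?thesis by simp
qed

lemma nrm2_uniform_limit:
  assumes f: "\<And>n. cont (f n)" and u: "uniform_limit (carrier G) f u sequentially"
  shows "(\<lambda>n. nrm2 (\<lambda>x. f n x - u x)) \<longlonglongrightarrow> 0"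
proof (rule LIMSEQ_I)
  fix r :: real assume r: "r > 0"
  then have "sqrt (r / 2) > 0" by simp
  then obtain N where N: "\<forall>n\<ge>N. \<forall>x\<in>carrier G. dist (f n x) (u x) < sqrt (r / 2)"
    using u unfolding uniform_limit_sequentially_iff by blast
  have c: "cont (\<lambda>x. f n x - u x)" for n by (intro cont_diff f cont_uniform_limit[OF f u])
  have "norm (nrm2 (\<lambda>x. f n x - u x) - 0) < r" if "n \<ge> N" for n
  proof -
    have "nrm2 (\<lambda>x. f n x - u x) \<le> (sqrt (r / 2))\<^sup>2"
      using N that r by (intro nrm2_le c) (auto simp: dist_norm less_imp_le)
    then show ?thesis using r nrm2_nonneg[OF c, of n] by simp
  qed
  then show "\<exists>N. \<forall>n\<ge>N. norm (nrm2 (\<lambda>x. f n x - u x) - 0) < r" by blast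
qed

lemma ip_uniform_limit:
  assumes f: "\<And>n. cont (f n)" and u: "uniform_limit (carrier G) f u sequentially" and p: "cont p"
  shows "(\<lambda>n. ip (f n) p) \<longlonglongrightarrow> ip u p"
proof -
  have cu: "cont u" by (rule cont_uniform_limit[OF f u])
  have "(\<lambda>n. ip (f n) p - ip u p) \<longlonglongrightarrow> 0"
  proof (rule Lim_null_comparison)
    have "norm (ip (f n) p - ip u p) \<le> sqrt (nrm2 (\<lambda>x. f n x - u x) * nrm2 p)" for n
      using Cauchy_Schwarz[OF cont_diff[OF f cu] p, of n] ip_diff[OF f cu p, of n] by (simp add: real_le_rsqrt)
    then show "\<forall>\<^sub>F n in sequentially. norm (ip (f n) p - ip u p) \<le> sqrt (nrm2 (\<lambda>x. f n x - u x) * nrm2 p)"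
      by simp
    have "(\<lambda>n. sqrt (nrm2 (\<lambda>x. f n x - u x) * nrm2 p)) \<longlonglongrightarrow> sqrt (0 * nrm2 p)"
      by (intro tendsto_intros nrm2_uniform_limit f u)
    then show "(\<lambda>n. sqrt (nrm2 (\<lambda>x. f n x - u x) * nrm2 p)) \<longlonglongrightarrow> 0" by simp
  qed
  then show ?thesis by (rule LIM_zero_cancel)
qed

text \<open>
  Let \<open>A = cor h\<close>, with adjoint \<open>A\<^sup>* = conv h\<close>, and let \<open>s\<close> be the square of the norm of \<open>A\<close> on \<open>V\<close>. By
  compactness the images of a maximising sequence of unit vectors \<open>f n\<close> have a subsequence converging
  uniformly to some \<open>u\<close>, with \<open>\<parallel>u\<parallel>\<^sup>2 = s\<close>. From \<open>\<langle>A (f n), u\<rangle> = \<langle>f n, A\<^sup>*u\<rangle> \<le> \<parallel>A\<^sup>*u\<parallel>\<close> one gets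
  \<open>s \<le> \<parallel>A\<^sup>*u\<parallel>\<close>, and expanding \<open>\<parallel>A A\<^sup>*u - s u\<parallel>\<^sup>2\<close> with \<open>\<parallel>A A\<^sup>*u\<parallel>\<^sup>2 \<le> s \<parallel>A\<^sup>*u\<parallel>\<^sup>2\<close> shows that this
  quantity is not positive. The function \<open>h\<close> itself lies in \<open>V\<close> and is not annihilated by \<open>A\<close>, so
  \<open>s > 0\<close>.
\<close>

lemma singular_vector_exists:
  assumes V: "lin V" and h: "h \<in> V" "x0 \<in> carrier G" "h x0 \<noteq> 0"
    and cor: "\<And>f. f \<in> V \<Longrightarrow> cor h f \<in> V" and conv: "\<And>f. f \<in> V \<Longrightarrow> conv h f \<in> V"
    and lim: "\<And>f u. (\<And>n. f n \<in> V) \<Longrightarrow> uniform_limit (carrier G) f u sequentially \<Longrightarrow> u \<in> V"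
  shows "\<exists>s u. s > 0 \<and> u \<in> V \<and> nrm2 u > 0 \<and> (\<forall>x\<in>carrier G. cor h (conv h u) x = of_real s * u x)"
proof -
  have ch: "cont h" using linD(1)[OF V h(1)] .
  have hpos: "nrm2 h > 0" using nrm2_eq_0[OF ch _ h(2)] h(3) nrm2_nonneg[OF ch] by fastforce
  note cV = linD(1)[OF V]
  have ccor: "cont (cor h f)" if "f \<in> V" for f using cV[OF cor[OF that]] .
  define S where "S = {nrm2 (cor h f) | f. f \<in> V \<and> nrm2 f \<le> 1}"
  have corle: "nrm2 (cor h f) \<le> nrm2 f * nrm2 h" if f: "f \<in> V" for f
  proof -
    have n: "nrm2 f * nrm2 h \<ge> 0" using nrm2_nonneg[OF cV[OF f]] hpos by simp
    have "nrm2 (cor h f) \<le> (sqrt (nrm2 f * nrm2 h))\<^sup>2"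
    proof (rule nrm2_le[OF ccor[OF f]])
      fix x assume "x \<in> carrier G"
      from norm_cor_le[OF ch cV[OF f] this] show "cmod (cor h f x) \<le> sqrt (nrm2 f * nrm2 h)"
        by (rule real_le_rsqrt)
    qed (use n in simp)
    then show ?thesis using n by simp
  qed
  have le_h: "z \<le> nrm2 h" if zS: "z \<in> S" for z
  proof -
    obtain f where f: "f \<in> V" "nrm2 f \<le> 1" "z = nrm2 (cor h f)" using zS unfolding S_def by blast
    have "nrm2 f * nrm2 h \<le> 1 * nrm2 h" using f(2) hpos by (intro mult_right_mono) auto
    then show ?thesis using corle[OF f(1)] f(3) by simp
  qed
  then have bdd: "bdd_above S" by (auto simp: bdd_above_def)
  define s where "s = Sup S"
  have upper: "nrm2 (cor h f) \<le> s" if "f \<in> V" "nrm2 f \<le> 1" for f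
    unfolding s_def using that bdd by (intro cSup_upper) (auto simp: S_def)
  have cor_scale: "nrm2 (cor h (\<lambda>x. c * f x)) = (cmod c)\<^sup>2 * nrm2 (cor h f)" if f: "f \<in> V" for c f
  proof -
    have "nrm2 (cor h (\<lambda>x. c * f x)) = nrm2 (\<lambda>x. c * cor h f x)"
      unfolding nrm2_def by (rule arg_cong[where f = Re], rule ip_cong) (simp_all add: cor_cmult[OF ch cV[OF
        f]])
    then show ?thesis using nrm2_cmult[OF ccor[OF f]] by simp
  qed
  have sle: "nrm2 (cor h f) \<le> s * nrm2 f" if f: "f \<in> V" for f
  proof (cases "nrm2 f = 0")
    case True
    then show ?thesis using corle[OF f] by simp
  next
    case False
    then have pos: "nrm2 f > 0" using nrm2_nonneg[OF cV[OF f]] by simp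
    let ?c = "complex_of_real (1 / sqrt (nrm2 f))"
    have c2: "(cmod ?c)\<^sup>2 = 1 / nrm2 f" using pos unfolding norm_of_real by (simp add: power_divide)
    have "nrm2 (\<lambda>x. ?c * f x) = 1" unfolding nrm2_cmult[OF cV[OF f]] c2 using pos by simp
    then have "nrm2 (cor h (\<lambda>x. ?c * f x)) \<le> s" by (intro upper[OF linD(4)[OF V f]]) (simp only: order_refl)
    then show ?thesis unfolding cor_scale[OF f] c2 using pos by (simp add: divide_le_eq)
  qed
  \<comment> \<open>this makes the operator non-zero on \<open>V\<close>\<close>
  have "cor h h \<one> = of_real (nrm2 h)"
  proof -
    have "cor h h \<one> = ip h h" unfolding cor_def ip_def by (rule haar_cong) (simp add: mult.commute)
    then show ?thesis using ip_self[OF ch] by simp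
  qed
  then have "nrm2 (cor h h) \<noteq> 0" using nrm2_eq_0[OF ccor[OF h(1)] _ one_closed] hpos by fastforce
  then have "nrm2 (cor h h) > 0" using nrm2_nonneg[OF ccor[OF h(1)]] by simp
  then have spos: "s > 0" using sle[OF h(1)] hpos
    by (metis (no_types) less_le_trans zero_less_mult_pos2)
  have Sne: "S \<noteq> {}" using h(1) unfolding S_def using linD(2)[OF V] nrm2_cmult[OF ch, of 0] by auto
  have "\<exists>f. f \<in> V \<and> nrm2 f \<le> 1 \<and> s - inverse (real (Suc n)) < nrm2 (cor h f)" for n
  proof -
    have "s - inverse (real (Suc n)) < Sup S" unfolding s_def by simp
    then obtain z where "z \<in> S" "s - inverse (real (Suc n)) < z"
      using less_cSup_iff[OF Sne bdd] by blast
    then show ?thesis unfolding S_def by blast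
  qed
  then obtain f where f: "\<And>n. f n \<in> V" "\<And>n. nrm2 (f n) \<le> 1"
    "\<And>n. s - inverse (real (Suc n)) < nrm2 (cor h (f n))"
    by metis
  have cf: "cont (f n)" for n using cV f(1) .
  have "\<exists>r u. strict_mono (r :: nat \<Rightarrow> nat) \<and> uniform_limit (carrier G) (\<lambda>n. cor h (f (r n))) u sequentially"
  proof (rule uniformly_convergent_subsequence[of "carrier G" "\<lambda>n. cor h (f n)" "sqrt (nrm2 h)"])
    fix n x assume x: "x \<in> carrier G"
    have "(cmod (cor h (f n) x))\<^sup>2 \<le> nrm2 (f n) * nrm2 h" by (rule norm_cor_le[OF ch cf x])
    also have "\<dots> \<le> 1 * nrm2 h" using f(2) hpos by (intro mult_right_mono) auto
    finally show "cmod (cor h (f n) x) \<le> sqrt (nrm2 h)" by (intro real_le_rsqrt) simp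
  next
    fix e :: real assume "e > 0"
    obtain C where C: "finite C" "C \<subseteq> carrier G" and near:
      "\<forall>x\<in>carrier G. \<exists>c\<in>C. \<forall>f. cont f \<longrightarrow> nrm2 f \<le> 1 \<longrightarrow> cmod (cor h f x - cor h f c) \<le> e"
      using cor_equicontinuous[OF ch \<open>e > 0\<close>] by (elim exE conjE)
    have "\<exists>c\<in>C. \<forall>n. cmod (cor h (f n) x - cor h (f n) c) \<le> e" if "x \<in> carrier G" for x
      using bspec[OF near that] cf f(2) by blast
    then show "\<exists>C. finite C \<and> C \<subseteq> carrier G \<and> (\<forall>x\<in>carrier G. \<exists>c\<in>C. \<forall>n. cmod (cor h (f n) x - cor h (f n) c)
      \<le> e)"
      using C(1,2) by blast
  qed blast
  then obtain r u where r: "strict_mono r" and u: "uniform_limit (carrier G) (\<lambda>n. cor h (f (r n))) u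
    sequentially"
    by blast
  define g where "g = (\<lambda>n. cor h (f (r n)))"
  have gV: "g n \<in> V" for n unfolding g_def using cor f(1) .
  have cg: "cont (g n)" for n using cV gV .
  have ug: "uniform_limit (carrier G) g u sequentially" using u by (simp add: g_def)
  have cu: "cont u" by (rule cont_uniform_limit[OF cg ug])
  have uV: "u \<in> V" by (rule lim[OF gV ug])
  define w where "w = conv h u"
  have wV: "w \<in> V" unfolding w_def by (rule conv[OF uV])
  have inv0: "(\<lambda>n. inverse (real (Suc (r n)))) \<longlonglongrightarrow> 0"
    using LIMSEQ_subseq_LIMSEQ[OF LIMSEQ_inverse_real_of_nat r] by (simp add: o_def)
  have gs: "(\<lambda>n. nrm2 (g n)) \<longlonglongrightarrow> s"
  proof (rule real_tendsto_sandwich)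
    show "\<forall>\<^sub>F n in sequentially. s - inverse (real (Suc (r n))) \<le> nrm2 (g n)"
      using f(3) by (simp add: g_def less_imp_le)
    show "\<forall>\<^sub>F n in sequentially. nrm2 (g n) \<le> s" using upper f(1,2) by (simp add: g_def)
    show "(\<lambda>n. s - inverse (real (Suc (r n)))) \<longlonglongrightarrow> s" using tendsto_diff[OF tendsto_const inv0, of s] by simp
  qed simp
  have gu: "(\<lambda>n. Re (ip (g n) u)) \<longlonglongrightarrow> nrm2 u"
    using tendsto_Re[OF ip_uniform_limit[OF cg ug cu]] by (simp add: nrm2_def)
  have us: "nrm2 u = s"
  proof -
    have lim: "(\<lambda>n. nrm2 (g n) - 2 * Re (ip (g n) u) + nrm2 u) \<longlonglongrightarrow> s - 2 * nrm2 u + nrm2 u"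
      by (intro tendsto_intros gs gu)
    have eq: "nrm2 (g n) - 2 * Re (ip (g n) u) + nrm2 u = nrm2 (\<lambda>x. g n x - u x)" for n
      using nrm2_diff[OF cg cu, of n 1] by simp
    show ?thesis using LIMSEQ_unique[OF lim[unfolded eq] nrm2_uniform_limit[OF cg ug]] by simp
  qed
  have "nrm2 u \<le> sqrt (nrm2 w)"
  proof (rule LIMSEQ_le_const2[OF gu], intro exI allI impI)
    fix n
    have "Re (ip (g n) u) = Re (ip (f (r n)) w)" unfolding g_def w_def ip_cor[OF ch cf cu] ..
    also have "\<dots> \<le> cmod (ip (f (r n)) w)" by (rule complex_Re_le_cmod)
    also have "\<dots> \<le> sqrt (nrm2 (f (r n)) * nrm2 w)"
      by (rule real_le_rsqrt[OF Cauchy_Schwarz[OF cf cV[OF wV]]])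
    also have "\<dots> \<le> sqrt (nrm2 w)"
      using mult_right_mono[OF f(2) nrm2_nonneg[OF cV[OF wV]], of "r n"] by simp
    finally show "Re (ip (g n) u) \<le> sqrt (nrm2 w)" .
  qed
  then have ws: "s * s \<le> nrm2 w"
    using us spos power_mono[of s "sqrt (nrm2 w)" 2] nrm2_nonneg[OF cV[OF wV]] by (simp add: power2_eq_square)
  have "nrm2 (\<lambda>x. cor h w x - of_real s * u x) = nrm2 (cor h w) - 2 * (s * nrm2 w) + s\<^sup>2 * s"
    unfolding nrm2_diff[OF ccor[OF wV] cu] ip_cor[OF ch cV[OF wV] cu] us
    using ip_self[OF cV[OF wV]] by (simp add: w_def)
  also have "\<dots> \<le> s * nrm2 w - 2 * (s * nrm2 w) + s * (s * s)"
    using sle[OF wV] by (simp add: power2_eq_square mult.assoc)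
  also have "\<dots> \<le> 0" using mult_left_mono[OF ws, of s] spos by simp
  finally have "nrm2 (\<lambda>x. cor h w x - of_real s * u x) = 0"
    using nrm2_nonneg[of "\<lambda>x. cor h w x - of_real s * u x"] ccor[OF wV] cu by (simp add: cont_diff cont_mult)
  then have "cor h (conv h u) x = of_real s * u x" if "x \<in> carrier G" for x
    using nrm2_eq_0[of "\<lambda>x. cor h w x - of_real s * u x" x] that ccor[OF wV] cu
    by (simp add: cont_diff cont_mult w_def)
  then show ?thesis using spos uV us by (intro exI[of _ s] exI[of _ u]) simp
qed

section \<open>Irreducible representations inside invariant function spaces\<close>

definition orthonormal :: "nat \<Rightarrow> (nat \<Rightarrow> 'a \<Rightarrow> complex) \<Rightarrow> bool" where
  "orthonormal n e \<longleftrightarrow> (\<forall>i<n. cont (e i)) \<and> (\<forall>i<n. \<forall>j<n. ip (e i) (e j) = (if i = j then 1 else 0))"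

text \<open>
  An orthonormal family of the largest possible size in \<open>W\<close>. It spans \<open>W\<close> up to equality on the
  carrier, so \<open>n\<close> is the dimension of \<open>W\<close>.
\<close>

definition max_orthonormal :: "('a \<Rightarrow> complex) set \<Rightarrow> nat \<Rightarrow> (nat \<Rightarrow> 'a \<Rightarrow> complex) \<Rightarrow> bool" where
  "max_orthonormal W n e \<longleftrightarrow> (\<forall>i<n. e i \<in> W) \<and> orthonormal n e \<and>
     (\<forall>e'. (\<forall>i<Suc n. e' i \<in> W) \<longrightarrow> \<not> orthonormal (Suc n) e')"

definition right_invariant :: "('a \<Rightarrow> complex) set \<Rightarrow> bool" where
  "right_invariant W \<longleftrightarrow> (\<forall>f\<in>W. \<forall>g\<in>carrier G. (\<lambda>x. f (x \<otimes> g)) \<in> W)"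

lemma max_orthonormal_exists:
  assumes "\<And>n e. (\<And>i. i < n \<Longrightarrow> e i \<in> W) \<Longrightarrow> orthonormal n e \<Longrightarrow> n \<le> N"
  shows "\<exists>n e. n \<le> N \<and> max_orthonormal W n e"
proof -
  define P where "P n \<longleftrightarrow> (\<exists>e. (\<forall>i<n. e i \<in> W) \<and> orthonormal n e)" for n
  have P0: "P 0" by (simp add: P_def orthonormal_def)
  have bd: "n \<le> N" if "P n" for n using assms that unfolding P_def by blast
  define n where "n = Greatest P"
  have "P n" unfolding n_def by (rule GreatestI_nat[of P 0 N, OF P0 bd])
  moreover have "\<not> P (Suc n)" using Greatest_le_nat[of P "Suc n" N] bd unfolding n_def by fastforce
  ultimately show ?thesis using bd unfolding P_def max_orthonormal_def by blast
qed

text \<open>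
  Otherwise the normalised remainder would extend the family.
\<close>

lemma max_orthonormal_expansion:
  assumes W: "lin W" and e: "max_orthonormal W n e" and f: "f \<in> W" and x: "x \<in> carrier G"
  shows "f x = (\<Sum>i<n. ip f (e i) * e i x)"
proof -
  have eW: "e i \<in> W" if "i < n" for i using e that by (simp add: max_orthonormal_def)
  have ce: "cont (e i)" if "i < n" for i using linD(1)[OF W eW[OF that]] .
  have cf: "cont f" using linD(1)[OF W f] .
  define p where "p = (\<lambda>x. \<Sum>i<n. ip f (e i) * e i x)"
  have pW: "p \<in> W" unfolding p_def using eW by (intro lin_lincomb[OF W]) auto
  define g where "g = (\<lambda>x. f x - p x)"
  have gW: "g \<in> W" unfolding g_def by (rule lin_diff[OF W f pW])
  have cg: "cont g" and cp: "cont p" using linD(1)[OF W] gW pW by auto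
  have orth: "ip g (e j) = 0" if j: "j < n" for j
  proof -
    have "ip p (e j) = (\<Sum>i<n. ip f (e i) * ip (e i) (e j))"
      unfolding p_def using ce j by (intro ip_lincomb) auto
    also have "\<dots> = (\<Sum>i<n. if i = j then ip f (e i) else 0)"
      using e j by (intro sum.cong) (auto simp: max_orthonormal_def orthonormal_def)
    also have "\<dots> = ip f (e j)" using j by simp
    finally show ?thesis unfolding g_def using ip_diff[OF cf cp ce[OF j]] by simp
  qed
  have "nrm2 g = 0"
  proof (rule ccontr)
    assume "nrm2 g \<noteq> 0"
    then have pos: "nrm2 g > 0" using nrm2_nonneg[OF cg] by simp
    define c where "c = complex_of_real (1 / sqrt (nrm2 g))"
    define e' where "e' = e(n := (\<lambda>x. c * g x))"
    have c2: "(cmod c)\<^sup>2 = 1 / nrm2 g" unfolding c_def norm_of_real using pos by (simp add: power_divide)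
    have ccg: "cont (\<lambda>x. c * g x)" using cg by (intro cont_intros)
    have nn: "ip (\<lambda>x. c * g x) (\<lambda>x. c * g x) = 1"
      unfolding ip_self[OF ccg] nrm2_cmult[OF cg] c2 using pos by simp
    have o1: "ip (\<lambda>x. c * g x) (e i) = 0" if "i < n" for i
      using ip_cmult[OF cg ce[OF that]] orth[OF that] by simp
    have o2: "ip (e i) (\<lambda>x. c * g x) = 0" if "i < n" for i
      using ip_cnj[OF ccg ce[OF that]] o1[OF that] by simp
    have "\<forall>i<Suc n. e' i \<in> W" using eW linD(4)[OF W gW] by (auto simp: e'_def less_Suc_eq)
    moreover have "orthonormal (Suc n) e'"
      unfolding orthonormal_def
    proof (intro conjI allI impI)
      fix i assume "i < Suc n" then show "cont (e' i)" using ce ccg by (auto simp: e'_def less_Suc_eq)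
    next
      fix i j assume ij: "i < Suc n" "j < Suc n"
      consider "i < n" "j < n" | "i = n" "j < n" | "i < n" "j = n" | "i = n" "j = n" using ij by linarith
      then show "ip (e' i) (e' j) = (if i = j then 1 else 0)"
        by cases (use e o1 o2 nn in \<open>auto simp: e'_def max_orthonormal_def orthonormal_def\<close>)
    qed
    ultimately show False using e unfolding max_orthonormal_def by blast
  qed
  from nrm2_eq_0[OF cg this x] show ?thesis by (simp add: g_def p_def)
qed

lemma ip_orthonormal_lincomb:
  assumes e: "orthonormal n e" and j: "j < n"
  shows "ip (\<lambda>x. \<Sum>i<n. a i * e i x) (e j) = a j"
proof -
  have "ip (\<lambda>x. \<Sum>i<n. a i * e i x) (e j) = (\<Sum>i<n. a i * ip (e i) (e j))"
    using e j by (intro ip_lincomb) (auto simp: orthonormal_def)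
  also have "\<dots> = (\<Sum>i<n. if i = j then a i else 0)"
    using e j by (intro sum.cong) (auto simp: orthonormal_def)
  finally show ?thesis using j by simp
qed

lemma parseval:
  assumes e: "orthonormal n e"
  shows "ip (\<lambda>x. \<Sum>i<n. a i * e i x) (\<lambda>x. \<Sum>i<n. b i * e i x) = (\<Sum>i<n. a i * cnj (b i))"
proof -
  have ce: "\<And>i. i < n \<Longrightarrow> cont (e i)" using e by (simp add: orthonormal_def)
  have "ip (\<lambda>x. \<Sum>i<n. a i * e i x) (\<lambda>x. \<Sum>i<n. b i * e i x) = (\<Sum>j<n. cnj (b j) * ip (\<lambda>x. \<Sum>i<n. a i * e i x)
    (e j))"
    using ce by (intro ip_lincomb_right cont_sum cont_intros) auto
  also have "\<dots> = (\<Sum>j<n. a j * cnj (b j))"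
    using ip_orthonormal_lincomb[OF e] by (intro sum.cong) auto
  finally show ?thesis .
qed

text \<open>
  If evaluation at points is bounded by \<open>sqrt K\<close> in the mean square norm, then applying this to the
  function \<open>\<lambda>y. \<Sum>i<n. cnj (e i x) * e i y\<close> bounds \<open>\<Sum>i<n. (cmod (e i x))\<^sup>2\<close> by \<open>K\<close>, and the mean of this sum
  over \<open>x\<close> is \<open>n\<close>.
\<close>

lemma orthonormal_card_bound:
  assumes W: "lin W" and K0: "K \<ge> 0" and K: "\<And>f x. f \<in> W \<Longrightarrow> x \<in> carrier G \<Longrightarrow> (cmod (f x))\<^sup>2 \<le> K * nrm2 f"
    and eW: "\<And>i. i < n \<Longrightarrow> e i \<in> W" and e: "orthonormal n e"
  shows "real n \<le> K"
proof -
  have ce: "\<And>i. i < n \<Longrightarrow> cont (e i)" using e by (simp add: orthonormal_def)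
  define t where "t = (\<lambda>x. \<Sum>i<n. (cmod (e i x))\<^sup>2)"
  have tK: "t x \<le> K" if x: "x \<in> carrier G" for x
  proof -
    define f where "f = (\<lambda>y. \<Sum>i<n. cnj (e i x) * e i y)"
    have fW: "f \<in> W" unfolding f_def using eW by (intro lin_lincomb[OF W]) auto
    have tc: "complex_of_real (t x) = (\<Sum>i<n. cnj (e i x) * e i x)"
      unfolding t_def of_real_sum complex_norm_square by (simp add: mult.commute)
    have fx: "f x = of_real (t x)" unfolding f_def tc ..
    have "ip f f = of_real (t x)" unfolding f_def parseval[OF e] tc by (simp add: mult.commute)
    then have nf: "nrm2 f = t x" by (simp add: nrm2_def)
    have t0: "t x \<ge> 0" unfolding t_def by (intro sum_nonneg) auto
    have "t x * t x \<le> K * t x"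
      using K[OF fW x] unfolding fx nf norm_of_real by (simp add: power2_eq_square)
    then show ?thesis using t0 K0 by (cases "t x = 0") auto
  qed
  have "Re (haar (\<lambda>x. \<Sum>i<n. e i x * cnj (e i x))) \<le> Re (haar (\<lambda>x. of_real K))"
  proof (rule Re_haar_mono)
    fix x assume x: "x \<in> carrier G"
    have "(\<Sum>i<n. e i x * cnj (e i x)) = complex_of_real (t x)"
      unfolding t_def of_real_sum complex_norm_square ..
    then show "Re (\<Sum>i<n. e i x * cnj (e i x)) \<le> Re (complex_of_real K)" using tK[OF x] by simp
  qed (use ce in \<open>auto intro!: cont_sum cont_intros\<close>)
  moreover have "haar (\<lambda>x. \<Sum>i<n. e i x * cnj (e i x)) = (\<Sum>i<n. ip (e i) (e i))"
    unfolding ip_def using ce by (intro haar_sum) (auto intro!: cont_intros)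
  moreover have "(\<Sum>i<n. ip (e i) (e i)) = of_nat n" using e by (simp add: orthonormal_def)
  ultimately show ?thesis by (simp add: haar_const)
qed

lemma unitary_repI:
  assumes c: "\<And>g. g \<in> carrier G \<Longrightarrow> \<pi> g \<in> carrier_mat n n"
    and mult: "\<And>g h. g \<in> carrier G \<Longrightarrow> h \<in> carrier G \<Longrightarrow> \<pi> (g \<otimes> h) = \<pi> g * \<pi> h"
    and u: "\<And>g. g \<in> carrier G \<Longrightarrow> mat_adjoint (\<pi> g) * \<pi> g = 1\<^sub>m n"
    and cont: "\<And>i j. i < n \<Longrightarrow> j < n \<Longrightarrow> cont (\<lambda>g. \<pi> g $$ (i, j))"
  shows "urep n \<pi>"
  using c mult u cont mat_mult_left_right_inverse[OF mat_adjoint_carrier[OF c] c u]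
  by (auto simp: unitary_rep_def hom_def unitary_group_def)

text \<open>
  Take an invariant subspace \<open>W'\<close> of minimal positive dimension with an orthonormal basis \<open>e\<close>, and let
  \<open>\<pi> g\<close> be the matrix of right translation by \<open>g\<close> in this basis. An invariant subspace \<open>U\<close> of coordinate
  vectors corresponds to the invariant subspace \<open>X\<close> of functions in \<open>W'\<close> with coordinates in \<open>U\<close>, so
  minimality of the dimension makes \<open>\<pi>\<close> irreducible. Evaluating the translation formula for \<open>e 0\<close> at \<open>\<one>\<close>
  expresses \<open>e 0\<close> by coefficients of \<open>\<pi>\<close>.
\<close>

lemma invariant_space_contains_irreducible:
  assumes W: "lin W" and RW: "right_invariant W" and u: "u \<in> W" "nrm2 u > 0"
    and bd: "\<And>n e. (\<And>i. i < n \<Longrightarrow> e i \<in> W) \<Longrightarrow> orthonormal n e \<Longrightarrow> n \<le> N"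
  shows "\<exists>n \<pi> f a. irrep n \<pi> \<and> f \<in> W \<and> ip f f = 1 \<and>
    (\<forall>x\<in>carrier G. f x = (\<Sum>i<n. a i * \<pi> x $$ (i, 0)))"
proof -
  define Q where "Q n \<longleftrightarrow> n > 0 \<and> (\<exists>W' e. W' \<subseteq> W \<and> lin W' \<and> right_invariant W' \<and> max_orthonormal W' n e)" for n
  have pos: "n > 0" if "lin W'" "max_orthonormal W' n e" "f \<in> W'" "nrm2 f > 0" for W' n e f
  proof (rule ccontr)
    assume "\<not> n > 0"
    then have z: "f x = 0" if "x \<in> carrier G" for x using max_orthonormal_expansion[OF \<open>lin W'\<close>
      \<open>max_orthonormal W' n e\<close> \<open>f \<in> W'\<close> that] by simp
    have "nrm2 f = nrm2 (\<lambda>x. 0)" unfolding nrm2_def by (rule arg_cong[where f = Re], rule ip_cong) (simp_all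
      add: z)
    then show False using \<open>nrm2 f > 0\<close> by (simp add: nrm2_def ip_def haar_0)
  qed
  obtain n0 e0 where "max_orthonormal W n0 e0" using max_orthonormal_exists[of W N] bd by blast
  then have "Q n0" using pos[OF W _ u] W RW unfolding Q_def by blast
  define n where "n = (LEAST n. Q n)"
  have Qn: "Q n" unfolding n_def using \<open>Q n0\<close> by (rule LeastI)
  have least: "n \<le> m" if "Q m" for m unfolding n_def using that by (rule Least_le)
  obtain W' e where W': "W' \<subseteq> W" "lin W'" "right_invariant W'" and e: "max_orthonormal W' n e" and n: "n > 0"
    using Qn unfolding Q_def by blast
  have on: "orthonormal n e" and eW: "\<And>i. i < n \<Longrightarrow> e i \<in> W'" using e by (auto simp: max_orthonormal_def)
  have ce: "\<And>i. i < n \<Longrightarrow> cont (e i)" using on by (simp add: orthonormal_def)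
  define \<pi> where "\<pi> = (\<lambda>g. mat n n (\<lambda>(i, j). ip (\<lambda>x. e j (x \<otimes> g)) (e i)))"
  have \<pi>ij: "\<pi> g $$ (i, j) = ip (\<lambda>x. e j (x \<otimes> g)) (e i)" if "i < n" "j < n" for g i j
    using that by (simp add: \<pi>_def)
  have \<pi>c: "\<pi> g \<in> carrier_mat n n" for g by (simp add: \<pi>_def)
  have RW': "(\<lambda>x. f (x \<otimes> g)) \<in> W'" if "f \<in> W'" "g \<in> carrier G" for f g using W'(3) that
    by (simp add: right_invariant_def)
  have trans: "e j (x \<otimes> g) = (\<Sum>i<n. \<pi> g $$ (i, j) * e i x)" if "j < n" "x \<in> carrier G" "g \<in> carrier G" for j x g
    using max_orthonormal_expansion[OF W'(2) e RW'[OF eW[OF that(1)] that(3)] that(2)] \<pi>ij that(1) by simp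
  define cv where "cv = (\<lambda>f. vec n (\<lambda>i. ip f (e i)))"
  have cv_trans: "cv (\<lambda>x. f (x \<otimes> g)) = \<pi> g *\<^sub>v cv f" if f: "f \<in> W'" and g: "g \<in> carrier G" for f g
  proof (rule eq_vecI)
    show "dim_vec (cv (\<lambda>x. f (x \<otimes> g))) = dim_vec (\<pi> g *\<^sub>v cv f)" using \<pi>c[of g] by (simp add: cv_def)
    fix i assume "i < dim_vec (\<pi> g *\<^sub>v cv f)"
    then have i: "i < n" using \<pi>c[of g] by simp
    have "ip (\<lambda>x. f (x \<otimes> g)) (e i) = ip (\<lambda>x. \<Sum>j<n. ip f (e j) * e j (x \<otimes> g)) (e i)"
      using max_orthonormal_expansion[OF W'(2) e f] g by (intro ip_cong) auto
    also have "\<dots> = (\<Sum>j<n. ip f (e j) * ip (\<lambda>x. e j (x \<otimes> g)) (e i))"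
      using ce i g by (intro ip_lincomb) (auto intro: cont_right)
    also have "\<dots> = (\<pi> g *\<^sub>v cv f) $ i"
      using i \<pi>c[of g] by (simp add: scalar_prod_def \<pi>ij cv_def lessThan_atLeast0 mult.commute)
    finally show "cv (\<lambda>x. f (x \<otimes> g)) $ i = (\<pi> g *\<^sub>v cv f) $ i" using i by (simp add: cv_def)
  qed
  have col: "col (\<pi> g) j = cv (\<lambda>x. e j (x \<otimes> g))" if "j < n" for j g
    using that by (intro eq_vecI) (auto simp: cv_def \<pi>_def)
  have rep: "urep n \<pi>"
  proof (rule unitary_repI)
    fix g h assume g: "g \<in> carrier G" and h: "h \<in> carrier G"
    show "\<pi> (g \<otimes> h) = \<pi> g * \<pi> h"
    proof (rule eq_matI)
      fix i j assume "i < dim_row (\<pi> g * \<pi> h)" "j < dim_col (\<pi> g * \<pi> h)"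
      then have ij: "i < n" "j < n" using \<pi>c[of g] \<pi>c[of h] by auto
      have "cv (\<lambda>x. e j (x \<otimes> (g \<otimes> h))) = cv (\<lambda>x. e j (x \<otimes> g \<otimes> h))"
        unfolding cv_def using g h by (intro eq_vecI) (auto intro!: ip_cong simp: m_assoc)
      also have "\<dots> = \<pi> g *\<^sub>v cv (\<lambda>x. e j (x \<otimes> h))" by (rule cv_trans[OF RW'[OF eW[OF ij(2)] h] g])
      finally have "cv (\<lambda>x. e j (x \<otimes> (g \<otimes> h))) = \<pi> g *\<^sub>v cv (\<lambda>x. e j (x \<otimes> h))" .
      then have "col (\<pi> (g \<otimes> h)) j = \<pi> g *\<^sub>v col (\<pi> h) j" using col[OF ij(2)] by simp
      then have "col (\<pi> (g \<otimes> h)) j $ i = (\<pi> g *\<^sub>v col (\<pi> h) j) $ i" by simp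
      then show "\<pi> (g \<otimes> h) $$ (i, j) = (\<pi> g * \<pi> h) $$ (i, j)"
        using ij \<pi>c[of g] \<pi>c[of h] \<pi>c[of "g \<otimes> h"] by simp
    qed (use \<pi>c[of g] \<pi>c[of h] \<pi>c[of "g \<otimes> h"] in auto)
  next
    fix g assume g: "g \<in> carrier G"
    show "mat_adjoint (\<pi> g) * \<pi> g = 1\<^sub>m n"
    proof (rule eq_matI)
      fix i j assume "i < dim_row (1\<^sub>m n :: complex mat)" "j < dim_col (1\<^sub>m n :: complex mat)"
      then have ij: "i < n" "j < n" by auto
      have "(mat_adjoint (\<pi> g) * \<pi> g) $$ (i, j) = (\<Sum>k<n. \<pi> g $$ (k, j) * cnj (\<pi> g $$ (k, i)))"
        using ij \<pi>c[of g] mat_adjoint_carrier[OF \<pi>c[of g]]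
        by (simp add: scalar_prod_def mat_adjoint_index[OF \<pi>c[of g]] lessThan_atLeast0 mult.commute)
      also have "\<dots> = ip (\<lambda>x. \<Sum>k<n. \<pi> g $$ (k, j) * e k x) (\<lambda>x. \<Sum>k<n. \<pi> g $$ (k, i) * e k x)"
        by (rule parseval[OF on, symmetric])
      also have "\<dots> = ip (\<lambda>x. e j (x \<otimes> g)) (\<lambda>x. e i (x \<otimes> g))"
        using trans[OF ij(1) _ g] trans[OF ij(2) _ g] by (intro ip_cong) auto
      also have "\<dots> = ip (e j) (e i)"
        unfolding ip_def using haar_right[OF cont_mult[OF ce[OF ij(2)] cont_cnj[OF ce[OF ij(1)]]] g] by simp
      also have "\<dots> = 1\<^sub>m n $$ (i, j)" using on ij by (auto simp: orthonormal_def)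
      finally show "(mat_adjoint (\<pi> g) * \<pi> g) $$ (i, j) = 1\<^sub>m n $$ (i, j)" .
    qed (use \<pi>c[of g] mat_adjoint_carrier[OF \<pi>c[of g]] in auto)
  next
    fix i j assume ij: "i < n" "j < n"
    have "cont (\<lambda>g. haar (\<lambda>x. e j (x \<otimes> g) * cnj (e i x)))"
      using ce ij by (intro cont_haar jcont_intros cont_intros)
    then show "cont (\<lambda>g. \<pi> g $$ (i, j))" using ij by (simp add: \<pi>ij ip_def)
  qed (rule \<pi>c)
  have irr: "irrep n \<pi>"
    unfolding irreducible_iff
  proof (intro conjI allI impI rep n)
    fix U assume U: "vec_subspace n U" and inv: "\<forall>g\<in>carrier G. \<forall>w\<in>U. \<pi> g *\<^sub>v w \<in> U"
    show "U = {0\<^sub>v n} \<or> U = carrier_vec n"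
    proof (rule disjCI)
      assume "U \<noteq> carrier_vec n"
      have Uc: "U \<subseteq> carrier_vec n" and U0: "0\<^sub>v n \<in> U" and Uadd: "\<And>v w. v \<in> U \<Longrightarrow> w \<in> U \<Longrightarrow> v + w \<in> U"
        and Usm: "\<And>c v. v \<in> U \<Longrightarrow> c \<cdot>\<^sub>v v \<in> U" using U by (auto simp: vec_subspace_def)
      define X where "X = {f \<in> W'. cv f \<in> U}"
      have XW: "X \<subseteq> W'" by (auto simp: X_def)
      have linX: "lin X"
      proof -
        have z: "cv (\<lambda>x. 0) = 0\<^sub>v n" by (intro eq_vecI) (auto simp: cv_def ip_def haar_0)
        have a: "cv (\<lambda>x. f x + g x) = cv f + cv g" if "f \<in> W'" "g \<in> W'" for f g
          using that linD(1)[OF W'(2)] ce by (intro eq_vecI) (auto simp: cv_def ip_add)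
        have m: "cv (\<lambda>x. c * f x) = c \<cdot>\<^sub>v cv f" if "f \<in> W'" for c f
          using that linD(1)[OF W'(2)] ce by (intro eq_vecI) (auto simp: cv_def ip_cmult)
        show ?thesis unfolding lin_def X_def
          using linD[OF W'(2)] U0 Uadd Usm by (auto simp: z a m)
      qed
      have rX: "right_invariant X" unfolding right_invariant_def X_def using RW' inv cv_trans by auto
      have "m \<le> N" if "\<And>i. i < m \<Longrightarrow> e' i \<in> X" "orthonormal m e'" for m e'
        using bd that XW W'(1) by blast
      then obtain m e' where e': "max_orthonormal X m e'" using max_orthonormal_exists[of X N] by blast
      \<comment> \<open>if \<open>X\<close> had full dimension, its basis would expand all of \<open>W'\<close>, and \<open>U\<close> would be everything\<close>
      have nle: "\<not> n \<le> m"
      proof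
        assume "n \<le> m"
        have e'X: "e' i \<in> X" if "i < m" for i using e' that by (simp add: max_orthonormal_def)
        have e'on: "orthonormal m e'" using e' by (simp add: max_orthonormal_def)
        have mn: "m = n"
        proof (rule ccontr)
          assume "m \<noteq> n"
          then have "Suc n \<le> m" using \<open>n \<le> m\<close> by simp
          then have "\<forall>i<Suc n. e' i \<in> W'" "orthonormal (Suc n) e'" using e'X XW e'on
            by (auto simp: orthonormal_def)
          then show False using e unfolding max_orthonormal_def by blast
        qed
        have e'W: "max_orthonormal W' n e'" using e e' XW unfolding mn max_orthonormal_def by blast
        have "v \<in> U" if v: "v \<in> carrier_vec n" for v
        proof -
          define f where "f = (\<lambda>x. \<Sum>i<n. v $ i * e i x)"
          have fW: "f \<in> W'" unfolding f_def using eW by (intro lin_lincomb[OF W'(2)]) auto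
          have cvf: "cv f = v" using v unfolding cv_def f_def
            by (intro eq_vecI) (auto simp: ip_orthonormal_lincomb[OF on])
          define f' where "f' = (\<lambda>x. \<Sum>i<n. ip f (e' i) * e' i x)"
          have "f' \<in> X" unfolding f'_def using e'X mn by (intro lin_lincomb[OF linX]) auto
          moreover have "f x = f' x" if "x \<in> carrier G" for x
            unfolding f'_def using max_orthonormal_expansion[OF W'(2) e'W fW that] .
          then have "cv f = cv f'" unfolding cv_def by (intro eq_vecI) (auto intro!: ip_cong)
          ultimately show ?thesis using cvf by (simp add: X_def)
        qed
        then show False using Uc \<open>U \<noteq> carrier_vec n\<close> by blast
      qed
      show "U = {0\<^sub>v n}"
      proof (rule ccontr)
        assume "U \<noteq> {0\<^sub>v n}"
        then obtain w where w: "w \<in> U" "w \<noteq> 0\<^sub>v n" using U0 by blast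
        have wc: "w \<in> carrier_vec n" using w Uc by auto
        define f where "f = (\<lambda>x. \<Sum>i<n. w $ i * e i x)"
        have fW: "f \<in> W'" unfolding f_def using eW by (intro lin_lincomb[OF W'(2)]) auto
        have cvf: "cv f = w" using wc unfolding cv_def f_def
          by (intro eq_vecI) (auto simp: ip_orthonormal_lincomb[OF on])
        have fX: "f \<in> X" using fW cvf w(1) by (simp add: X_def)
        have cf: "cont f" using linD(1)[OF W'(2) fW] .
        have "nrm2 f \<noteq> 0"
        proof
          assume 0: "nrm2 f = 0"
          have "cv f = cv (\<lambda>x. 0)" unfolding cv_def using nrm2_eq_0[OF cf 0]
            by (intro eq_vecI) (auto intro!: ip_cong)
          also have "\<dots> = 0\<^sub>v n" by (intro eq_vecI) (auto simp: cv_def ip_def haar_0)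
          finally show False using cvf w(2) by simp
        qed
        then have "nrm2 f > 0" using nrm2_nonneg[OF cf] by simp
        then have "m > 0" by (rule pos[OF linX e' fX])
        then have "Q m" unfolding Q_def using XW W'(1) linX rX e' by blast
        then show False using least nle by blast
      qed
    qed
  qed
  show ?thesis
  proof (intro exI conjI ballI)
    show "irrep n \<pi>" by (rule irr)
    show "e 0 \<in> W" using eW[OF n] W'(1) by blast
    show "ip (e 0) (e 0) = 1" using on n by (simp add: orthonormal_def)
    fix x assume x: "x \<in> carrier G"
    have "e 0 x = e 0 (\<one> \<otimes> x)" using x by simp
    also have "\<dots> = (\<Sum>i<n. \<pi> x $$ (i, 0) * e i \<one>)" by (rule trans[OF n one_closed x])
    finally show "e 0 x = (\<Sum>i<n. e i \<one> * \<pi> x $$ (i, 0))" by (simp add: mult.commute)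
  qed
qed

section \<open>Irreducible representations separate points\<close>

lemma cont_entry: "urep n \<pi> \<Longrightarrow> i < n \<Longrightarrow> j < n \<Longrightarrow> cont (\<lambda>x. \<pi> x $$ (i, j))"
  by (simp add: unitary_rep_def)

lemma entry_mult:
  assumes "urep n \<pi>" "x \<in> carrier G" "y \<in> carrier G" "i < n" "j < n"
  shows "\<pi> (x \<otimes> y) $$ (i, j) = (\<Sum>k<n. \<pi> x $$ (i, k) * \<pi> y $$ (k, j))"
  using unitary_repD[OF assms(1)] assms by (simp add: mat_mult_index_sum)

text \<open>
  The continuous functions orthogonal to all coefficients of irreducible representations.
\<close>

definition perp :: "('a \<Rightarrow> complex) set" where
  "perp = {f. cont f \<and> (\<forall>n \<pi>. irrep n \<pi> \<longrightarrow>
     (\<forall>i<n. \<forall>j<n. ip f (\<lambda>x. \<pi> x $$ (i, j)) = 0))}"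

lemma lin_perp: "lin perp"
proof -
  have ce: "cont (\<lambda>x. \<pi> x $$ (i, j))" if "irrep n \<pi>" "i < n" "j < n" for n \<pi> i j
    by (rule cont_entry[of n]) (use that in \<open>auto simp: irreducible_iff\<close>)
  have z: "ip (\<lambda>x. 0) g = 0" for g by (simp add: ip_def haar_0)
  show ?thesis
    unfolding lin_def perp_def
    by (auto simp: z ip_add[OF _ _ ce] ip_cmult[OF _ ce] intro: cont_intros)
qed

lemma perpI:
  assumes "cont f" "\<And>n \<pi> i j. irrep n \<pi> \<Longrightarrow> urep n \<pi> \<Longrightarrow> i < n \<Longrightarrow> j < n \<Longrightarrow> ip f (\<lambda>x. \<pi> x $$ (i, j)) = 0"
  shows "f \<in> perp"
  using assms by (auto simp: perp_def irreducible_iff)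

lemma perp_lincomb:
  assumes f: "f \<in> perp" and \<pi>: "irrep n \<pi>"
    and I: "finite I" "\<And>k. k \<in> I \<Longrightarrow> p k < n" "\<And>k. k \<in> I \<Longrightarrow> q k < n"
    and h: "\<And>x. x \<in> carrier G \<Longrightarrow> h x = (\<Sum>k\<in>I. c k * \<pi> x $$ (p k, q k))"
  shows "ip f h = 0"
proof -
  have u: "urep n \<pi>" using \<pi> by (simp add: irreducible_iff)
  have "ip f h = ip f (\<lambda>x. \<Sum>k\<in>I. c k * \<pi> x $$ (p k, q k))" using h by (intro ip_cong) auto
  also have "\<dots> = (\<Sum>k\<in>I. cnj (c k) * ip f (\<lambda>x. \<pi> x $$ (p k, q k)))"
    using I f cont_entry[OF u] by (intro ip_lincomb_right) (auto simp: perp_def)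
  also have "\<dots> = 0" using f \<pi> I by (intro sum.neutral) (auto simp: perp_def)
  finally show ?thesis .
qed

lemma haar_rep_lincomb:
  fixes n :: nat
  assumes "\<And>k. k < n \<Longrightarrow> cont (a k)" "\<And>y. y \<in> carrier G \<Longrightarrow> F y = (\<Sum>k<n. a k y * b k)"
  shows "haar F = (\<Sum>k<n. haar (a k) * b k)"
proof -
  have "haar F = haar (\<lambda>y. \<Sum>k<n. b k * a k y)" using assms(2) by (intro haar_cong) (simp add: mult.commute)
  also have "\<dots> = (\<Sum>k<n. haar (\<lambda>y. b k * a k y))" using assms(1) by (intro haar_sum) (auto intro!: cont_intros)
  also have "\<dots> = (\<Sum>k<n. haar (a k) * b k)" using assms(1) by (intro sum.cong) (auto simp: haar_cmult)
  finally show ?thesis .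
qed

text \<open>
  By adjointness it suffices that \<open>cor h\<close> maps a coefficient \<open>\<lambda>x. \<pi> x $$ (i, j)\<close> to a linear combination of
  coefficients of \<open>\<pi>\<close>, which follows from multiplicativity of \<open>\<pi>\<close>.
\<close>

lemma conv_perp:
  assumes h: "cont h" and f: "f \<in> perp" shows "conv h f \<in> perp"
proof (rule perpI)
  have cf: "cont f" using f by (simp add: perp_def)
  show "cont (conv h f)" by (rule cont_conv[OF h cf])
  fix n \<pi> i j assume \<pi>: "irrep n \<pi>" and u: "urep n \<pi>" and ij: "i < n" "j < n"
  let ?p = "\<lambda>x. \<pi> x $$ (i, j)"
  have cp: "cont ?p" using cont_entry[OF u ij] .
  have "ip (conv h f) ?p = cnj (ip ?p (conv h f))" using ip_cnj[OF cp cont_conv[OF h cf]] by simp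
  also have "\<dots> = cnj (ip (cor h ?p) f)" by (simp only: ip_cor[OF h cp cf])
  also have "\<dots> = ip f (cor h ?p)" by (rule ip_cnj[OF cont_cor[OF h cp] cf])
  also have "\<dots> = 0"
  proof (rule perp_lincomb[OF f \<pi>])
    fix x assume x: "x \<in> carrier G"
    show "cor h ?p x = (\<Sum>k\<in>{..<n}. haar (\<lambda>y. cnj (h y) * \<pi> y $$ (i, k)) * \<pi> x $$ (k, j))"
      unfolding cor_def
    proof (rule haar_rep_lincomb)
      fix y assume "y \<in> carrier G"
      then show "cnj (h y) * \<pi> (y \<otimes> x) $$ (i, j) = (\<Sum>k<n. cnj (h y) * \<pi> y $$ (i, k) * \<pi> x $$ (k, j))"
        using entry_mult[OF u _ x ij] by (simp add: sum_distrib_left mult_ac)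
    qed (use h cont_entry[OF u ij(1)] in \<open>auto intro: cont_intros\<close>)
  qed (use ij in auto)
  finally show "ip (conv h f) ?p = 0" .
qed

lemma cor_perp:
  assumes h: "cont h" and f: "f \<in> perp" shows "cor h f \<in> perp"
proof (rule perpI)
  have cf: "cont f" using f by (simp add: perp_def)
  show "cont (cor h f)" by (rule cont_cor[OF h cf])
  fix n \<pi> i j assume \<pi>: "irrep n \<pi>" and u: "urep n \<pi>" and ij: "i < n" "j < n"
  let ?p = "\<lambda>x. \<pi> x $$ (i, j)"
  have cp: "cont ?p" using cont_entry[OF u ij] .
  have "ip (cor h f) ?p = ip f (conv h ?p)" by (rule ip_cor[OF h cf cp])
  also have "\<dots> = 0"
  proof (rule perp_lincomb[OF f \<pi>])
    fix x assume x: "x \<in> carrier G"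
    show "conv h ?p x = (\<Sum>k\<in>{..<n}. haar (\<lambda>y. h y * \<pi> (inv y) $$ (i, k)) * \<pi> x $$ (k, j))"
      unfolding conv_def
    proof (rule haar_rep_lincomb)
      fix y assume "y \<in> carrier G"
      then show "h y * \<pi> (inv y \<otimes> x) $$ (i, j) = (\<Sum>k<n. h y * \<pi> (inv y) $$ (i, k) * \<pi> x $$ (k, j))"
        using entry_mult[OF u _ x ij, of "inv y"] by (simp add: sum_distrib_left mult_ac)
    qed (use h cont_inv[OF cont_entry[OF u ij(1)]] in \<open>auto intro: cont_intros\<close>)
  qed (use ij in auto)
  finally show "ip (cor h f) ?p = 0" .
qed

lemma right_invariant_perp: "right_invariant perp"
  unfolding right_invariant_def
proof (intro ballI)
  fix f g assume f: "f \<in> perp" and g: "g \<in> carrier G"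
  have cf: "cont f" using f by (simp add: perp_def)
  show "(\<lambda>x. f (x \<otimes> g)) \<in> perp"
  proof (rule perpI)
    show "cont (\<lambda>x. f (x \<otimes> g))" by (rule cont_right[OF cf g])
    fix n \<pi> i j assume \<pi>: "irrep n \<pi>" and u: "urep n \<pi>" and ij: "i < n" "j < n"
    have "ip (\<lambda>x. f (x \<otimes> g)) (\<lambda>x. \<pi> x $$ (i, j)) = ip f (\<lambda>x. \<pi> (x \<otimes> inv g) $$ (i, j))"
      by (rule ip_right_translate[OF cf cont_entry[OF u ij] g])
    also have "\<dots> = 0"
    proof (rule perp_lincomb[OF f \<pi>, where I = "{..<n}" and p = "\<lambda>k. i" and q = "\<lambda>k. k"
      and c = "\<lambda>k. \<pi> (inv g) $$ (k, j)"])
      fix x assume "x \<in> carrier G"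
      then show "\<pi> (x \<otimes> inv g) $$ (i, j) = (\<Sum>k<n. \<pi> (inv g) $$ (k, j) * \<pi> x $$ (i, k))"
        using entry_mult[OF u _ _ ij, of x "inv g"] g by (simp add: mult.commute)
    qed (use ij in auto)
    finally show "ip (\<lambda>x. f (x \<otimes> g)) (\<lambda>x. \<pi> x $$ (i, j)) = 0" .
  qed
qed

lemma perp_uniform_limit:
  assumes f: "\<And>n. f n \<in> perp" and u: "uniform_limit (carrier G) f u sequentially"
  shows "u \<in> perp"
proof (rule perpI)
  have cf: "cont (f n)" for n using f[of n] by (simp add: perp_def)
  show "cont u" by (rule cont_uniform_limit[OF cf u])
  fix n \<pi> i j assume \<pi>: "irrep n \<pi>" and r: "urep n \<pi>" and ij: "i < n" "j < n"
  have "ip (f k) (\<lambda>x. \<pi> x $$ (i, j)) = 0" for k using f[of k] \<pi> ij by (simp add: perp_def)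
  then show "ip u (\<lambda>x. \<pi> x $$ (i, j)) = 0"
    using LIMSEQ_unique[OF ip_uniform_limit[OF cf u cont_entry[OF r ij]], of 0] by simp
qed

text \<open>
  The eigenspace \<open>E\<close> of \<open>cor h (conv h f) = s f\<close> in \<open>perp\<close> is invariant under right translations, and it
  is finite-dimensional because its members satisfy \<open>s f = cor h (conv h f)\<close>, which bounds their values
  by their mean square norm. So it contains a non-zero function that is a linear combination of
  coefficients of an irreducible representation, and this function is orthogonal to itself.
\<close>

lemma perp_trivial:
  assumes h: "h \<in> perp" and x0: "x0 \<in> carrier G" shows "h x0 = 0"
proof (rule ccontr)
  assume ne: "h x0 \<noteq> 0"
  have ch: "cont h" using h by (simp add: perp_def)
  have "\<exists>s u. s > 0 \<and> u \<in> perp \<and> nrm2 u > 0 \<and> (\<forall>x\<in>carrier G. cor h (conv h u) x = of_real s * u x)"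
  proof (rule singular_vector_exists[OF lin_perp h x0 ne cor_perp[OF ch] conv_perp[OF ch]])
    fix f v assume f: "\<And>n. f n \<in> perp" and v: "uniform_limit (carrier G) f v sequentially"
    show "v \<in> perp" by (rule perp_uniform_limit[of f, OF f v])
  qed
  then obtain s u where s: "s > 0" and u: "u \<in> perp" "nrm2 u > 0"
    and eig: "\<And>x. x \<in> carrier G \<Longrightarrow> cor h (conv h u) x = of_real s * u x"
    by blast
  define E where "E = {f \<in> perp. \<forall>x\<in>carrier G. cor h (conv h f) x = of_real s * f x}"
  have cperp: "cont f" if "f \<in> perp" for f using that by (simp add: perp_def)
  have cc: "cont (conv h f)" if "f \<in> perp" for f using cont_conv[OF ch cperp[OF that]] .
  have linE: "lin E"
  proof -
    have z: "(\<lambda>x. 0) \<in> E" unfolding E_def using linD(2)[OF lin_perp] by (simp add: cor_def conv_def haar_0)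
    have a: "(\<lambda>x. f x + g x) \<in> E" if "f \<in> E" "g \<in> E" for f g
    proof -
      have fg: "f \<in> perp" "g \<in> perp" using that by (auto simp: E_def)
      have "cor h (conv h (\<lambda>x. f x + g x)) x = of_real s * (f x + g x)" if x: "x \<in> carrier G" for x
      proof -
        have "cor h (conv h (\<lambda>x. f x + g x)) x = cor h (\<lambda>x. conv h f x + conv h g x) x"
          using conv_add[OF ch cperp[OF fg(1)] cperp[OF fg(2)]] by (intro cor_cong x)
        also have "\<dots> = cor h (conv h f) x + cor h (conv h g) x"
          by (rule cor_add[OF ch cc[OF fg(1)] cc[OF fg(2)] x])
        finally show ?thesis using \<open>f \<in> E\<close> \<open>g \<in> E\<close> x by (simp add: E_def distrib_left)
      qed
      then show ?thesis using linD(3)[OF lin_perp fg] by (simp add: E_def)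
    qed
    have m: "(\<lambda>x. c * f x) \<in> E" if "f \<in> E" for c f
    proof -
      have f: "f \<in> perp" using that by (auto simp: E_def)
      have "cor h (conv h (\<lambda>x. c * f x)) x = of_real s * (c * f x)" if x: "x \<in> carrier G" for x
      proof -
        have "cor h (conv h (\<lambda>x. c * f x)) x = cor h (\<lambda>x. c * conv h f x) x"
          using conv_cmult[OF ch cperp[OF f]] by (intro cor_cong x)
        also have "\<dots> = c * cor h (conv h f) x" by (rule cor_cmult[OF ch cc[OF f] x])
        finally show ?thesis using \<open>f \<in> E\<close> x by (simp add: E_def)
      qed
      then show ?thesis using linD(4)[OF lin_perp f] by (simp add: E_def)
    qed
    show ?thesis unfolding lin_def using z a m cperp by (auto simp: E_def)
  qed
  have rE: "right_invariant E" unfolding right_invariant_def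
  proof (intro ballI)
    fix f g assume f: "f \<in> E" and g: "g \<in> carrier G"
    have "cor h (conv h (\<lambda>x. f (x \<otimes> g))) x = of_real s * f (x \<otimes> g)" if x: "x \<in> carrier G" for x
    proof -
      have "cor h (conv h (\<lambda>x. f (x \<otimes> g))) x = cor h (\<lambda>x. conv h f (x \<otimes> g)) x"
        using conv_right_translate[OF _ g] by (intro cor_cong x)
      also have "\<dots> = cor h (conv h f) (x \<otimes> g)" by (rule cor_right_translate[OF x g])
      finally show ?thesis using f x g by (simp add: E_def)
    qed
    then show "(\<lambda>x. f (x \<otimes> g)) \<in> E" using f g right_invariant_perp by (simp add: E_def right_invariant_def)
  qed
  define K where "K = nrm2 h / s"
  have K0: "K \<ge> 0" using nrm2_nonneg[OF ch] s by (simp add: K_def)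
  have K: "(cmod (f x))\<^sup>2 \<le> K * nrm2 f" if f: "f \<in> E" and x: "x \<in> carrier G" for f x
  proof -
    have fp: "f \<in> perp" using f by (simp add: E_def)
    have "s\<^sup>2 * (cmod (f x))\<^sup>2 = (cmod (cor h (conv h f) x))\<^sup>2"
      using f x s by (simp add: E_def norm_mult power_mult_distrib)
    also have "\<dots> \<le> nrm2 (conv h f) * nrm2 h" by (rule norm_cor_le[OF ch cc[OF fp] x])
    also have "nrm2 (conv h f) = s * nrm2 f"
    proof -
      have "ip (conv h f) (conv h f) = ip (cor h (conv h f)) f"
        by (rule ip_cor[OF ch cc[OF fp] cperp[OF fp], symmetric])
      also have "\<dots> = ip (\<lambda>x. of_real s * f x) f" using f by (intro ip_cong) (auto simp: E_def)
      finally show ?thesis using ip_cmult[OF cperp[OF fp] cperp[OF fp], of "of_real s"] by (simp add: nrm2_def)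
    qed
    finally have "s * (s * (cmod (f x))\<^sup>2) \<le> s * (nrm2 h * nrm2 f)" by (simp add: power2_eq_square mult_ac)
    then have "s * (cmod (f x))\<^sup>2 \<le> nrm2 h * nrm2 f" using s by simp
    then show ?thesis using s by (simp add: K_def field_simps)
  qed
  have uE: "u \<in> E" using u eig by (simp add: E_def)
  have "\<exists>n \<pi> f a. irrep n \<pi> \<and> f \<in> E \<and> ip f f = 1 \<and>
    (\<forall>x\<in>carrier G. f x = (\<Sum>i<n. a i * \<pi> x $$ (i, 0)))"
  proof (rule invariant_space_contains_irreducible[OF linE rE uE u(2)])
    fix n e assume "\<And>i. i < n \<Longrightarrow> e i \<in> E" "orthonormal n e"
    from orthonormal_card_bound[OF linE K0 K this] show "n \<le> nat \<lceil>K\<rceil>" by linarith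
  qed
  then obtain n \<pi> f a where \<pi>: "irrep n \<pi>" and f: "f \<in> E" "ip f f = 1"
    and fx: "\<And>x. x \<in> carrier G \<Longrightarrow> f x = (\<Sum>i<n. a i * \<pi> x $$ (i, 0))"
    by blast
  have "ip f f = 0"
  proof (rule perp_lincomb[OF _ \<pi>])
    show "f \<in> perp" using f by (simp add: E_def)
    show "\<And>x. x \<in> carrier G \<Longrightarrow> f x = (\<Sum>i\<in>{..<n}. a i * \<pi> x $$ (i, 0))" by (rule fx)
  qed (use \<pi> in \<open>auto simp: irreducible_iff\<close>)
  then show False using f(2) by simp
qed

text \<open>
  If all irreducible representations are trivial at \<open>g\<close>, then \<open>\<lambda>x. f (x \<otimes> g) - f x\<close> is orthogonal to their
  coefficients for every continuous \<open>f\<close>, hence zero. So continuous functions do not distinguish \<open>g\<close> from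
  \<open>\<one>\<close>, and Urysohn's lemma applies.
\<close>

theorem irreducible_reps_separate:
  assumes H: "Hausdorff_space T" and g: "g \<in> carrier G"
    and triv: "\<And>n \<pi>. irrep n \<pi> \<Longrightarrow> \<pi> g = 1\<^sub>m n"
  shows "g = \<one>"
proof (rule ccontr)
  assume ne: "g \<noteq> \<one>"
  have inv: "f g = f \<one>" if f: "cont f" for f
  proof -
    have "(\<lambda>x. f (x \<otimes> g) - f x) \<in> perp"
    proof (rule perpI)
      have cg: "cont (\<lambda>x. f (x \<otimes> g))" by (rule cont_right[OF f g])
      show "cont (\<lambda>x. f (x \<otimes> g) - f x)" by (rule cont_diff[OF cg f])
      fix n \<pi> i j assume \<pi>: "irrep n \<pi>" and u: "urep n \<pi>" and ij: "i < n" "j < n"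
      note r = unitary_repD[OF u]
      have ig: "\<pi> (inv g) = 1\<^sub>m n"
      proof -
        have "\<pi> (inv g) = \<pi> (inv g) * \<pi> g" using triv[OF \<pi>] r(1)[of "inv g"] g by simp
        also have "\<dots> = 1\<^sub>m n" using r(4)[of "inv g" g] g unitary_rep_one[OF u] by simp
        finally show ?thesis .
      qed
      have "ip (\<lambda>x. f (x \<otimes> g)) (\<lambda>x. \<pi> x $$ (i, j)) = ip f (\<lambda>x. \<pi> (x \<otimes> inv g) $$ (i, j))"
        by (rule ip_right_translate[OF f cont_entry[OF u ij] g])
      also have "\<dots> = ip f (\<lambda>x. \<pi> x $$ (i, j))"
        using r(4)[of _ "inv g"] g ig right_mult_one_mat[OF r(1)] by (intro ip_cong) auto
      finally show "ip (\<lambda>x. f (x \<otimes> g) - f x) (\<lambda>x. \<pi> x $$ (i, j)) = 0"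
        using ip_diff[OF cg f cont_entry[OF u ij]] by simp
    qed
    from perp_trivial[OF this one_closed] show ?thesis using g by simp
  qed
  have "normal_space T" using compact H by (simp add: compact_Hausdorff_or_regular_imp_normal_space)
  moreover have "closedin T {g}" "closedin T {\<one>}"
    using H g by (auto simp: topspace_eq intro!: closedin_Hausdorff_singleton)
  ultimately obtain f :: "'a \<Rightarrow> real" where f: "continuous_map T (top_of_set {0..1}) f" "f ` {g} \<subseteq> {0}"
    "f ` {\<one>} \<subseteq> {1}"
    using Urysohn_lemma[of T "{g}" "{\<one>}" 0 1] ne by (auto simp: disjnt_def)
  have "continuous_map T euclidean f" using f(1) by (simp add: continuous_map_in_subtopology)
  then have "cont (\<lambda>x. complex_of_real (f x))" by (auto simp: continuous_map_atin intro: tendsto_of_real)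
  from inv[OF this] show False using f(2,3) by simp
qed

section \<open>Local randomness bounds the number of irreducible representations\<close>

text \<open>
  The mean \<open>P\<close> of \<open>\<sigma> g * \<pi> (inv g)\<close> is an intertwiner by left invariance. If \<open>\<sigma> g\<close> were equal to \<open>\<pi> g\<close> the
  trace of the integrand would be \<open>n\<close>; the assumed closeness changes it by at most \<open>1 / 2\<close>, as there are
  \<open>n\<^sup>2\<close> pairs of entries and those of \<open>\<pi> (inv g)\<close> are bounded by 1. So \<open>P\<close> is not zero.
\<close>

lemma close_reps_isomorphic:
  assumes \<pi>: "irrep n \<pi>" and \<sigma>: "urep n \<sigma>"
    and close: "\<And>g i j. g \<in> carrier G \<Longrightarrow> i < n \<Longrightarrow> j < n \<Longrightarrow>
      cmod (\<sigma> g $$ (i, j) - \<pi> g $$ (i, j)) \<le> 1 / (2 * (real n)\<^sup>2)"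
  shows "isomorphic_reps G n \<pi> \<sigma>"
proof -
  have \<pi>u: "urep n \<pi>" and n: "n > 0" using \<pi> by (auto simp: irreducible_iff)
  note r = unitary_repD[OF \<pi>u] and s = unitary_repD[OF \<sigma>]
  define F where "F = (\<lambda>g. \<sigma> g * \<pi> (inv g))"
  have Fc: "F g \<in> carrier_mat n n" if "g \<in> carrier G" for g
    using r(1)[of "inv g"] s(1)[OF that] that by (auto simp: F_def)
  have Fij: "F g $$ (i, j) = (\<Sum>k<n. \<sigma> g $$ (i, k) * \<pi> (inv g) $$ (k, j))" if "g \<in> carrier G" "i < n" "j < n"
    for g i j
    unfolding F_def using r(1)[of "inv g"] s(1) that by (simp add: mat_mult_index_sum)
  have Fcont: "cont (\<lambda>g. F g $$ (i, j))" if "i < n" "j < n" for i j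
  proof (rule cont_cong)
    show "cont (\<lambda>g. \<Sum>k<n. \<sigma> g $$ (i, k) * \<pi> (inv g) $$ (k, j))"
      using that cont_entry[OF \<sigma>] cont_inv[OF cont_entry[OF \<pi>u]] by (intro cont_sum cont_mult) auto
  qed (use Fij that in simp)
  define P where "P = mat n n (\<lambda>(i, j). haar (\<lambda>g. F g $$ (i, j)))"
  have P: "P \<in> carrier_mat n n" by (simp add: P_def)
  have comm: "P * \<pi> h = \<sigma> h * P" if h: "h \<in> carrier G" for h
  proof (rule eq_matI)
    fix i j assume "i < dim_row (\<sigma> h * P)" "j < dim_col (\<sigma> h * P)"
    then have ij: "i < n" "j < n" using s(1)[OF h] P by auto
    have key: "\<sigma> h * F g = F (h \<otimes> g) * \<pi> h" if g: "g \<in> carrier G" for g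
    proof -
      have "\<pi> (inv g) = \<pi> (inv (h \<otimes> g)) * \<pi> h"
        using r(4)[of "inv (h \<otimes> g)" h] g h by (simp add: inv_mult_group m_assoc)
      then have "\<sigma> h * F g = \<sigma> h * \<sigma> g * (\<pi> (inv (h \<otimes> g)) * \<pi> h)"
        unfolding F_def using assoc_mult_mat[OF s(1)[OF h] s(1)[OF g] r(1)[of "inv g"]] g by simp
      also have "\<dots> = \<sigma> (h \<otimes> g) * \<pi> (inv (h \<otimes> g)) * \<pi> h"
        using assoc_mult_mat[OF s(1)[of "h \<otimes> g"] r(1)[of "inv (h \<otimes> g)"] r(1)[OF h]] s(4)[OF h g] g h by simp
      finally show ?thesis by (simp add: F_def)
    qed
    have "(\<sigma> h * P) $$ (i, j) = (\<Sum>k<n. \<sigma> h $$ (i, k) * haar (\<lambda>g. F g $$ (k, j)))"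
      unfolding mat_mult_index_sum[OF s(1)[OF h] P ij] by (intro sum.cong) (auto simp: P_def ij)
    also have "\<dots> = (\<Sum>k<n. haar (\<lambda>g. \<sigma> h $$ (i, k) * F g $$ (k, j)))"
      using Fcont ij by (intro sum.cong) (auto simp: haar_cmult)
    also have "\<dots> = haar (\<lambda>g. \<Sum>k<n. \<sigma> h $$ (i, k) * F g $$ (k, j))"
      using Fcont ij by (intro haar_sum[symmetric]) (auto intro!: cont_mult)
    also have "\<dots> = haar (\<lambda>g. \<Sum>k<n. F (h \<otimes> g) $$ (i, k) * \<pi> h $$ (k, j))"
    proof (rule haar_cong)
      fix g assume g: "g \<in> carrier G"
      have "(\<Sum>k<n. \<sigma> h $$ (i, k) * F g $$ (k, j)) = (\<sigma> h * F g) $$ (i, j)"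
        using mat_mult_index_sum[OF s(1)[OF h] Fc[OF g] ij] by simp
      also have "\<dots> = (\<Sum>k<n. F (h \<otimes> g) $$ (i, k) * \<pi> h $$ (k, j))"
        unfolding key[OF g] using mat_mult_index_sum[OF Fc r(1)[OF h] ij, of "h \<otimes> g"] g h by simp
      finally show "(\<Sum>k<n. \<sigma> h $$ (i, k) * F g $$ (k, j)) = (\<Sum>k<n. F (h \<otimes> g) $$ (i, k) * \<pi> h $$ (k, j))" .
    qed
    also have "\<dots> = (\<Sum>k<n. haar (\<lambda>g. F (h \<otimes> g) $$ (i, k)) * \<pi> h $$ (k, j))"
      using cont_left[OF Fcont h] ij by (intro haar_rep_lincomb) auto
    also have "\<dots> = (\<Sum>k<n. P $$ (i, k) * \<pi> h $$ (k, j))"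
      using haar_left[OF Fcont h] ij by (intro sum.cong) (auto simp: P_def)
    also have "\<dots> = (P * \<pi> h) $$ (i, j)" by (rule mat_mult_index_sum[OF P r(1)[OF h] ij, symmetric])
    finally show "(P * \<pi> h) $$ (i, j) = (\<sigma> h * P) $$ (i, j)" ..
  qed (use P r(1)[OF h] s(1)[OF h] in auto)
  have "P \<noteq> 0\<^sub>m n n"
  proof
    assume P0: "P = 0\<^sub>m n n"
    define tr where "tr = (\<lambda>g. \<Sum>i<n. F g $$ (i, i))"
    have ctr: "cont tr" unfolding tr_def using Fcont by (intro cont_sum) auto
    have "haar tr = (\<Sum>i<n. P $$ (i, i))"
      unfolding tr_def using Fcont by (subst haar_sum) (auto simp: P_def)
    then have Mtr: "haar tr = 0" by (simp add: P0)
    have "cmod (of_nat n - tr g) \<le> 1 / 2" if g: "g \<in> carrier G" for g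
    proof -
      have one: "cmod (\<pi> (inv g) $$ (k, i)) \<le> 1" if "i < n" "k < n" for i k
      proof -
        have "op_norm (\<pi> (inv g)) \<le> 1"
          using unitary_rep_isometry[OF \<pi>u, of "inv g"] r(1)[of "inv g"] g by (intro op_norm_le) auto
        then show ?thesis using norm_entry_le_op_norm[OF r(1)[of "inv g"] that(2,1)] g by simp
      qed
      have "(\<Sum>i<n. \<Sum>k<n. \<pi> g $$ (i, k) * \<pi> (inv g) $$ (k, i)) = (\<Sum>i<n. (\<pi> g * \<pi> (inv g)) $$ (i, i))"
        using g by (intro sum.cong refl mat_mult_index_sum[symmetric] r(1)) auto
      also have "\<dots> = (\<Sum>i<n. 1)"
        using r(2)[OF g] unitary_rep_inv[OF \<pi>u g] by (intro sum.cong) auto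
      finally have "of_nat n = (\<Sum>i<n. \<Sum>k<n. \<pi> g $$ (i, k) * \<pi> (inv g) $$ (k, i))" by simp
      then have "of_nat n - tr g = (\<Sum>i<n. \<Sum>k<n. (\<pi> g $$ (i, k) - \<sigma> g $$ (i, k)) * \<pi> (inv g) $$ (k, i))"
        unfolding tr_def using Fij[OF g] by (simp add: sum_subtractf left_diff_distrib)
      also have "cmod \<dots> \<le> (\<Sum>i<n. \<Sum>k<n. 1 / (2 * (real n)\<^sup>2))"
      proof (intro sum_norm_le)
        fix i k assume "i \<in> {..<n}" "k \<in> {..<n}"
        then have ik: "i < n" "k < n" by auto
        have "cmod ((\<pi> g $$ (i, k) - \<sigma> g $$ (i, k)) * \<pi> (inv g) $$ (k, i)) \<le> 1 / (2 * (real n)\<^sup>2) * 1"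
          unfolding norm_mult using close[OF g ik] one[OF ik]
          by (intro mult_mono) (auto simp: norm_minus_commute)
        then show "cmod ((\<pi> g $$ (i, k) - \<sigma> g $$ (i, k)) * \<pi> (inv g) $$ (k, i)) \<le> 1 / (2 * (real n)\<^sup>2)" by simp
      qed
      also have "\<dots> = 1 / 2" using n by (simp add: power2_eq_square)
      finally show ?thesis .
    qed
    then have "cmod (haar (\<lambda>g. of_nat n - tr g)) \<le> 1 / 2" using ctr by (intro norm_haar_le cont_diff cont_const)
    then have "real n \<le> 1 / 2" using ctr Mtr by (simp add: haar_diff haar_const)
    then show False using n by simp
  qed
  from intertwiner_invertible[OF \<pi> \<sigma> P this comm] show ?thesis
    unfolding isomorphic_reps_def using P comm by blast
qed

text \<open>
  The invariant \<open>\<Phi> \<pi>\<close> records the entries of \<open>\<pi>\<close> at the points of a finite net \<open>X\<close>, rounded to a grid. It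
  takes finitely many values because the entries are bounded by 1. If it agrees for \<open>\<pi>\<close> and \<open>\<sigma>\<close> then the
  entries differ by at most \<open>\<eta> / 3\<close> on \<open>X\<close>, and passing from \<open>X\<close> to a nearby point costs another \<open>\<eta> / 3\<close>
  for each of the two representations.
\<close>

lemma locally_random_imp_finite:
  assumes lr: "locally_random G T" and n: "n > 0"
  shows "finite (irrep_classes G T n)"
proof -
  obtain d L C where d: "compatible_biinvariant_metric G T d" and C: "1 \<le> C"
    and LR: "locally_random_wrt G T d L C"
    using lr unfolding locally_random_def by blast
  interpret D: Metric_space "carrier G" d using d by (simp add: compatible_biinvariant_metric_def)
  have mt: "D.mtopology = T" using d by (simp add: compatible_biinvariant_metric_def)
  let ?A = "{\<pi>. irrep n \<pi>}"
  define K where "K = C * real n powr L"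
  have K: "K > 0" using C n by (simp add: K_def)
  define \<eta> where "\<eta> = 1 / (2 * (real n)\<^sup>2)"
  have \<eta>: "\<eta> > 0" using n by (simp add: \<eta>_def)
  have "compactin D.mtopology (carrier G)" using compact mt by (simp add: compact_space_def topspace_eq)
  then have "D.mtotally_bounded (carrier G)" by (rule D.compactin_imp_mtotally_bounded)
  moreover have "\<eta> / (3 * K) > 0" using \<eta> K by simp
  ultimately have "\<exists>X. finite X \<and> X \<subseteq> carrier G \<and> carrier G \<subseteq> (\<Union>x\<in>X. D.mball x (\<eta> / (3 * K)))"
    unfolding D.mtotally_bounded_def by simp
  then obtain X where X: "finite X" "X \<subseteq> carrier G" "carrier G \<subseteq> (\<Union>x\<in>X. D.mball x (\<eta> / (3 * K)))"
    by (elim exE conjE)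
  \<comment> \<open>grid of mesh \<open>\<eta> / 6\<close> in the real and in the imaginary direction\<close>
  define s where "s = 6 / \<eta>"
  have s: "s > 0" using \<eta> by (simp add: s_def)
  define q where "q = (\<lambda>z. (\<lfloor>Re z * s\<rfloor>, \<lfloor>Im z * s\<rfloor>))"
  have q: "cmod (z - w) \<le> \<eta> / 3" if "q z = q w" for z w
  proof -
    have fl: "\<bar>a - b\<bar> \<le> \<eta> / 6" if "\<lfloor>a * s\<rfloor> = \<lfloor>b * s\<rfloor>" for a b
    proof -
      have "\<bar>a * s - b * s\<bar> \<le> 1" using that by linarith
      then have "\<bar>a - b\<bar> * s \<le> 1" using s by (simp add: abs_mult flip: left_diff_distrib)
      then show ?thesis using \<eta> by (simp add: s_def field_simps)
    qed
    have "cmod (z - w) \<le> \<bar>Re z - Re w\<bar> + \<bar>Im z - Im w\<bar>" using cmod_le[of "z - w"] by simp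
    then show ?thesis using fl[of "Re z" "Re w"] fl[of "Im z" "Im w"] that by (simp add: q_def)
  qed
  define \<Phi> where "\<Phi> = (\<lambda>\<pi>. restrict (\<lambda>(x, i, j). q (\<pi> x $$ (i, j) :: complex)) (X \<times> {..<n} \<times> {..<n}))"
  have entry1: "cmod (\<pi> x $$ (i, j)) \<le> 1" if "urep n \<pi>" "x \<in> carrier G" "i < n" "j < n" for \<pi> x i j
  proof -
    have c: "\<pi> x \<in> carrier_mat n n" using unitary_repD(1) that by blast
    have "op_norm (\<pi> x) \<le> 1" using unitary_rep_isometry[OF that(1,2)] c by (intro op_norm_le) auto
    then show ?thesis using norm_entry_le_op_norm[OF c that(3,4)] by simp
  qed
  let ?box = "{- \<lceil>s\<rceil>..\<lceil>s\<rceil>} \<times> {- \<lceil>s\<rceil>..\<lceil>s\<rceil>}"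
  have qbox: "q z \<in> ?box" if "cmod z \<le> 1" for z
  proof -
    have fl: "\<lfloor>a * s\<rfloor> \<in> {- \<lceil>s\<rceil>..\<lceil>s\<rceil>}" if "\<bar>a\<bar> \<le> 1" for a
    proof -
      have "\<bar>a * s\<bar> \<le> 1 * s" unfolding abs_mult using that s by (intro mult_mono) auto
      then have "a * s \<le> s" "- s \<le> a * s" by auto
      then show ?thesis by (simp add: le_floor_iff floor_le_iff) linarith
    qed
    have "\<bar>Re z\<bar> \<le> 1" "\<bar>Im z\<bar> \<le> 1" using abs_Re_le_cmod[of z] abs_Im_le_cmod[of z] that by linarith+
    then show ?thesis using fl by (simp add: q_def)
  qed
  have "\<Phi> ` ?A \<subseteq> (X \<times> {..<n} \<times> {..<n}) \<rightarrow>\<^sub>E ?box"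
  proof (intro image_subsetI)
    fix \<pi> assume "\<pi> \<in> ?A"
    then have u: "urep n \<pi>" by (simp add: irreducible_iff)
    have "q (\<pi> x $$ (i, j)) \<in> ?box" if "x \<in> X" "i < n" "j < n" for x i j
      using that X(2) by (intro qbox entry1[OF u]) auto
    then show "\<Phi> \<pi> \<in> (X \<times> {..<n} \<times> {..<n}) \<rightarrow>\<^sub>E ?box"
      unfolding \<Phi>_def by (intro restrict_PiE_iff[THEN iffD2]) auto
  qed
  moreover have "finite ((X \<times> {..<n} \<times> {..<n}) \<rightarrow>\<^sub>E ?box)" using X(1) by (intro finite_PiE) auto
  ultimately have "finite (\<Phi> ` ?A)" by (rule finite_subset)
  then show ?thesis
  proof (rule finite_irrep_classesI)
    fix \<pi> \<sigma> assume \<pi>: "irrep n \<pi>" and \<sigma>: "irrep n \<sigma>" and eq: "\<Phi> \<pi> = \<Phi> \<sigma>"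
    have lip: "cmod (\<rho> x $$ (i, j) - \<rho> y $$ (i, j)) \<le> K * d x y"
      if \<rho>: "irrep n \<rho>" and xy: "x \<in> carrier G" "y \<in> carrier G" and ij: "i < n" "j < n" for \<rho> x y i j
    proof -
      have u: "urep n \<rho>" using \<rho> by (simp add: irreducible_iff)
      have c: "\<rho> x \<in> carrier_mat n n" "\<rho> y \<in> carrier_mat n n" using unitary_repD(1)[OF u] xy by auto
      have dc: "\<rho> x - \<rho> y \<in> carrier_mat n n" using c by auto
      have "cmod ((\<rho> x - \<rho> y) $$ (i, j)) \<le> op_norm (\<rho> x - \<rho> y)"
        by (rule norm_entry_le_op_norm[OF dc ij])
      also have "\<dots> \<le> K * d x y" using LR \<rho> xy by (auto simp: locally_random_wrt_def K_def)
      finally show ?thesis using c ij by simp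
    qed
    show "isomorphic_reps G n \<pi> \<sigma>"
    proof (rule close_reps_isomorphic)
      show "irrep n \<pi>" "urep n \<sigma>" using \<pi> \<sigma> by (auto simp: irreducible_iff)
      fix g i j assume g: "g \<in> carrier G" and ij: "i < n" "j < n"
      obtain x where x: "x \<in> X" "g \<in> D.mball x (\<eta> / (3 * K))" using X(3) g by blast
      have xG: "x \<in> carrier G" using x(1) X(2) by auto
      have "K * d x g \<le> K * (\<eta> / (3 * K))" using x(2) K by (intro mult_left_mono) auto
      then have dx: "K * d x g \<le> \<eta> / 3" using K by simp
      have "\<Phi> \<pi> (x, i, j) = \<Phi> \<sigma> (x, i, j)" using eq by simp
      then have "q (\<sigma> x $$ (i, j)) = q (\<pi> x $$ (i, j))" using x(1) ij by (simp add: \<Phi>_def)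
      then have 1: "cmod (\<sigma> x $$ (i, j) - \<pi> x $$ (i, j)) \<le> \<eta> / 3" by (rule q)
      have 2: "cmod (\<sigma> x $$ (i, j) - \<sigma> g $$ (i, j)) \<le> \<eta> / 3" using lip[OF _ xG g ij, of \<sigma>] \<sigma> dx by simp
      have 3: "cmod (\<pi> x $$ (i, j) - \<pi> g $$ (i, j)) \<le> \<eta> / 3" using lip[OF _ xG g ij, of \<pi>] \<pi> dx by simp
      have eq: "\<sigma> g $$ (i, j) - \<pi> g $$ (i, j) = (\<sigma> x $$ (i, j) - \<pi> x $$ (i, j)) - (\<sigma> x $$ (i, j) - \<sigma> g $$
        (i, j)) + (\<pi> x $$ (i, j) - \<pi> g $$ (i, j))" by simp
      have "cmod (\<sigma> g $$ (i, j) - \<pi> g $$ (i, j)) \<le> \<eta>"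
        unfolding eq
        using 1 2 3 norm_triangle_ineq[of "(\<sigma> x $$ (i, j) - \<pi> x $$ (i, j)) - (\<sigma> x $$ (i, j) - \<sigma> g $$ (i,
          j))" "\<pi> x $$ (i, j) - \<pi> g $$ (i, j)"]
          norm_triangle_ineq4[of "\<sigma> x $$ (i, j) - \<pi> x $$ (i, j)" "\<sigma> x $$ (i, j) - \<sigma> g $$ (i, j)"] by linarith
      then show "cmod (\<sigma> g $$ (i, j) - \<pi> g $$ (i, j)) \<le> 1 / (2 * (real n)\<^sup>2)" by (simp add: \<eta>_def)
    qed
  qed
qed

section \<open>The metric defined by the irreducible representations\<close>

text \<open>
  One neighbourhood serves all irreducible representations of degree \<open>n\<close>: up to isomorphism there are
  finitely many, and the norms in question are isomorphism invariants.
\<close>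

lemma irreps_nbhd:
  assumes fin: "\<And>n. n > 0 \<Longrightarrow> finite (irrep_classes G T n)" and y0: "y0 \<in> carrier G" and e: "e > 0"
  shows "\<exists>V. openin T V \<and> y0 \<in> V \<and> (\<forall>\<pi>. irrep n \<pi> \<longrightarrow> (\<forall>y\<in>V. op_norm (\<pi> y0 - \<pi> y) < e))"
proof (cases "n = 0")
  case True
  then show ?thesis using y0 openin_topspace[of T]
    by (intro exI[of _ "topspace T"]) (auto simp: irreducible_iff topspace_eq)
next
  case False
  obtain R where finR: "finite R" and R: "\<And>\<rho>. \<rho> \<in> R \<Longrightarrow> irrep n \<rho>"
    and repr: "\<And>\<pi>. irrep n \<pi> \<Longrightarrow> \<exists>\<rho>\<in>R. isomorphic_reps G n \<pi> \<rho>"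
    using finite_irrep_representatives[OF fin] False by (metis neq0_conv)
  define V where "V = {y \<in> topspace T. \<forall>\<rho>\<in>R. entry_sum n (\<rho> y0 - \<rho> y) < e}"
  have V1: "openin T {y \<in> topspace T. entry_sum n (\<rho> y0 - \<rho> y) < e}" if \<rho>: "\<rho> \<in> R" for \<rho>
  proof -
    have u: "urep n \<rho>" using R[OF \<rho>] by (simp add: irreducible_iff)
    have "continuous_map T euclidean (\<lambda>y. \<Sum>i<n. \<Sum>j<n. cmod (\<rho> y0 $$ (i, j) - \<rho> y $$ (i, j)))"
      using cont_entry[OF u] by (auto simp: continuous_map_atin intro!: tendsto_sum tendsto_norm tendsto_diff)
    moreover have "(\<Sum>i<n. \<Sum>j<n. cmod (\<rho> y0 $$ (i, j) - \<rho> y $$ (i, j))) = entry_sum n (\<rho> y0 - \<rho> y)"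
      if y: "y \<in> topspace T" for y
      unfolding entry_sum_def using unitary_repD(1)[OF u y0] unitary_repD(1)[OF u, of y] y
      by (intro sum.cong) (auto simp: topspace_eq)
    ultimately have c: "continuous_map T euclidean (\<lambda>y. entry_sum n (\<rho> y0 - \<rho> y))"
      by (rule continuous_map_eq)
    have "openin T {y \<in> topspace T. entry_sum n (\<rho> y0 - \<rho> y) \<in> {..<e}}"
      by (rule openin_continuous_map_preimage[OF c]) simp
    then show ?thesis by simp
  qed
  have "V = (if R = {} then topspace T else (\<Inter>\<rho>\<in>R. {y \<in> topspace T. entry_sum n (\<rho> y0 - \<rho> y) < e}))"
    unfolding V_def by auto
  moreover have "openin T (\<Inter>\<rho>\<in>R. {y \<in> topspace T. entry_sum n (\<rho> y0 - \<rho> y) < e})" if "R \<noteq> {}"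
    using finR V1 that by (intro openin_Inter) auto
  ultimately have "openin T V" by simp
  moreover have "y0 \<in> V"
  proof -
    have "entry_sum n (\<rho> y0 - \<rho> y0) = 0" if "\<rho> \<in> R" for \<rho>
    proof -
      have "urep n \<rho>" using R[OF that] by (simp add: irreducible_iff)
      from unitary_repD(1)[OF this y0] show ?thesis unfolding entry_sum_def by auto
    qed
    then show ?thesis using y0 e by (simp add: V_def topspace_eq)
  qed
  moreover have "op_norm (\<pi> y0 - \<pi> y) < e" if \<pi>: "irrep n \<pi>" and y: "y \<in> V" for \<pi> y
  proof -
    obtain \<rho> where \<rho>: "\<rho> \<in> R" "isomorphic_reps G n \<pi> \<rho>" using repr[OF \<pi>] by blast
    have \<rho>i: "irrep n \<rho>" using R[OF \<rho>(1)] by simp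
    have yG: "y \<in> carrier G" using y by (simp add: V_def topspace_eq)
    have "\<rho> y0 - \<rho> y \<in> carrier_mat n n"
      using \<rho>i unitary_repD(1)[of T n \<rho> y0] unitary_repD(1)[of T n \<rho> y] y0 yG by (auto simp: irreducible_iff)
    then have "op_norm (\<rho> y0 - \<rho> y) \<le> entry_sum n (\<rho> y0 - \<rho> y)" by (rule op_norm_le_entry_sum)
    also have "\<dots> < e" using y \<rho>(1) by (simp add: V_def)
    finally show ?thesis using isomorphic_op_norm_le[OF \<pi> _ \<rho>(2) y0 yG] \<rho>i by (simp add: irreducible_iff)
  qed
  ultimately show ?thesis by blast
qed

text \<open>
  The element 0 keeps the set non-empty, whatever the irreducible representations are.
\<close>

definition rep_dists :: "'a \<Rightarrow> 'a \<Rightarrow> real set" where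
  "rep_dists x y = insert 0 {op_norm (\<pi> x - \<pi> y) / real n | n \<pi>. irrep n \<pi>}"

text \<open>
  Outside the carrier the value is 0, because symmetry and non-negativity of a metric are required
  of all arguments.
\<close>

definition rep_dist :: "'a \<Rightarrow> 'a \<Rightarrow> real" where
  "rep_dist x y = (if x \<in> carrier G \<and> y \<in> carrier G then Sup (rep_dists x y) else 0)"

lemma rep_dists_le:
  assumes \<pi>: "irrep n \<pi>" and xy: "x \<in> carrier G" "y \<in> carrier G"
  shows "op_norm (\<pi> x - \<pi> y) / real n \<le> 2 / real n"
  using op_norm_diff_unitary_le[of T n \<pi> x y] \<pi> xy by (auto simp: irreducible_iff divide_right_mono)

lemma rep_dists_bdd:
  assumes xy: "x \<in> carrier G" "y \<in> carrier G" shows "bdd_above (rep_dists x y)"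
proof (rule bdd_aboveI[of _ 2])
  fix z assume "z \<in> rep_dists x y"
  then consider "z = 0" | n \<pi> where "irrep n \<pi>" "z = op_norm (\<pi> x - \<pi> y) / real n"
    unfolding rep_dists_def by blast
  then show "z \<le> 2"
  proof cases
    case 2
    then have "n > 0" by (simp add: irreducible_iff)
    then have "2 / real n \<le> 2" by (simp add: divide_le_eq)
    then show ?thesis using rep_dists_le[OF 2(1) xy] 2(2) by linarith
  qed simp
qed

lemma op_norm_le_rep_dist:
  assumes \<pi>: "irrep n \<pi>" and xy: "x \<in> carrier G" "y \<in> carrier G"
  shows "op_norm (\<pi> x - \<pi> y) \<le> real n * rep_dist x y"
proof -
  have n: "n > 0" using \<pi> by (simp add: irreducible_iff)
  have "op_norm (\<pi> x - \<pi> y) / real n \<in> rep_dists x y" unfolding rep_dists_def using \<pi> by blast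
  then have "op_norm (\<pi> x - \<pi> y) / real n \<le> rep_dist x y"
    using xy by (simp add: rep_dist_def cSup_upper rep_dists_bdd)
  then show ?thesis using n by (simp add: divide_le_eq mult.commute)
qed

lemma rep_dist_nonneg: "0 \<le> rep_dist x y"
  unfolding rep_dist_def using rep_dists_bdd by (auto simp: rep_dists_def intro!: cSup_upper)

lemma rep_dist_le:
  assumes xy: "x \<in> carrier G" "y \<in> carrier G" and c: "c \<ge> 0"
    and le: "\<And>n \<pi>. irrep n \<pi> \<Longrightarrow> urep n \<pi> \<Longrightarrow> n > 0 \<Longrightarrow> op_norm (\<pi> x - \<pi> y) \<le> real n * c"
  shows "rep_dist x y \<le> c"
proof -
  have "Sup (rep_dists x y) \<le> c"
  proof (rule cSup_least)
    show "rep_dists x y \<noteq> {}" by (simp add: rep_dists_def)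
    fix z assume "z \<in> rep_dists x y"
    then consider "z = 0" | n \<pi> where "irrep n \<pi>" "z = op_norm (\<pi> x - \<pi> y) / real n"
      unfolding rep_dists_def by blast
    then show "z \<le> c"
    proof cases
      case 2
      then have "n > 0" "urep n \<pi>" by (auto simp: irreducible_iff)
      with le[OF 2(1)] show ?thesis unfolding 2(2) by (simp add: divide_le_eq mult.commute)
    qed (use c in simp)
  qed
  then show ?thesis using xy by (simp add: rep_dist_def)
qed

lemma rep_dist_metric:
  assumes H: "Hausdorff_space T" shows "Metric_space (carrier G) rep_dist"
proof
  fix x y
  show "0 \<le> rep_dist x y" by (rule rep_dist_nonneg)
  have "rep_dist x y \<le> rep_dist y x" if xy: "x \<in> carrier G" "y \<in> carrier G" for x y
  proof (rule rep_dist_le[OF xy rep_dist_nonneg])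
    fix n \<pi> assume \<pi>: "irrep n \<pi>" and u: "urep n \<pi>"
    have "op_norm (\<pi> x - \<pi> y) = op_norm (\<pi> y - \<pi> x)"
      using unitary_repD(1)[OF u] xy by (intro op_norm_minus_commute)
    then show "op_norm (\<pi> x - \<pi> y) \<le> real n * rep_dist y x" using op_norm_le_rep_dist[OF \<pi> xy(2,1)] by simp
  qed
  then show "rep_dist x y = rep_dist y x" by (metis antisym rep_dist_def)
next
  fix x y assume xy: "x \<in> carrier G" "y \<in> carrier G"
  show "rep_dist x y = 0 \<longleftrightarrow> x = y"
  proof
    assume "x = y"
    have "rep_dist x x \<le> 0"
    proof (rule rep_dist_le[OF xy(1) xy(1)])
      fix n \<pi> assume u: "urep n \<pi>"
      have c: "\<pi> x \<in> carrier_mat n n" by (rule unitary_repD(1)[OF u xy(1)])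
      then have "\<pi> x - \<pi> x \<in> carrier_mat n n" by auto
      from op_norm_le_entry_sum[OF this] show "op_norm (\<pi> x - \<pi> x) \<le> real n * 0"
        using c by (auto simp: entry_sum_def)
    qed simp
    then show "rep_dist x y = 0" using rep_dist_nonneg[of x x] \<open>x = y\<close> by simp
  next
    assume d0: "rep_dist x y = 0"
    have "inv y \<otimes> x = \<one>"
    proof (rule irreducible_reps_separate[OF H])
      show "inv y \<otimes> x \<in> carrier G" using xy by simp
      fix n \<pi> assume \<pi>: "irrep n \<pi>"
      have u: "urep n \<pi>" using \<pi> by (simp add: irreducible_iff)
      note r = unitary_repD[OF u]
      have c: "\<pi> x \<in> carrier_mat n n" "\<pi> y \<in> carrier_mat n n" using r(1) xy by auto
      have dc: "\<pi> x - \<pi> y \<in> carrier_mat n n" using c by auto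
      have "op_norm (\<pi> x - \<pi> y) \<le> 0" using op_norm_le_rep_dist[OF \<pi> xy] d0 by simp
      then have z: "cmod ((\<pi> x - \<pi> y) $$ (i, j)) \<le> 0" if "i < n" "j < n" for i j
        using norm_entry_le_op_norm[OF dc that] by linarith
      have "\<pi> x = \<pi> y"
      proof (rule eq_matI)
        fix i j assume "i < dim_row (\<pi> y)" "j < dim_col (\<pi> y)"
        then have "i < n" "j < n" using c by auto
        from z[OF this] show "\<pi> x $$ (i, j) = \<pi> y $$ (i, j)" using c \<open>i < n\<close> \<open>j < n\<close> by simp
      qed (use c in auto)
      then have "\<pi> (inv y \<otimes> x) = \<pi> (inv y) * \<pi> y" using r(4)[of "inv y" x] xy by simp
      also have "\<dots> = \<pi> (inv y \<otimes> y)" using r(4)[of "inv y" y] xy by simp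
      finally show "\<pi> (inv y \<otimes> x) = 1\<^sub>m n" using xy unitary_rep_one[OF u] by simp
    qed
    then have "y \<otimes> (inv y \<otimes> x) = y \<otimes> \<one>" by simp
    then show "x = y" using xy by (simp flip: m_assoc)
  qed
next
  fix x y z assume xyz: "x \<in> carrier G" "y \<in> carrier G" "z \<in> carrier G"
  show "rep_dist x z \<le> rep_dist x y + rep_dist y z"
  proof (rule rep_dist_le)
    fix n \<pi> assume \<pi>: "irrep n \<pi>" and u: "urep n \<pi>"
    have c: "\<pi> x \<in> carrier_mat n n" "\<pi> y \<in> carrier_mat n n" "\<pi> z \<in> carrier_mat n n"
      using unitary_repD(1)[OF u] xyz by auto
    have d: "\<pi> x - \<pi> y \<in> carrier_mat n n" "\<pi> y - \<pi> z \<in> carrier_mat n n" using c by auto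
    have "\<pi> x - \<pi> z = (\<pi> x - \<pi> y) + (\<pi> y - \<pi> z)" using c by (intro eq_matI) auto
    then have "op_norm (\<pi> x - \<pi> z) \<le> op_norm (\<pi> x - \<pi> y) + op_norm (\<pi> y - \<pi> z)"
      using op_norm_triangle[OF d] by simp
    also have "\<dots> \<le> real n * (rep_dist x y + rep_dist y z)"
      using op_norm_le_rep_dist[OF \<pi> xyz(1,2)] op_norm_le_rep_dist[OF \<pi> xyz(2,3)] by (simp add: distrib_left)
    finally show "op_norm (\<pi> x - \<pi> z) \<le> real n * (rep_dist x y + rep_dist y z)" .
  qed (use xyz rep_dist_nonneg in auto)
qed

lemma rep_dist_biinvariant:
  assumes xy: "x \<in> carrier G" "y \<in> carrier G" "g \<in> carrier G"
  shows "rep_dist (g \<otimes> x) (g \<otimes> y) = rep_dist x y" "rep_dist (x \<otimes> g) (y \<otimes> g) = rep_dist x y"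
proof -
  have le: "rep_dist (g \<otimes> x) (g \<otimes> y) \<le> rep_dist x y" "rep_dist (x \<otimes> g) (y \<otimes> g) \<le> rep_dist x y"
    if xy: "x \<in> carrier G" "y \<in> carrier G" "g \<in> carrier G" for x y g
  proof -
    show "rep_dist (g \<otimes> x) (g \<otimes> y) \<le> rep_dist x y"
    proof (rule rep_dist_le)
      fix n \<pi> assume \<pi>: "irrep n \<pi>" and u: "urep n \<pi>"
      show "op_norm (\<pi> (g \<otimes> x) - \<pi> (g \<otimes> y)) \<le> real n * rep_dist x y"
        using op_norm_translate(1)[OF u xy] op_norm_le_rep_dist[OF \<pi> xy(1,2)] by linarith
    qed (use xy rep_dist_nonneg in auto)
    show "rep_dist (x \<otimes> g) (y \<otimes> g) \<le> rep_dist x y"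
    proof (rule rep_dist_le)
      fix n \<pi> assume \<pi>: "irrep n \<pi>" and u: "urep n \<pi>"
      show "op_norm (\<pi> (x \<otimes> g) - \<pi> (y \<otimes> g)) \<le> real n * rep_dist x y"
        using op_norm_translate(2)[OF u xy] op_norm_le_rep_dist[OF \<pi> xy(1,2)] by linarith
    qed (use xy rep_dist_nonneg in auto)
  qed
  have "inv g \<otimes> (g \<otimes> x) = x" "inv g \<otimes> (g \<otimes> y) = y" using xy by (simp_all flip: m_assoc)
  then show "rep_dist (g \<otimes> x) (g \<otimes> y) = rep_dist x y"
    using le(1)[OF xy] le(1)[of "g \<otimes> x" "g \<otimes> y" "inv g"] xy by simp
  have "(x \<otimes> g) \<otimes> inv g = x" "(y \<otimes> g) \<otimes> inv g = y" using xy by (simp_all add: m_assoc)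
  then show "rep_dist (x \<otimes> g) (y \<otimes> g) = rep_dist x y"
    using le(2)[OF xy] le(2)[of "x \<otimes> g" "y \<otimes> g" "inv g"] xy by simp
qed

text \<open>
  Representations of degree greater than \<open>4 / e\<close> contribute at most \<open>e / 2\<close>, since the norm of \<open>\<pi> x - \<pi> y\<close> is
  at most 2; the finitely many remaining degrees are controlled by finitely many neighbourhoods.
\<close>

lemma rep_dist_nbhd:
  assumes fin: "\<And>n. n > 0 \<Longrightarrow> finite (irrep_classes G T n)" and y0: "y0 \<in> carrier G" and e: "e > 0"
  shows "\<exists>V. openin T V \<and> y0 \<in> V \<and> (\<forall>y\<in>V. rep_dist y0 y < e)"
proof -
  obtain N :: nat where N: "4 / e < real N" using reals_Archimedean2 by blast
  have e2: "e / 2 > 0" using e by simp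
  have "\<forall>n. \<exists>V. openin T V \<and> y0 \<in> V \<and> (\<forall>\<pi>. irrep n \<pi> \<longrightarrow> (\<forall>y\<in>V. op_norm (\<pi> y0 - \<pi> y) < e / 2))"
    using irreps_nbhd[OF fin y0 e2] by blast
  from choice[OF this] obtain V where V: "\<And>n. openin T (V n)" "\<And>n. y0 \<in> V n"
    "\<And>n \<pi> y. irrep n \<pi> \<Longrightarrow> y \<in> V n \<Longrightarrow> op_norm (\<pi> y0 - \<pi> y) < e / 2" by blast
  let ?V = "\<Inter>n\<in>{..N}. V n"
  have "openin T ?V" using V(1) by (intro openin_Inter) auto
  moreover have "y0 \<in> ?V" using V(2) by blast
  moreover have "rep_dist y0 y < e" if y: "y \<in> ?V" for y
  proof -
    have yG: "y \<in> carrier G" using y V(1)[of 0] openin_subset topspace_eq by fastforce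
    have "rep_dist y0 y \<le> e / 2"
    proof (rule rep_dist_le[OF y0 yG])
      fix n \<pi> assume \<pi>: "irrep n \<pi>" and u: "urep n \<pi>" and n: "n > 0"
      show "op_norm (\<pi> y0 - \<pi> y) \<le> real n * (e / 2)"
      proof (cases "n \<le> N")
        case True
        then have "y \<in> V n" using y by blast
        then have "op_norm (\<pi> y0 - \<pi> y) < e / 2" by (rule V(3)[OF \<pi>])
        moreover have "1 * (e / 2) \<le> real n * (e / 2)" using n e by (intro mult_right_mono) auto
        ultimately show ?thesis by simp
      next
        case False
        then have "real N \<le> real n" by simp
        then have "4 / e < real n" using N by linarith
        then have "2 \<le> real n * (e / 2)" using e by (simp add: field_simps)
        then show ?thesis using op_norm_diff_unitary_le[OF u y0 yG] by linarith
      qed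
    qed (use e in simp)
    then show ?thesis using e by simp
  qed
  ultimately show ?thesis by blast
qed

text \<open>
  The identity from the compact space \<open>T\<close> to the Hausdorff metric topology is continuous, hence closed.
\<close>

lemma rep_dist_topology:
  assumes H: "Hausdorff_space T" and fin: "\<And>n. n > 0 \<Longrightarrow> finite (irrep_classes G T n)"
  shows "Metric_space.mtopology (carrier G) rep_dist = T"
proof -
  interpret D: Metric_space "carrier G" rep_dist by (rule rep_dist_metric[OF H])
  have c: "continuous_map T D.mtopology (\<lambda>x. x)"
    unfolding D.continuous_map_to_metric
  proof (intro ballI allI impI)
    fix y0 e assume y0: "y0 \<in> topspace T" and e: "e > (0 :: real)"
    have y0G: "y0 \<in> carrier G" using y0 by (simp add: topspace_eq)
    obtain V where V: "openin T V" "y0 \<in> V" "\<forall>y\<in>V. rep_dist y0 y < e"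
      using rep_dist_nbhd[OF fin y0G e] by blast
    have "V \<subseteq> carrier G" using V(1) openin_subset topspace_eq by blast
    then show "\<exists>U. openin T U \<and> y0 \<in> U \<and> (\<forall>y\<in>U. y \<in> D.mball y0 e)"
      using V y0G by (intro exI[of _ V]) (auto simp: D.in_mball)
  qed
  have "closed_map T D.mtopology (\<lambda>x. x)"
    by (rule continuous_imp_closed_map[OF c compact D.Hausdorff_space_mtopology])
  then have 1: "closedin D.mtopology S" if "closedin T S" for S
    using that by (simp add: closed_map_def)
  have tops: "topspace D.mtopology = topspace T" by (simp add: topspace_eq)
  have "openin D.mtopology U \<longleftrightarrow> openin T U" for U
  proof
    assume U: "openin D.mtopology U"
    then have "openin T {x \<in> topspace T. x \<in> U}" by (rule openin_continuous_map_preimage[OF c])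
    moreover have "{x \<in> topspace T. x \<in> U} = U" using openin_subset[OF U] tops by blast
    ultimately show "openin T U" by simp
  next
    assume U: "openin T U"
    then have "closedin D.mtopology (topspace T - U)" by (intro 1) blast
    then have "openin D.mtopology (topspace D.mtopology - (topspace T - U))"
      by (rule openin_diff[OF openin_topspace])
    moreover have "topspace D.mtopology - (topspace T - U) = U" using openin_subset[OF U] tops by blast
    ultimately show "openin D.mtopology U" by simp
  qed
  then show ?thesis by (simp add: topology_eq)
qed

lemma finite_imp_locally_random:
  assumes H: "Hausdorff_space T" and fin: "\<And>n. n > 0 \<Longrightarrow> finite (irrep_classes G T n)"
  shows "locally_random G T"
proof -
  have "compatible_biinvariant_metric G T rep_dist"
    unfolding compatible_biinvariant_metric_def
    using rep_dist_metric[OF H] rep_dist_topology[OF H fin] rep_dist_biinvariant by blast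
  moreover have "locally_random_wrt G T rep_dist 1 1"
    unfolding locally_random_wrt_def using op_norm_le_rep_dist by (auto simp: irreducible_iff)
  ultimately show ?thesis unfolding locally_random_def by (intro exI[of _ rep_dist] exI[of _ 1]) auto
qed

end

section \<open>The characterisation of locally random groups\<close>

theorem theorem2p3:
  fixes G :: "('a, 'b) monoid_scheme" and T :: "'a topology"
  assumes "topological_group G T"
    and "compact_space T" and "Hausdorff_space T" and "second_countable T"
  shows "locally_random G T \<longleftrightarrow> (\<forall>n>0. finite (irrep_classes G T n))"
proof -
  interpret compact_group G T
    using assms(1,2) by (simp add: compact_group_def compact_group_axioms_def)
  show ?thesis
    using locally_random_imp_finite finite_imp_locally_random[OF assms(3)] by blast
qed

end
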